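(* Let $2<p,q<\infty$. Then there is a closed subspace $X\subset\ell^q$ that fails the $\mathcal{SK}_r$-approximation property for all real $r\ge p$.
   Context: All Banach spaces are over the same, either real or complex, scalar field. $B_X$ denotes the closed unit ball of $X$, and $r'$ the dual exponent of $r$ ($1/r+1/r'=1$). $\mathcal L(X,Y)$ denotes the bounded linear operators and $\mathcal F(X,Y)$ the bounded finite-rank operators $X\to Y$. For $1\le r<\infty$, $\ell^r_s(Y)$ is the space of strongly $r$-summable sequences $(y_k)$ in $Y$, with norm $\|(y_k)\|_r=\big(\sum_k\|y_k\|^r\big)^{1/r}$. For $(y_k)\in\ell^r_s(Y)$ put $r\text{-co}\{y_k\}=\{\sum_{k=1}^\infty\lambda_ky_k\mid(\lambda_k)\in B_{\ell^{r'}}\}$ (with $B_{c_0}$ in place of $B_{\ell^{r'}}$ if $r=1$). An operator $T\in\mathcal L(X,Y)$ is Sinha-Karn $r$-compact, $T\in\mathcal{SK}_r(X,Y)$, if $T(B_X)\subset r\text{-co}\{y_k\}$ for some $(y_k)\in\ell^r_s(Y)$. Its norm is $\|T\|_{\mathcal{SK}_r}=\inf\|(y_k)\|_r$, the infimum being over all such $(y_k)\in\ell^r_s(Y)$. With this norm $\mathcal{SK}_r$ is a Banach operator ideal. A Banach space $X$ has the $\mathcal{SK}_r$-approximation property if for every Banach space $Y$ the space $\mathcal F(Y,X)$ is dense in $\mathcal{SK}_r(Y,X)$ with respect to $\|\cdot\|_{\mathcal{SK}_r}$. *)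

theory Defs
  imports "HOL-Analysis.Analysis" "HOL-Library.Function_Algebras"
begin

text \<open>
  The spaces below are not types: the closed subspaces of \<open>\<ell>\<^sup>q\<close> and the test spaces of the approximation
  property are quantified over inside formulas. A normed space is therefore a linear subspace
  \<open>vecs\<close> of an ambient vector space, with scalar multiplication \<open>scl\<close>, together with a norm \<open>nrm\<close> of
  which only the values on \<open>vecs\<close> matter. The scalar field \<open>'k\<close> is \<open>real\<close> or \<open>complex\<close>.
\<close>

record ('k, 'a) nspace =
  vecs :: "'a set"
  scl :: "'k \<Rightarrow> 'a \<Rightarrow> 'a"
  nrm :: "'a \<Rightarrow> real"

definition banach_space :: "('k::real_normed_field, 'a::ab_group_add) nspace \<Rightarrow> bool" where
  "banach_space X \<longleftrightarrow>
     vector_space (scl X) \<and> module.subspace (scl X) (vecs X) \<and>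
     (\<forall>x\<in>vecs X. 0 \<le> nrm X x \<and> (nrm X x = 0 \<longleftrightarrow> x = 0)) \<and>
     (\<forall>x\<in>vecs X. \<forall>c. nrm X (scl X c x) = norm c * nrm X x) \<and>
     (\<forall>x\<in>vecs X. \<forall>y\<in>vecs X. nrm X (x + y) \<le> nrm X x + nrm X y) \<and>
     (\<forall>f::nat \<Rightarrow> 'a. range f \<subseteq> vecs X \<and>
        (\<forall>e>0. \<exists>M. \<forall>m\<ge>M. \<forall>n\<ge>M. nrm X (f m - f n) < e) \<longrightarrow>
        (\<exists>x\<in>vecs X. (\<lambda>n. nrm X (f n - x)) \<longlonglongrightarrow> 0))"

definition unit_ball :: "('k, 'a) nspace \<Rightarrow> 'a set" where
  "unit_ball X = {x \<in> vecs X. nrm X x \<le> 1}"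

definition closed_subspace :: "('k::real_normed_field, 'a::ab_group_add) nspace \<Rightarrow> 'a set \<Rightarrow> bool" where
  "closed_subspace E V \<longleftrightarrow>
     V \<subseteq> vecs E \<and> module.subspace (scl E) V \<and>
     (\<forall>f x. range f \<subseteq> V \<and> x \<in> vecs E \<and> (\<lambda>n::nat. nrm E (f n - x)) \<longlonglongrightarrow> 0 \<longrightarrow> x \<in> V)"

text \<open>The space \<open>\<ell>\<^sup>q\<close>, for real \<open>q \<ge> 1\<close>.\<close>

definition ell :: "real \<Rightarrow> ('k::real_normed_field, nat \<Rightarrow> 'k) nspace" where
  "ell q = \<lparr>vecs = {x. summable (\<lambda>n. norm (x n) powr q)},
            scl = (\<lambda>c x n. c * x n),
            nrm = (\<lambda>x. (\<Sum>n. norm (x n) powr q) powr (1 / q))\<rparr>"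

definition bounded_op ::
  "('k::real_normed_field, 'b::ab_group_add) nspace \<Rightarrow> ('k, 'a::ab_group_add) nspace \<Rightarrow> ('b \<Rightarrow> 'a) set" where
  "bounded_op Y X = {T. T ` vecs Y \<subseteq> vecs X \<and>
     (\<forall>y\<in>vecs Y. \<forall>z\<in>vecs Y. T (y + z) = T y + T z) \<and>
     (\<forall>y\<in>vecs Y. \<forall>c. T (scl Y c y) = scl X c (T y)) \<and>
     (\<exists>C. \<forall>y\<in>vecs Y. nrm X (T y) \<le> C * nrm Y y)}"

definition finite_rank_op ::
  "('k::real_normed_field, 'b::ab_group_add) nspace \<Rightarrow> ('k, 'a::ab_group_add) nspace \<Rightarrow> ('b \<Rightarrow> 'a) set" where
  "finite_rank_op Y X = {T \<in> bounded_op Y X.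
     \<exists>B. finite B \<and> B \<subseteq> vecs X \<and> T ` vecs Y \<subseteq> module.span (scl X) B}"

definition strongly_summable :: "real \<Rightarrow> ('k, 'a) nspace \<Rightarrow> (nat \<Rightarrow> 'a) set" where
  "strongly_summable r X = {y. range y \<subseteq> vecs X \<and> summable (\<lambda>k. nrm X (y k) powr r)}"

definition strong_norm :: "real \<Rightarrow> ('k, 'a) nspace \<Rightarrow> (nat \<Rightarrow> 'a) \<Rightarrow> real" where
  "strong_norm r X y = (\<Sum>k. nrm X (y k) powr r) powr (1 / r)"

text \<open>The unit ball of \<open>\<ell>\<^sup>r\<^sup>'\<close>, respectively of \<open>c\<^sub>0\<close> if \<open>r = 1\<close>.\<close>

definition coeff_ball :: "real \<Rightarrow> (nat \<Rightarrow> 'k::real_normed_field) set" where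
  "coeff_ball r = (if r = 1 then {l. l \<longlonglongrightarrow> 0 \<and> (\<forall>k. norm (l k) \<le> 1)}
                   else unit_ball (ell (r / (r - 1))))"

definition r_co ::
  "real \<Rightarrow> ('k::real_normed_field, 'a::ab_group_add) nspace \<Rightarrow> (nat \<Rightarrow> 'a) \<Rightarrow> 'a set" where
  "r_co r X y = {x \<in> vecs X. \<exists>l\<in>coeff_ball r.
     (\<lambda>n. nrm X ((\<Sum>k<n. scl X (l k) (y k)) - x)) \<longlonglongrightarrow> 0}"

definition SK ::
  "real \<Rightarrow> ('k::real_normed_field, 'b::ab_group_add) nspace \<Rightarrow> ('k, 'a::ab_group_add) nspace \<Rightarrow> ('b \<Rightarrow> 'a) set" where
  "SK r Y X = {T \<in> bounded_op Y X. \<exists>y\<in>strongly_summable r X. T ` unit_ball Y \<subseteq> r_co r X y}"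

definition SK_norm ::
  "real \<Rightarrow> ('k::real_normed_field, 'b::ab_group_add) nspace \<Rightarrow> ('k, 'a::ab_group_add) nspace \<Rightarrow> ('b \<Rightarrow> 'a) \<Rightarrow> real" where
  "SK_norm r Y X T =
     Inf {strong_norm r X y | y. y \<in> strongly_summable r X \<and> T ` unit_ball Y \<subseteq> r_co r X y}"

text \<open>
  The test space \<open>Y\<close> ranges over the Banach spaces in the ambient type \<open>'a\<close> of \<open>X\<close>. This is no
  restriction, by the lemma \<open>SK_AP_universal\<close> below: an operator \<open>T : Y \<rightarrow> X\<close> can be replaced by the
  inclusion into \<open>X\<close> of its range with the quotient norm of \<open>Y / ker T\<close>. The condition
  \<open>(\<lambda>y. T y - S y) \<in> SK r Y X\<close>, which holds automatically, keeps the infimum in \<open>SK_norm\<close> away from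
  the empty set.
\<close>

definition SK_AP :: "real \<Rightarrow> ('k::real_normed_field, 'a::ab_group_add) nspace \<Rightarrow> bool" where
  "SK_AP r X \<longleftrightarrow>
     (\<forall>Y::('k, 'a) nspace. banach_space Y \<longrightarrow>
        (\<forall>T\<in>SK r Y X. \<forall>e>0. \<exists>S\<in>finite_rank_op Y X.
           (\<lambda>y. T y - S y) \<in> SK r Y X \<and> SK_norm r Y X (\<lambda>y. T y - S y) < e))"

lemma SK_AP_universal:
  fixes X :: "('k::real_normed_field, 'a::ab_group_add) nspace"
    and Y :: "('k, 'b::ab_group_add) nspace"
  assumes X: "banach_space X" and Y: "banach_space Y" and AP: "SK_AP r X"
    and T: "T \<in> SK r Y X" and e: "0 < e"
  shows "\<exists>S\<in>finite_rank_op Y X.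
           (\<lambda>y. T y - S y) \<in> SK r Y X \<and> SK_norm r Y X (\<lambda>y. T y - S y) < e"
proof -
  interpret vX: vector_space "scl X" using X by (simp add: banach_space_def)
  interpret vY: vector_space "scl Y" using Y by (simp add: banach_space_def)
  have sX: "vX.subspace (vecs X)" and sY: "vY.subspace (vecs Y)"
    using X Y by (auto simp: banach_space_def)
  have nX: "\<And>x. x \<in> vecs X \<Longrightarrow> 0 \<le> nrm X x" "\<And>x. x \<in> vecs X \<Longrightarrow> nrm X x = 0 \<longleftrightarrow> x = 0"
    "\<And>x c. x \<in> vecs X \<Longrightarrow> nrm X (scl X c x) = norm c * nrm X x"
    using X unfolding banach_space_def by blast+
  have nY: "\<And>x. x \<in> vecs Y \<Longrightarrow> 0 \<le> nrm Y x" "\<And>x. x \<in> vecs Y \<Longrightarrow> nrm Y x = 0 \<longleftrightarrow> x = 0"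
    "\<And>x c. x \<in> vecs Y \<Longrightarrow> nrm Y (scl Y c x) = norm c * nrm Y x"
    "\<And>x y. x \<in> vecs Y \<Longrightarrow> y \<in> vecs Y \<Longrightarrow> nrm Y (x + y) \<le> nrm Y x + nrm Y y"
    using Y unfolding banach_space_def by blast+
  note clX = vX.subspace_0[OF sX] vX.subspace_add[OF sX] vX.subspace_scale[OF sX]
    vX.subspace_diff[OF sX] vX.subspace_sum[OF sX]
  note clY = vY.subspace_0[OF sY] vY.subspace_add[OF sY] vY.subspace_scale[OF sY]
    vY.subspace_diff[OF sY] vY.subspace_sum[OF sY]
  have TX: "\<And>y. y \<in> vecs Y \<Longrightarrow> T y \<in> vecs X"
    and Tadd: "\<And>y z. y \<in> vecs Y \<Longrightarrow> z \<in> vecs Y \<Longrightarrow> T (y + z) = T y + T z"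
    and Tscl: "\<And>y c. y \<in> vecs Y \<Longrightarrow> T (scl Y c y) = scl X c (T y)"
    using T by (auto simp: SK_def bounded_op_def)
  have T0: "T 0 = 0" using Tadd[of 0 0] clY(1) by simp
  have Tdiff: "T (y - z) = T y - T z" if "y \<in> vecs Y" "z \<in> vecs Y" for y z
    using Tadd[of "y - z" z] that clY(4) by (simp add: algebra_simps)
  obtain C0 where C0: "\<And>y. y \<in> vecs Y \<Longrightarrow> nrm X (T y) \<le> C0 * nrm Y y"
  proof -
    have "\<exists>C. \<forall>y\<in>vecs Y. nrm X (T y) \<le> C * nrm Y y" using T by (simp add: SK_def bounded_op_def)
    then show ?thesis using that by blast
  qed
  define C where "C = max C0 1"
  have C: "nrm X (T y) \<le> C * nrm Y y" if "y \<in> vecs Y" for y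
    using C0[OF that] mult_right_mono[of C0 C "nrm Y y"] nY(1)[OF that] by (auto simp: C_def)
  have Cpos: "C > 0" by (simp add: C_def)
  define N where "N z = Inf (nrm Y ` {y \<in> vecs Y. T y = z})" for z
  define Z where "Z = \<lparr>vecs = T ` vecs Y, scl = scl X, nrm = N\<rparr>"
  have Zs [simp]: "vecs Z = T ` vecs Y" "scl Z = scl X" "nrm Z = N" by (simp_all add: Z_def)
  have bdd: "bdd_below (nrm Y ` {y \<in> vecs Y. T y = z})" for z
    using nY(1) by (auto intro!: bdd_belowI[of _ 0])
  have N1: "N (T y) \<le> nrm Y y" if "y \<in> vecs Y" for y
    unfolding N_def by (rule cInf_lower[OF _ bdd]) (use that in auto)
  have N2: "\<exists>y\<in>vecs Y. T y = z \<and> nrm Y y < b" if "z \<in> T ` vecs Y" "N z < b" for z b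
    using cInf_lessD[of "nrm Y ` {y \<in> vecs Y. T y = z}" b] that unfolding N_def by auto
  have N3: "0 \<le> N z" if "z \<in> T ` vecs Y" for z
    unfolding N_def by (rule cInf_greatest) (use that nY(1) in auto)
  have sZ: "vX.subspace (T ` vecs Y)"
  proof (rule vX.subspaceI)
    show "0 \<in> T ` vecs Y" using T0 clY(1) by force
    show "x + y \<in> T ` vecs Y" if "x \<in> T ` vecs Y" "y \<in> T ` vecs Y" for x y
      using that Tadd clY(2) by (metis (no_types, lifting) image_iff)
    show "scl X c x \<in> T ` vecs Y" if "x \<in> T ` vecs Y" for c x
      using that Tscl clY(3) by (metis (no_types, lifting) image_iff)
  qed
  note clZ = vX.subspace_0[OF sZ] vX.subspace_add[OF sZ] vX.subspace_scale[OF sZ]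
    vX.subspace_diff[OF sZ]
  have NC: "nrm X z \<le> C * N z" if z: "z \<in> T ` vecs Y" for z
  proof (rule field_le_epsilon)
    fix d :: real assume "d > 0"
    then obtain y where y: "y \<in> vecs Y" "T y = z" "nrm Y y < N z + d / C"
      using N2[OF z, of "N z + d / C"] Cpos by auto
    have "nrm X z \<le> C * nrm Y y" using C[OF y(1)] y(2) by simp
    also have "\<dots> \<le> C * (N z + d / C)" using y(3) Cpos by (intro mult_left_mono) auto
    also have "\<dots> = C * N z + d" using Cpos by (simp add: field_simps)
    finally show "nrm X z \<le> C * N z + d" .
  qed
  have N0: "N 0 = 0" using N1[OF clY(1)] N3[OF clZ(1)] nY(2)[OF clY(1)] T0 by simp
  have Ntri: "N (z + w) \<le> N z + N w" if z: "z \<in> T ` vecs Y" and w: "w \<in> T ` vecs Y" for z w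
  proof (rule field_le_epsilon)
    fix d :: real assume d: "d > 0"
    obtain y where y: "y \<in> vecs Y" "T y = z" "nrm Y y < N z + d / 2"
      using N2[OF z, of "N z + d / 2"] d by auto
    obtain u where u: "u \<in> vecs Y" "T u = w" "nrm Y u < N w + d / 2"
      using N2[OF w, of "N w + d / 2"] d by auto
    have "N (z + w) \<le> nrm Y (y + u)"
      using N1[OF clY(2)[OF y(1) u(1)]] Tadd[OF y(1) u(1)] y(2) u(2) by simp
    also have "\<dots> \<le> nrm Y y + nrm Y u" by (rule nY(4)[OF y(1) u(1)])
    finally show "N (z + w) \<le> N z + N w + d" using y(3) u(3) by simp
  qed
  have Nscl_le: "N (scl X c z) \<le> norm c * N z" if z: "z \<in> T ` vecs Y" and c: "c \<noteq> 0" for c z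
  proof (rule field_le_epsilon)
    fix d :: real assume d: "d > 0"
    then obtain y where y: "y \<in> vecs Y" "T y = z" "nrm Y y < N z + d / norm c"
      using N2[OF z, of "N z + d / norm c"] c by auto
    have "N (scl X c z) \<le> nrm Y (scl Y c y)"
      using N1[OF clY(3)[OF y(1)]] Tscl[OF y(1)] y(2) by simp
    also have "\<dots> = norm c * nrm Y y" by (rule nY(3)[OF y(1)])
    also have "\<dots> \<le> norm c * (N z + d / norm c)" using y(3) by (intro mult_left_mono) auto
    also have "\<dots> = norm c * N z + d" using c by (simp add: field_simps)
    finally show "N (scl X c z) \<le> norm c * N z + d" .
  qed
  have Nscl: "N (scl X c z) = norm c * N z" if z: "z \<in> T ` vecs Y" for c z
  proof (cases "c = 0")
    case True then show ?thesis by (simp add: N0)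
  next
    case False
    have "N z = N (scl X (inverse c) (scl X c z))" using False by simp
    also have "\<dots> \<le> norm (inverse c) * N (scl X c z)"
      using Nscl_le[OF clZ(3)[OF z], of "inverse c" c] False by simp
    finally have "norm c * N z \<le> N (scl X c z)" using False
      by (simp add: norm_divide norm_inverse field_simps)
    then show ?thesis using Nscl_le[OF z False] by simp
  qed
  have Nneg: "N (z - w) = N (w - z)" if "z \<in> T ` vecs Y" "w \<in> T ` vecs Y" for z w
    using Nscl[OF clZ(4)[OF that], of "-1"] by simp
  have complete: "\<exists>z\<in>T ` vecs Y. (\<lambda>n. N (f n - z)) \<longlonglongrightarrow> 0"
    if fZ: "range f \<subseteq> T ` vecs Y" and cauchy: "\<forall>e>0. \<exists>M. \<forall>m\<ge>M. \<forall>n\<ge>M. N (f m - f n) < e"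
    for f :: "nat \<Rightarrow> 'a"
  proof -
    have f: "f n \<in> T ` vecs Y" for n using fZ by auto
    have "\<forall>k. \<exists>M. \<forall>m\<ge>M. \<forall>n\<ge>M. N (f m - f n) < (1/2)^k" using cauchy by simp
    then obtain M where M: "\<And>k m n. m \<ge> M k \<Longrightarrow> n \<ge> M k \<Longrightarrow> N (f m - f n) < (1/2)^k"
      by metis
    define \<phi> where "\<phi> k = (\<Sum>i\<le>k. M i)" for k :: nat
    have \<phi>: "\<phi> k \<ge> M k" "\<phi> (Suc k) \<ge> M k" for k
      by (auto simp: \<phi>_def intro!: member_le_sum trans_le_add1)
    have "\<forall>k. \<exists>y\<in>vecs Y. T y = f (\<phi> (Suc k)) - f (\<phi> k) \<and> nrm Y y < (1/2)^k"
      using N2 M \<phi> clZ(4)[OF f f] by meson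
    then obtain y where y: "\<And>k. y k \<in> vecs Y" "\<And>k. T (y k) = f (\<phi> (Suc k)) - f (\<phi> k)"
      "\<And>k. nrm Y (y k) < (1/2)^k" by metis
    obtain u where u: "u \<in> vecs Y" "T u = f (\<phi> 0)" using f[of "\<phi> 0"] by (metis imageE)
    define s where "s n = (\<Sum>k<n. y k)" for n
    have s: "s n \<in> vecs Y" for n unfolding s_def by (rule clY(5)) (rule y)
    have Ts: "T (u + s n) = f (\<phi> n)" for n
    proof (induction n)
      case 0 then show ?case using u by (simp add: s_def)
    next
      case (Suc n)
      have "u + s (Suc n) = (u + s n) + y n" by (simp add: s_def algebra_simps)
      then show ?case using Tadd[OF clY(2)[OF u(1) s] y(1)[of n]] Suc y(2)[of n] by (simp add: add.assoc)
    qed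
    have sdiff: "nrm Y (s (n + j) - s n) \<le> 2 * (1/2)^n - 2 * (1/2)^(n + j)" for n j
    proof (induction j)
      case 0 then show ?case using nY(2)[OF clY(1)] by simp
    next
      case (Suc j)
      have "s (n + Suc j) - s n = (s (n + j) - s n) + y (n + j)" by (simp add: s_def algebra_simps)
      then have "nrm Y (s (n + Suc j) - s n) \<le> nrm Y (s (n + j) - s n) + nrm Y (y (n + j))"
        using nY(4)[OF clY(4)[OF s s] y(1), of "n + j" n "n + j"] by metis
      then show ?case using Suc y(3)[of "n + j"] by simp
    qed
    have sd: "nrm Y (s m - s n) \<le> 2 * (1/2)^K" if "m \<ge> K" "n \<ge> K" for m n K
    proof -
      have neg: "nrm Y (s m - s n) = nrm Y (s n - s m)"
        using nY(3)[OF clY(4)[OF s s], of "-1" m n] by simp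
      have "nrm Y (s m - s n) \<le> 2 * (1/2)^(min m n)"
      proof (cases "n \<le> m")
        case True
        have "nrm Y (s m - s n) \<le> 2 * (1/2)^n - 2 * (1/2)^m" using sdiff[of n "m - n"] True by simp
        also have "\<dots> \<le> 2 * (1/2)^n" by simp
        finally show ?thesis using True by (simp add: min_absorb2)
      next
        case False
        have "nrm Y (s n - s m) \<le> 2 * (1/2)^m - 2 * (1/2)^n" using sdiff[of m "n - m"] False by simp
        also have "\<dots> \<le> 2 * (1/2)^m" by simp
        finally show ?thesis using False neg by (simp add: min_absorb1)
      qed
      also have "\<dots> \<le> 2 * (1/2)^K" using that by (simp add: power_decreasing)
      finally show ?thesis .
    qed
    have sC: "\<exists>K. \<forall>m\<ge>K. \<forall>n\<ge>K. nrm Y (s m - s n) < e" if "e > 0" for e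
    proof -
      obtain K where "(1/2)^K < e / 2" using real_arch_pow_inv[of "e/2" "1/2"] \<open>e > 0\<close> by auto
      then show ?thesis using sd[of K] by (intro exI[of _ K]) fastforce
    qed
    have "\<forall>f::nat \<Rightarrow> 'b. range f \<subseteq> vecs Y \<and>
        (\<forall>e>0. \<exists>M. \<forall>m\<ge>M. \<forall>n\<ge>M. nrm Y (f m - f n) < e) \<longrightarrow>
        (\<exists>x\<in>vecs Y. (\<lambda>n. nrm Y (f n - x)) \<longlonglongrightarrow> 0)"
      using Y unfolding banach_space_def by blast
    moreover have "range s \<subseteq> vecs Y" using s by auto
    ultimately have "\<exists>v\<in>vecs Y. (\<lambda>n. nrm Y (s n - v)) \<longlonglongrightarrow> 0" using sC by auto
    then obtain v where v: "v \<in> vecs Y" "(\<lambda>n. nrm Y (s n - v)) \<longlonglongrightarrow> 0" by blast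
    define z where "z = T (u + v)"
    have z: "z \<in> T ` vecs Y" unfolding z_def using clY(2)[OF u(1) v(1)] by simp
    have Nb: "N (f (\<phi> n) - z) \<le> nrm Y (s n - v)" for n
    proof -
      have "f (\<phi> n) - z = T ((u + s n) - (u + v))"
        using Tdiff[OF clY(2)[OF u(1) s] clY(2)[OF u(1) v(1)]] Ts by (simp add: z_def)
      then have "f (\<phi> n) - z = T (s n - v)" by simp
      then show ?thesis using N1[OF clY(4)[OF s v(1)]] by simp
    qed
    have "(\<lambda>n. N (f n - z)) \<longlonglongrightarrow> 0"
    proof (rule LIMSEQ_I)
      fix e :: real assume e: "e > 0"
      obtain n0 where n0: "\<And>n. n \<ge> n0 \<Longrightarrow> norm (nrm Y (s n - v) - 0) < e / 2"
        using LIMSEQ_D[OF v(2), of "e/2"] e by auto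
      obtain K where K: "(1/2)^K < e / 2" using real_arch_pow_inv[of "e/2" "1/2"] e by auto
      define n where "n = max n0 K"
      have Kn: "(1/2::real)^n \<le> (1/2)^K" by (rule power_decreasing) (auto simp: n_def)
      have nn: "n0 \<le> n" by (simp add: n_def)
      have "norm (N (f m - z) - 0) < e" if m: "m \<ge> M n" for m
      proof -
        have "N (f m - z) = N ((f m - f (\<phi> n)) + (f (\<phi> n) - z))" by simp
        also have "\<dots> \<le> N (f m - f (\<phi> n)) + N (f (\<phi> n) - z)"
          by (rule Ntri[OF clZ(4)[OF f f] clZ(4)[OF f z]])
        finally have "N (f m - z) < e"
          using M[OF m \<phi>(1)] Kn K n0[OF nn] Nb[of n] by (simp only: real_norm_def)
        then show ?thesis using N3[OF clZ(4)[OF f z]] by simp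
      qed
      then show "\<exists>no. \<forall>n\<ge>no. norm (N (f n - z) - 0) < e" by blast
    qed
    then show ?thesis using z by blast
  qed
  have Ndef: "z = 0" if "z \<in> T ` vecs Y" "N z = 0" for z
  proof -
    have "z \<in> vecs X" using that(1) TX by auto
    then show ?thesis using NC[OF that(1)] that(2) nX(1,2)[of z] by simp
  qed
  have Z: "banach_space Z"
    unfolding banach_space_def Zs
  proof (intro conjI ballI allI impI)
    show "vector_space (scl X)" by (rule vX.vector_space_axioms)
    show "vX.subspace (T ` vecs Y)" by (rule sZ)
    show "0 \<le> N z" if "z \<in> T ` vecs Y" for z using that by (rule N3)
    show "N z = 0 \<longleftrightarrow> z = 0" if "z \<in> T ` vecs Y" for z using Ndef[OF that] N0 by auto
    show "N (scl X c z) = norm c * N z" if "z \<in> T ` vecs Y" for c z using that by (rule Nscl)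
    show "N (z + w) \<le> N z + N w" if "z \<in> T ` vecs Y" "w \<in> T ` vecs Y" for z w
      using that by (rule Ntri)
    show "\<exists>z\<in>T ` vecs Y. (\<lambda>n. N (f n - z)) \<longlonglongrightarrow> 0"
      if "range f \<subseteq> T ` vecs Y \<and> (\<forall>e>0. \<exists>M. \<forall>m\<ge>M. \<forall>n\<ge>M. N (f m - f n) < e)"
      for f :: "nat \<Rightarrow> 'a"
      using that by (intro complete) auto
  qed
  obtain y where y: "y \<in> strongly_summable r X" "T ` unit_ball Y \<subseteq> r_co r X y"
    using T by (auto simp: SK_def)
  have yX: "y k \<in> vecs X" for k using y(1) by (auto simp: strongly_summable_def)
  have JSK: "(\<lambda>z. z) \<in> SK r Z X"
  proof -
    have J: "(\<lambda>z. z) \<in> bounded_op Z X"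
      unfolding bounded_op_def using TX NC by auto
    define y2 where "y2 k = scl X 2 (y k)" for k
    have "y2 \<in> strongly_summable r X"
      using y(1) clX(3) nX(1,3)[OF yX]
      by (auto simp: strongly_summable_def y2_def powr_mult intro!: summable_mult)
    moreover have "z \<in> r_co r X y2" if "z \<in> unit_ball Z" for z
    proof -
      have z: "z \<in> T ` vecs Y" "N z < 2" using that by (auto simp: unit_ball_def)
      obtain u where u: "u \<in> vecs Y" "T u = z" "nrm Y u < 2" using N2[OF z] by auto
      have "scl Y (inverse 2) u \<in> unit_ball Y"
        using u clY(3) nY(3)[OF u(1), of "inverse 2"] by (simp add: unit_ball_def norm_inverse)
      then have "T (scl Y (inverse 2) u) \<in> r_co r X y" using y(2) by blast
      then have "scl X (inverse 2) z \<in> r_co r X y" using Tscl[OF u(1)] u(2) by simp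
      then obtain l where l: "l \<in> coeff_ball r"
        "(\<lambda>n. nrm X ((\<Sum>k<n. scl X (l k) (y k)) - scl X (inverse 2) z)) \<longlonglongrightarrow> 0"
        by (auto simp: r_co_def)
      have zX: "z \<in> vecs X" using z(1) TX by auto
      have eq: "nrm X ((\<Sum>k<n. scl X (l k) (y2 k)) - z)
          = 2 * nrm X ((\<Sum>k<n. scl X (l k) (y k)) - scl X (inverse 2) z)" for n
      proof -
        have "(\<Sum>k<n. scl X (l k) (y2 k)) - z
            = scl X 2 ((\<Sum>k<n. scl X (l k) (y k)) - scl X (inverse 2) z)"
          by (simp add: y2_def vX.scale_right_diff_distrib vX.scale_sum_right mult.commute)
        moreover have "(\<Sum>k<n. scl X (l k) (y k)) - scl X (inverse 2) z \<in> vecs X"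
          by (intro clX zX yX)
        ultimately show ?thesis using nX(3)[of _ 2] by simp
      qed
      have "(\<lambda>n. nrm X ((\<Sum>k<n. scl X (l k) (y2 k)) - z)) \<longlonglongrightarrow> 0"
        unfolding eq using tendsto_mult_left[OF l(2), of 2] by simp
      then show ?thesis using l(1) zX by (auto simp: r_co_def)
    qed
    ultimately show ?thesis using J by (auto simp: SK_def)
  qed
  obtain S where S: "S \<in> finite_rank_op Z X" "(\<lambda>z. z - S z) \<in> SK r Z X"
    "SK_norm r Z X (\<lambda>z. z - S z) < e"
    using AP[unfolded SK_AP_def, rule_format, OF Z JSK e] by auto
  obtain w where w: "w \<in> strongly_summable r X"
    "(\<lambda>z. z - S z) ` unit_ball Z \<subseteq> r_co r X w" "strong_norm r X w < e"
  proof -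
    let ?A = "{strong_norm r X y | y. y \<in> strongly_summable r X \<and>
        (\<lambda>z. z - S z) ` unit_ball Z \<subseteq> r_co r X y}"
    have "?A \<noteq> {}" using S(2) by (auto simp: SK_def)
    moreover have "Inf ?A < e" using S(3) by (simp add: SK_norm_def)
    ultimately have "\<exists>a\<in>?A. a < e" by (rule cInf_lessD)
    then show ?thesis using that by blast
  qed
  have bS: "S \<in> bounded_op Z X" using S(1) by (simp add: finite_rank_op_def)
  have comp: "R \<circ> T \<in> bounded_op Y X" if R: "R \<in> bounded_op Z X" for R
  proof -
    obtain D where D: "\<And>z. z \<in> T ` vecs Y \<Longrightarrow> nrm X (R z) \<le> D * N z"
    proof -
      have "\<exists>D. \<forall>z\<in>T ` vecs Y. nrm X (R z) \<le> D * N z" using R by (simp add: bounded_op_def)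
      then show ?thesis using that by blast
    qed
    have "nrm X (R (T v)) \<le> max D 0 * nrm Y v" if v: "v \<in> vecs Y" for v
    proof -
      have "nrm X (R (T v)) \<le> D * N (T v)" using D v by blast
      also have "\<dots> \<le> max D 0 * N (T v)" using N3 v by (intro mult_right_mono) auto
      also have "\<dots> \<le> max D 0 * nrm Y v" using N1[OF v] by (intro mult_left_mono) auto
      finally show ?thesis .
    qed
    then show ?thesis using R Tadd Tscl
      by (auto simp: bounded_op_def intro!: exI[of _ "max D 0"])
  qed
  have fin: "S \<circ> T \<in> finite_rank_op Y X"
    using S(1) comp[OF bS] by (auto simp: finite_rank_op_def image_comp)
  have TB: "T ` unit_ball Y \<subseteq> unit_ball Z"
    using N1 by (fastforce simp: unit_ball_def)
  have dB: "(\<lambda>y. T y - (S \<circ> T) y) ` unit_ball Y \<subseteq> r_co r X w"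
    using w(2) TB by (auto simp: image_subset_iff)
  have "(\<lambda>z. z - S z) \<circ> T \<in> bounded_op Y X" using S(2) by (intro comp) (simp add: SK_def)
  then have dSK: "(\<lambda>y. T y - (S \<circ> T) y) \<in> SK r Y X"
    using dB w(1) by (auto simp: SK_def o_def)
  have "SK_norm r Y X (\<lambda>y. T y - (S \<circ> T) y) \<le> strong_norm r X w"
    unfolding SK_norm_def
    by (rule cInf_lower) (use dB w(1) in \<open>auto simp: strong_norm_def intro!: bdd_belowI[of _ 0]\<close>)
  then show ?thesis using fin dSK w(3) by (intro bexI[of _ "S \<circ> T"]) auto
qed

end

theory Submission
  imports Defs
begin

text \<open>
  The idea is Davie's. Suppose that a scalar matrix \<open>a\<close> on \<open>\<nat>\<close> satisfies \<open>a\<^sup>2 = 0\<close> and has trace \<open>1\<close>,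
  although a nilpotent matrix of finite size has trace \<open>0\<close>. Let \<open>X \<subseteq> \<ell>\<^sup>q\<close> be the closed subspace
  of all \<open>x\<close> with \<open>\<Sum>\<^sub>i x\<^sub>i a\<^sub>i\<^sub>k = 0\<close> for every \<open>k\<close>. It contains the rows \<open>a\<^sub>i\<close> of the matrix, and
  \<open>\<beta>(D) = \<Sum>\<^sub>i (D a\<^sub>i)(i)\<close> is a substitute for the trace: \<open>\<beta>\<close> of the inclusion map is the trace of \<open>a\<close>,
  hence \<open>1\<close>, whereas for a rank one operator \<open>D = f \<otimes> x\<close> one finds
  \<open>\<beta>(D) = \<Sum>\<^sub>i f(a\<^sub>i) x\<^sub>i = f(\<Sum>\<^sub>i x\<^sub>i a\<^sub>i) = 0\<close>. If \<open>\<beta>\<close> is continuous for an operator norm, then in that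
  norm the inclusion cannot be approximated by operators of finite rank.

  Continuity rests on the decay of the matrix. It can be had with \<open>\<bar>a\<^sub>i\<^sub>k\<bar> = O(i\<^sup>-\<^sup>s)\<close> for every
  \<open>s < 3/2\<close> and with \<open>a\<^sub>i\<^sub>k = 0\<close> unless \<open>i\<close> and \<open>k\<close> are comparable
  (\<open>nilpotent_matrix_with_trace_one\<close>), so that the norm of \<open>a\<^sub>i\<close> in \<open>\<ell>\<^sup>q\<close> is \<open>O(i\<^bsup>1/q - s\<^esup>)\<close>.
  The matrix consists of blocks of sizes \<open>4 \<cdot> 2\<^sup>n\<close> built from columns of Hadamard matrices; a
  derandomised choice of columns and signs (\<open>balanced_choice\<close>) gives sums of \<open>2\<^sup>n\<close> signs the size
  \<open>2\<^bsup>n/2\<^esup>\<close>, up to a factor linear in \<open>n\<close>, which is the source of the exponent \<open>3/2\<close>.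

  To get a Sinha-Karn compact inclusion, the domain is not \<open>X\<close> itself. Put \<open>b\<^sub>i = i\<^sup>-\<^sup>t\<close> and
  \<open>y\<^sub>i = a\<^sub>i / b\<^sub>i\<close>. If \<open>t < s - 1/q - 1/r\<close>, then \<open>(y\<^sub>i)\<close> is strongly \<open>r\<close>-summable, and the range \<open>Z\<close> of
  the operator \<open>\<ell>\<^bsup>r'\<^esup> \<rightarrow> X\<close>, \<open>\<lambda> \<mapsto> \<Sum> \<lambda>\<^sub>i y\<^sub>i\<close>, with the quotient norm is a Banach space whose inclusion
  into \<open>X\<close> belongs to \<open>SK r\<close> (\<open>synthesis.inclusion_SK\<close>); moreover \<open>a\<^sub>i\<close> has norm at most \<open>b\<^sub>i\<close> in \<open>Z\<close>.
  For \<open>D : Z \<rightarrow> X\<close> mapping the unit ball into \<open>r-co{z\<^sub>k}\<close>, Young's inequality and an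
  embedding of \<open>\<ell>\<^sup>q\<close> into a weighted \<open>\<ell>\<^sup>r\<close> bound \<open>\<beta>(D)\<close> as soon as \<open>t > 1 - 1/max(q, r)\<close>, and then also
  \<open>\<Sum> x\<^sub>i a\<^sub>i\<close> converges in \<open>Z\<close> for \<open>x \<in> X\<close>, which makes \<open>\<beta>\<close> vanish on operators of finite rank.
  A suitable \<open>t\<close> exists if and only if \<open>s > 1 + 1/min(q, r)\<close>. As \<open>p\<close> and \<open>q\<close> exceed \<open>2\<close>, some \<open>s < 3/2\<close> serves for
  all \<open>r \<ge> p\<close> at once (\<open>nilpotent_matrix.kernel_fails_SK_AP\<close>). The whole argument is the same for real
  and complex scalars, since the matrix is real.
\<close>

section \<open>Hadamard columns with balanced correlations\<close>

lemma exp_le_one_plus_square: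
  fixes x :: real
  assumes "\<bar>x\<bar> \<le> 1"
  shows "exp x \<le> 1 + x + x\<^sup>2"
proof (cases "0 \<le> x")
  case True
  then show ?thesis using exp_bound[of x] assms by simp
next
  case False
  define y where "y = - x"
  have y: "0 < y" "y \<le> 1" using False assms by (auto simp: y_def)
  have "1 \<le> (1 - y + y\<^sup>2) * (1 + y)" using y by (simp add: algebra_simps power2_eq_square)
  also have "\<dots> \<le> (1 - y + y\<^sup>2) * exp y"
  proof (rule mult_left_mono)
    show "0 \<le> 1 - y + y\<^sup>2" using y by simp
  qed simp
  finally have "1 / exp y \<le> 1 - y + y\<^sup>2" by (simp add: divide_le_eq)
  then show ?thesis by (simp add: y_def exp_minus inverse_eq_divide)
qed

text \<open>
  Choosing every \<open>f j\<close> at random would give each sum the standard deviation of order \<open>B \<surd>m\<close>, and a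
  union bound over \<open>V\<close> costs the logarithm. The proof derandomises this by the method of conditional
  expectations: the potential \<open>\<Sum>\<^sub>v (exp (l s\<^sub>v) + exp (- l s\<^sub>v))\<close> of the partial sums \<open>s\<^sub>v\<close> grows on average
  over the next choice, hence for some choice, at most by the factor \<open>1 + 1/m\<close>.
\<close>

lemma balanced_choice:
  fixes c :: "nat \<Rightarrow> 'o \<Rightarrow> 'v \<Rightarrow> real"
  assumes V: "finite V" and Opt: "finite Opt" "Opt \<noteq> {}"
    and zero: "\<And>j v. v \<in> V \<Longrightarrow> (\<Sum>u\<in>Opt. c j u v) = 0"
    and bound: "\<And>j u v. u \<in> Opt \<Longrightarrow> v \<in> V \<Longrightarrow> \<bar>c j u v\<bar> \<le> B"
    and B: "0 < B" and m: "0 < m"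
  shows "\<exists>f. (\<forall>j. f j \<in> Opt) \<and>
     (\<forall>v\<in>V. \<bar>\<Sum>j<m. c j (f j) v\<bar> \<le> B * sqrt m * (ln (2 * card V) + 1))"
proof -
  \<comment> \<open>With this scale each step contributes at most \<open>(l B)\<^sup>2 = 1/m\<close> to the exponent.\<close>
  define l where "l = 1 / (B * sqrt m)"
  have l: "0 < l" using B m by (simp add: l_def)
  have lB: "l * B = 1 / sqrt m" using B by (simp add: l_def)
  have small: "\<bar>l * c j u v\<bar> \<le> 1 / sqrt m" if "u \<in> Opt" "v \<in> V" for j u v
    using mult_left_mono[OF bound[OF that, of j], of l] l by (simp add: abs_mult lB)
  have sm: "1 / sqrt m \<le> 1" using m by simp
  have avg: "(\<Sum>u\<in>Opt. exp (e * (l * c j u v))) \<le> card Opt * (1 + 1 / m)"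
    if v: "v \<in> V" and e: "\<bar>e\<bar> = 1" for v j e
  proof -
    have "(\<Sum>u\<in>Opt. exp (e * (l * c j u v))) \<le> (\<Sum>u\<in>Opt. 1 + e * l * c j u v + 1 / m)"
    proof (rule sum_mono)
      fix u assume u: "u \<in> Opt"
      have a: "\<bar>e * (l * c j u v)\<bar> \<le> 1 / sqrt m" using small[OF u v, of j] e by (simp add: abs_mult)
      have "(e * (l * c j u v))\<^sup>2 \<le> (1 / sqrt m)\<^sup>2" using power_mono[OF a, of 2] by simp
      also have "\<dots> = 1 / m" by (simp add: power_divide)
      finally show "exp (e * (l * c j u v)) \<le> 1 + e * l * c j u v + 1 / m"
        using exp_le_one_plus_square[of "e * (l * c j u v)"] a sm by (simp add: mult.assoc)
    qed
    also have "\<dots> = card Opt * (1 + 1 / m)"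
      using zero[OF v, of j] by (simp add: sum.distrib distrib_left flip: sum_distrib_left)
    finally show ?thesis .
  qed
  define \<Phi> where "\<Phi> f k = (\<Sum>v\<in>V. exp (l * (\<Sum>j<k. c j (f j) v)) + exp (- (l * (\<Sum>j<k. c j (f j) v))))"
    for f k
  have ex: "\<exists>f. (\<forall>j. f j \<in> Opt) \<and> \<Phi> f k \<le> 2 * card V * (1 + 1 / m) ^ k" for k :: nat
  proof (induction k)
    case 0
    obtain u where "u \<in> Opt" using Opt by auto
    then show ?case by (intro exI[of _ "\<lambda>_. u"]) (simp add: \<Phi>_def)
  next
    case (Suc k)
    then obtain f where f: "\<And>j. f j \<in> Opt" "\<Phi> f k \<le> 2 * card V * (1 + 1 / m) ^ k" by auto
    define s where "s v = l * (\<Sum>j<k. c j (f j) v)" for v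
    define \<Psi> where "\<Psi> u = (\<Sum>v\<in>V. exp (s v + l * c k u v) + exp (- (s v + l * c k u v)))" for u
    have "(\<Sum>u\<in>Opt. \<Psi> u) = (\<Sum>v\<in>V. exp (s v) * (\<Sum>u\<in>Opt. exp (1 * (l * c k u v))) +
          exp (- s v) * (\<Sum>u\<in>Opt. exp ((-1) * (l * c k u v))))"
      unfolding \<Psi>_def by (subst sum.swap) (simp add: sum.distrib sum_distrib_left flip: exp_add)
    also have "\<dots> \<le> (\<Sum>v\<in>V. exp (s v) * (card Opt * (1 + 1 / m)) + exp (- s v) * (card Opt * (1 + 1 / m)))"
      by (intro sum_mono add_mono mult_left_mono avg) auto
    also have "\<dots> = card Opt * ((1 + 1 / m) * \<Phi> f k)"
      unfolding \<Phi>_def s_def[symmetric] by (simp add: sum_distrib_left algebra_simps sum.distrib)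
    finally have le: "(\<Sum>u\<in>Opt. \<Psi> u) \<le> card Opt * ((1 + 1 / m) * \<Phi> f k)" .
    have "\<exists>u\<in>Opt. \<Psi> u \<le> (1 + 1 / m) * \<Phi> f k"
    proof (rule ccontr)
      assume "\<not> ?thesis"
      then have "(\<Sum>u\<in>Opt. (1 + 1 / m) * \<Phi> f k) < (\<Sum>u\<in>Opt. \<Psi> u)"
        by (intro sum_strict_mono) (use Opt in auto)
      then show False using le by simp
    qed
    then obtain u where u: "u \<in> Opt" "\<Psi> u \<le> (1 + 1 / m) * \<Phi> f k" by blast
    have "\<Phi> (f(k := u)) (Suc k) = \<Psi> u"
      unfolding \<Phi>_def \<Psi>_def s_def by (simp add: algebra_simps)
    also have "\<dots> \<le> (1 + 1 / m) * (2 * card V * (1 + 1 / m) ^ k)"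
      using u(2) f(2) by (rule order_trans[OF _ mult_left_mono]) simp
    finally have "\<Phi> (f(k := u)) (Suc k) \<le> 2 * card V * (1 + 1 / m) ^ Suc k" by (simp add: mult_ac)
    moreover have "\<forall>j. (f(k := u)) j \<in> Opt" using f(1) u(1) by simp
    ultimately show ?case by blast
  qed
  from ex[of m] obtain f where f: "\<And>j. f j \<in> Opt" "\<Phi> f m \<le> 2 * card V * (1 + 1 / m) ^ m" by blast
  have "(1 + 1 / m) ^ m \<le> exp 1" using exp_ge_one_plus_x_over_n_power_n[of "m" 1] m by simp
  then have \<Phi>: "\<Phi> f m \<le> 2 * card V * exp 1" using f(2) by (rule_tac order_trans[OF _ mult_left_mono]) auto
  have "\<bar>\<Sum>j<m. c j (f j) v\<bar> \<le> B * sqrt m * (ln (2 * card V) + 1)" if v: "v \<in> V" for v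
  proof -
    define s where "s = l * (\<Sum>j<m. c j (f j) v)"
    have V0: "0 < card V" using v V by (auto simp: card_gt_0_iff)
    have "exp s + exp (- s) \<le> \<Phi> f m"
      unfolding \<Phi>_def s_def by (rule member_le_sum[OF v _ V]) auto
    moreover have "exp \<bar>s\<bar> \<le> exp s + exp (- s)" by (cases "0 \<le> s") auto
    ultimately have "exp \<bar>s\<bar> \<le> 2 * card V * exp 1" using \<Phi> by linarith
    then have "\<bar>s\<bar> \<le> ln (2 * card V * exp 1)" using V0 by (subst ln_ge_iff) auto
    also have "\<dots> = ln (2 * card V) + 1" using V0 by (simp add: ln_mult)
    finally have "l * \<bar>\<Sum>j<m. c j (f j) v\<bar> \<le> ln (2 * card V) + 1"
      using l by (simp add: s_def abs_mult)
    then show ?thesis using B m by (simp add: l_def field_simps)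
  qed
  then show ?thesis using f(1) by blast
qed

text \<open>
  The entries \<open>\<plusminus>1\<close> of Sylvester's Hadamard matrix of size \<open>2\<^sup>k\<close>, that is the Walsh characters: the sign
  is the parity of the number of common binary digits of \<open>x\<close> and \<open>g\<close>.
\<close>

fun sylvester :: "nat \<Rightarrow> nat \<Rightarrow> nat \<Rightarrow> real" where
  "sylvester 0 x g = 1"
| "sylvester (Suc k) x g = (if odd x \<and> odd g then -1 else 1) * sylvester k (x div 2) (g div 2)"

lemma abs_sylvester: "\<bar>sylvester k x g\<bar> = 1"
  by (induction k arbitrary: x g) (auto simp: abs_mult)

lemma sum_lessThan_double: "(\<Sum>g<2 * n. f g) = (\<Sum>g<n. f (2 * g) + f (2 * g + 1))"
  for f :: "nat \<Rightarrow> 'a::comm_monoid_add"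
  by (induction n) (auto simp: algebra_simps)

lemma sylvester_orthogonal:
  "x < 2 ^ k \<Longrightarrow> y < 2 ^ k \<Longrightarrow>
     (\<Sum>g<2 ^ k. sylvester k x g * sylvester k y g) = (if x = y then 2 ^ k else 0)"
proof (induction k arbitrary: x y)
  case 0 then show ?case by simp
next
  case (Suc k)
  have IH: "(\<Sum>g<2 ^ k. sylvester k (x div 2) g * sylvester k (y div 2) g)
      = (if x div 2 = y div 2 then 2 ^ k else 0)"
    using Suc by auto
  define \<sigma> where "\<sigma> = (1 + (if odd x then -1 else 1) * (if odd y then -1 else 1) :: real)"
  have "(\<Sum>g<2 ^ Suc k. sylvester (Suc k) x g * sylvester (Suc k) y g)
      = (\<Sum>g<2 ^ k. \<sigma> * (sylvester k (x div 2) g * sylvester k (y div 2) g))"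
    unfolding power_Suc sum_lessThan_double by (intro sum.cong) (auto simp: \<sigma>_def)
  also have "\<dots> = \<sigma> * (if x div 2 = y div 2 then 2 ^ k else 0)"
    by (simp add: IH flip: sum_distrib_left)
  also have "\<dots> = (if x = y then 2 ^ Suc k else 0)"
  proof -
    have "x = y \<longleftrightarrow> x div 2 = y div 2 \<and> (odd x \<longleftrightarrow> odd y)"
      by (metis bit_eq_rec)
    then show ?thesis by (auto simp: \<sigma>_def)
  qed
  finally show ?case .
qed

lemma ln_two_power_le: "ln (2 ^ k :: real) \<le> k"
proof -
  have "ln (2::real) \<le> 1" using ln_2_less_1 by simp
  then have "k * ln 2 \<le> k * (1::real)" by (intro mult_left_mono) auto
  then show ?thesis by (simp add: ln_realpow)
qed

text \<open>
  The columns \<open>P j\<close> and \<open>Q k\<close> form an orthogonal system of \<open>3 \<cdot> 2\<^sup>n\<close> vectors with entries \<open>\<plusminus>1\<close> in dimension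
  \<open>4 \<cdot> 2\<^sup>n\<close>. The last clause says that their normalised correlation kernels nearly agree: the difference
  is of the order of a random sum, not of the number \<open>2\<^sup>n\<close> of its terms.
\<close>

definition flat_pair :: "nat \<Rightarrow> (nat \<Rightarrow> nat \<Rightarrow> real) \<Rightarrow> (nat \<Rightarrow> nat \<Rightarrow> real) \<Rightarrow> bool" where
  "flat_pair n P Q \<longleftrightarrow>
     (\<forall>j g. \<bar>P j g\<bar> = 1 \<and> \<bar>Q j g\<bar> = 1) \<and>
     (\<forall>j<2 ^ n. \<forall>k<2 ^ n. (\<Sum>g<4 * 2 ^ n. P j g * P k g) = (if j = k then 4 * 2 ^ n else 0)) \<and>
     (\<forall>j<2 * 2 ^ n. \<forall>k<2 * 2 ^ n. (\<Sum>g<4 * 2 ^ n. Q j g * Q k g) = (if j = k then 4 * 2 ^ n else 0)) \<and>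
     (\<forall>j<2 ^ n. \<forall>k<2 * 2 ^ n. (\<Sum>g<4 * 2 ^ n. P j g * Q k g) = 0) \<and>
     (\<forall>g<4 * 2 ^ n. \<forall>h<4 * 2 ^ n.
        \<bar>(\<Sum>k<2 * 2 ^ n. Q k g * Q k h) / 2 - (\<Sum>j<2 ^ n. P j g * P j h)\<bar> \<le> 4 * (real n + 3) * sqrt (2 ^ n))"

text \<open>
  The columns of the Hadamard matrix are grouped into quadruples \<open>4j, \<dots>, 4j + 3\<close>. Of the first three,
  one becomes \<open>P j\<close> and the other two become \<open>Q (2j)\<close> and \<open>Q (2j + 1)\<close>. Over the three possibilities \<open>\<rho> j\<close>
  the contribution to the kernel difference averages to \<open>0\<close>, so that \<open>balanced_choice\<close> applies.
\<close>

lemma flat_pair_exists: "\<exists>P Q. flat_pair n P Q"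
proof -
  define w where "w = sylvester (n + 2)"
  have w1: "\<bar>w x g\<bar> = 1" for x g by (simp add: w_def abs_sylvester)
  have w_orth: "(\<Sum>g<4 * 2 ^ n. w x g * w y g) = (if x = y then 4 * 2 ^ n else 0)"
    if "x < 4 * 2 ^ n" "y < 4 * 2 ^ n" for x y
    using sylvester_orthogonal[of x "n + 2" y] that by (simp add: w_def power_add mult.commute)
  define c where "c j u v = (case v of (g, h) \<Rightarrow>
      (w (4 * j + (u + 1) mod 3) g * w (4 * j + (u + 1) mod 3) h
       + w (4 * j + (u + 2) mod 3) g * w (4 * j + (u + 2) mod 3) h) / 2
      - w (4 * j + u) g * w (4 * j + u) h)" for j u :: nat and v
  define V where "V = {..<4 * 2 ^ n :: nat} \<times> {..<4 * 2 ^ n :: nat}"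
  have "\<exists>\<rho>. (\<forall>j. \<rho> j \<in> {0, 1, 2}) \<and>
     (\<forall>v\<in>V. \<bar>\<Sum>j<2 ^ n. c j (\<rho> j) v\<bar> \<le> 2 * sqrt (2 ^ n :: nat) * (ln (2 * card V) + 1))"
  proof (rule balanced_choice)
    show "finite V" by (simp add: V_def)
    show "(\<Sum>u\<in>{0, 1, 2}. c j u v) = 0" for j v by (cases v) (simp add: c_def field_simps)
    have ww: "\<bar>w x g * w x h\<bar> = 1" for x g h by (simp add: abs_mult w1)
    have avg: "\<bar>(a + b) / 2 - d\<bar> \<le> 2" if "\<bar>a\<bar> = 1" "\<bar>b\<bar> = 1" "\<bar>d\<bar> = 1" for a b d :: real
      using that by (simp add: abs_le_iff abs_eq_iff') auto
    show "\<bar>c j u v\<bar> \<le> 2" for j u v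
    proof (cases v)
      case (Pair g h)
      show ?thesis unfolding Pair c_def prod.case by (intro avg ww)
    qed
  qed auto
  then obtain \<rho> where \<rho>: "\<And>j. \<rho> j \<in> {0, 1, 2}"
    and bal: "\<And>v. v \<in> V \<Longrightarrow> \<bar>\<Sum>j<2 ^ n. c j (\<rho> j) v\<bar> \<le> 2 * sqrt (2 ^ n :: nat) * (ln (2 * card V) + 1)"
    by blast
  \<comment> \<open>The logarithmic loss of the balancing lemma is linear in \<open>n\<close>.\<close>
  have cV: "2 * card V = 2 ^ (2 * n + 5)"
    by (simp add: V_def power_add power_even_eq power2_eq_square)
  have lnV: "ln (2 * card V) + 1 \<le> 2 * (real n + 3)"
    using ln_two_power_le[of "2 * n + 5"] unfolding cV by simp
  define p where "p j = 4 * j + \<rho> j" for j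
  define q where "q k = 4 * (k div 2) + (\<rho> (k div 2) + 1 + k mod 2) mod 3" for k
  have \<rho>3: "\<rho> j < 3" for j using \<rho>[of j] by auto
  have p: "p j < 4 * 2 ^ n" if "j < 2 ^ n" for j
    using that \<rho>3[of j] unfolding p_def by linarith
  have q: "q k < 4 * 2 ^ n" if "k < 2 * 2 ^ n" for k
  proof -
    have "k div 2 < 2 ^ n" using that by auto
    moreover have "(\<rho> (k div 2) + 1 + k mod 2) mod 3 < 3" by simp
    ultimately show ?thesis unfolding q_def by linarith
  qed
  have p_inj: "p j = p k \<longleftrightarrow> j = k" for j k
  proof
    assume "p j = p k"
    then have "p j div 4 = p k div 4" by simp
    then show "j = k" using \<rho>3[of j] \<rho>3[of k] by (simp add: p_def)
  qed simp
  have q_div: "q k div 4 = k div 2" and q_mod: "q k mod 4 = (\<rho> (k div 2) + 1 + k mod 2) mod 3" for k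
  proof -
    have "(\<rho> (k div 2) + 1 + k mod 2) mod 3 < 4" by (rule order.strict_trans[of _ 3]) auto
    then show "q k div 4 = k div 2" "q k mod 4 = (\<rho> (k div 2) + 1 + k mod 2) mod 3"
      by (simp_all add: q_def)
  qed
  have q_inj: "q j = q k \<longleftrightarrow> j = k" for j k
  proof
    assume eq: "q j = q k"
    then have d: "j div 2 = k div 2" using q_div by metis
    have "q j mod 4 = q k mod 4" by (simp add: eq)
    then have "(\<rho> (k div 2) + 1 + j mod 2) mod 3 = (\<rho> (k div 2) + 1 + k mod 2) mod 3"
      by (simp only: q_mod d)
    moreover have "a = b"
      if "(r + 1 + a) mod 3 = (r + 1 + b) mod 3" "a \<in> {0, 1}" "b \<in> {0, 1}" "r \<in> {0, 1, 2}" for r a b :: nat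
      using that by auto
    ultimately have "j mod 2 = k mod 2" using \<rho>[of "k div 2"] by (metis insertCI mod2_eq_if)
    with d show "j = k" by (metis div_mult_mod_eq)
  qed simp
  have pq: "p j \<noteq> q k" for j k
  proof
    assume eq: "p j = q k"
    have "p j div 4 = j" "p j mod 4 = \<rho> j" using \<rho>3[of j] by (simp_all add: p_def)
    then have j: "j = k div 2" and "\<rho> j = (\<rho> (k div 2) + 1 + k mod 2) mod 3"
      using q_div[of k] q_mod[of k] by (simp_all add: eq)
    moreover have "r \<noteq> (r + 1 + a) mod 3" if "a \<in> {0, 1}" "r \<in> {0, 1, 2}" for r a :: nat
      using that by auto
    ultimately show False using \<rho>[of j] by (metis insertCI mod2_eq_if)
  qed
  define P where "P j = w (p j)" for j
  define Q where "Q k = w (q k)" for k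
  have bal': "\<bar>(\<Sum>k<2 * 2 ^ n. Q k g * Q k h) / 2 - (\<Sum>j<2 ^ n. P j g * P j h)\<bar> \<le> 4 * (real n + 3) * sqrt (2 ^ n)"
    if "g < 4 * 2 ^ n" "h < 4 * 2 ^ n" for g h
  proof -
    have "(\<Sum>k<2 * 2 ^ n. Q k g * Q k h) / 2 - (\<Sum>j<2 ^ n. P j g * P j h) = (\<Sum>j<2 ^ n. c j (\<rho> j) (g, h))"
      unfolding sum_lessThan_double sum_divide_distrib sum_subtractf[symmetric]
      by (intro sum.cong) (auto simp: c_def P_def Q_def p_def q_def)
    also have "\<bar>\<dots>\<bar> \<le> 2 * sqrt (2 ^ n :: nat) * (ln (2 * card V) + 1)"
      using that by (intro bal) (simp add: V_def)
    also have "\<dots> \<le> 2 * sqrt (2 ^ n :: nat) * (2 * (real n + 3))"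
      by (intro mult_left_mono lnV) simp
    finally show ?thesis by (simp add: algebra_simps)
  qed
  show ?thesis unfolding flat_pair_def
    by (intro exI[of _ P] exI[of _ Q] conjI allI impI bal')
      (auto simp: P_def Q_def w1 w_orth p q p_inj q_inj pq)
qed

text \<open>
  The positions of level \<open>n\<close>; the blocks partition the numbers from \<open>4\<close> on.
\<close>

definition block :: "nat \<Rightarrow> nat set" where
  "block n = {4 * 2 ^ n..<8 * 2 ^ n}"

lemma sum_block: "(\<Sum>i\<in>block n. f (i - 4 * 2 ^ n)) = (\<Sum>g<4 * 2 ^ n. f g)"
  by (rule sum.reindex_bij_witness[of _ "\<lambda>g. 4 * 2 ^ n + g" "\<lambda>i. i - 4 * 2 ^ n"]) (auto simp: block_def)

text \<open>
  Flat pairs on all levels, transported to the blocks, with one further property \<open>next_level\<close> coupling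
  neighbouring levels: the columns \<open>Q n\<close> of one level and \<open>P (Suc n)\<close> of the next, which are equal in
  number, are nearly uncorrelated. This will join them into the vectors \<open>E\<close> below.
\<close>

locale flat_system =
  fixes P Q :: "nat \<Rightarrow> nat \<Rightarrow> nat \<Rightarrow> real"
  assumes P_support: "i \<notin> block n \<Longrightarrow> P n j i = 0"
    and Q_support: "i \<notin> block n \<Longrightarrow> Q n j i = 0"
    and P_square: "i \<in> block n \<Longrightarrow> P n j i * P n j i = 1"
    and Q_square: "i \<in> block n \<Longrightarrow> Q n j i * Q n j i = 1"
    and P_orth: "j < 2 ^ n \<Longrightarrow> k < 2 ^ n \<Longrightarrow>
        (\<Sum>i\<in>block n. P n j i * P n k i) = (if j = k then 4 * 2 ^ n else 0)"
    and Q_orth: "j < 2 * 2 ^ n \<Longrightarrow> k < 2 * 2 ^ n \<Longrightarrow>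
        (\<Sum>i\<in>block n. Q n j i * Q n k i) = (if j = k then 4 * 2 ^ n else 0)"
    and PQ_orth: "j < 2 ^ n \<Longrightarrow> k < 2 * 2 ^ n \<Longrightarrow> (\<Sum>i\<in>block n. P n j i * Q n k i) = 0"
    and same_level: "i \<in> block n \<Longrightarrow> k \<in> block n \<Longrightarrow>
        \<bar>(\<Sum>j<2 * 2 ^ n. Q n j i * Q n j k) / 2 - (\<Sum>j<2 ^ n. P n j i * P n j k)\<bar>
        \<le> 4 * (real n + 3) * sqrt (2 ^ n)"
    and next_level: "i \<in> block n \<Longrightarrow> k \<in> block (Suc n) \<Longrightarrow>
        \<bar>\<Sum>j<2 * 2 ^ n. Q n j i * P (Suc n) j k\<bar> \<le> 4 * (real n + 3) * sqrt (2 ^ n)"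

text \<open>
  The signs \<open>\<theta> j\<close> can be attached to the columns of one side without affecting orthogonality or the
  products \<open>P j g * P j h\<close>.
\<close>

lemma balancing_signs:
  fixes f g :: "nat \<Rightarrow> nat \<Rightarrow> real"
  assumes "\<And>j x. \<bar>f j x\<bar> = 1" "\<And>j x. \<bar>g j x\<bar> = 1"
  shows "\<exists>\<theta>. (\<forall>j. \<theta> j \<in> {1, -1}) \<and> (\<forall>x<4 * 2 ^ n. \<forall>y<8 * 2 ^ n.
     \<bar>\<Sum>j<2 * 2 ^ n. f j x * (\<theta> j * g j y)\<bar> \<le> 4 * (real n + 3) * sqrt (2 ^ n))"
proof -
  define V where "V = {..<4 * 2 ^ n :: nat} \<times> {..<8 * 2 ^ n :: nat}"
  define c where "c j u v = f j (fst v) * (u * g j (snd v))" for j u v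
  have "\<exists>\<theta>. (\<forall>j. \<theta> j \<in> {1, -1}) \<and>
     (\<forall>v\<in>V. \<bar>\<Sum>j<2 * 2 ^ n. c j (\<theta> j) v\<bar> \<le> 1 * sqrt (2 * 2 ^ n :: nat) * (ln (2 * card V) + 1))"
    by (rule balanced_choice) (auto simp: V_def c_def abs_mult assms)
  then obtain \<theta> where \<theta>: "\<And>j. \<theta> j \<in> {1, -1}"
    and bal: "\<And>v. v \<in> V \<Longrightarrow> \<bar>\<Sum>j<2 * 2 ^ n. c j (\<theta> j) v\<bar> \<le> 1 * sqrt (2 * 2 ^ n :: nat) * (ln (2 * card V) + 1)"
    by blast
  have cV: "2 * card V = 2 ^ (2 * n + 6)"
    by (simp add: V_def power_add power_even_eq power2_eq_square)
  have lnV: "ln (2 * card V) + 1 \<le> 2 * real n + 7"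
    using ln_two_power_le[of "2 * n + 6"] unfolding cV by simp
  have s2: "sqrt 2 \<le> 3 / 2" by (rule real_le_lsqrt) (auto simp: power2_eq_square)
  have "1 * sqrt (2 * 2 ^ n :: nat) * (ln (2 * card V) + 1) \<le> sqrt (2 * 2 ^ n) * (2 * real n + 7)"
    using lnV by (simp add: mult_left_mono)
  also have "\<dots> = sqrt 2 * (2 * real n + 7) * sqrt (2 ^ n)" by (simp add: real_sqrt_mult)
  also have "\<dots> \<le> 3 / 2 * (2 * real n + 7) * sqrt (2 ^ n)" by (intro mult_right_mono s2) auto
  also have "\<dots> \<le> 4 * (real n + 3) * sqrt (2 ^ n)" by (intro mult_right_mono) auto
  finally have "1 * sqrt (2 * 2 ^ n :: nat) * (ln (2 * card V) + 1) \<le> 4 * (real n + 3) * sqrt (2 ^ n)" .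
  then have "\<bar>\<Sum>j<2 * 2 ^ n. f j x * (\<theta> j * g j y)\<bar> \<le> 4 * (real n + 3) * sqrt (2 ^ n)"
    if "x < 4 * 2 ^ n" "y < 8 * 2 ^ n" for x y
    using bal[of "(x, y)"] that unfolding V_def c_def by auto
  then show ?thesis using \<theta> by blast
qed

lemma flat_system_exists: "\<exists>P Q. flat_system P Q"
proof -
  have "\<exists>P. \<forall>n. \<exists>Q. flat_pair n (P n) Q" using flat_pair_exists by (intro choice allI)
  then obtain P where "\<forall>n. \<exists>Q. flat_pair n (P n) Q" by blast
  then have "\<exists>Q. \<forall>n. flat_pair n (P n) (Q n)" by (rule choice)
  then obtain Q where flat: "\<And>n. flat_pair n (P n) (Q n)" by blast
  have abs1: "\<bar>P n j g\<bar> = 1" "\<bar>Q n j g\<bar> = 1" for n j g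
    using flat[of n] unfolding flat_pair_def by blast+
  have PP: "(\<Sum>g<4 * 2 ^ n. P n j g * P n k g) = (if j = k then 4 * 2 ^ n else 0)"
    if "j < 2 ^ n" "k < 2 ^ n" for n j k
    using flat[of n] that unfolding flat_pair_def by blast
  have QQ: "(\<Sum>g<4 * 2 ^ n. Q n j g * Q n k g) = (if j = k then 4 * 2 ^ n else 0)"
    if "j < 2 * 2 ^ n" "k < 2 * 2 ^ n" for n j k
    using flat[of n] that unfolding flat_pair_def by blast
  have PQ: "(\<Sum>g<4 * 2 ^ n. P n j g * Q n k g) = 0" if "j < 2 ^ n" "k < 2 * 2 ^ n" for n j k
    using flat[of n] that unfolding flat_pair_def by blast
  have same: "\<bar>(\<Sum>k<2 * 2 ^ n. Q n k g * Q n k h) / 2 - (\<Sum>j<2 ^ n. P n j g * P n j h)\<bar>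
        \<le> 4 * (real n + 3) * sqrt (2 ^ n)" if "g < 4 * 2 ^ n" "h < 4 * 2 ^ n" for n g h
    using flat[of n] that unfolding flat_pair_def by blast
  have "\<exists>\<theta>. (\<forall>j. \<theta> j \<in> {1, -1}) \<and> (\<forall>x<4 * 2 ^ n. \<forall>y<8 * 2 ^ n.
     \<bar>\<Sum>j<2 * 2 ^ n. Q n j x * (\<theta> j * P (Suc n) j y)\<bar> \<le> 4 * (real n + 3) * sqrt (2 ^ n))" for n
    by (rule balancing_signs) (simp_all add: abs1)
  then have "\<exists>\<theta>. \<forall>n. (\<forall>j. \<theta> n j \<in> {1, -1}) \<and> (\<forall>x<4 * 2 ^ n. \<forall>y<8 * 2 ^ n.
     \<bar>\<Sum>j<2 * 2 ^ n. Q n j x * (\<theta> n j * P (Suc n) j y)\<bar> \<le> 4 * (real n + 3) * sqrt (2 ^ n))"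
    by (intro choice allI)
  then obtain \<theta> where all: "\<forall>n. (\<forall>j. \<theta> n j \<in> {1, -1 :: real}) \<and> (\<forall>x<4 * 2 ^ n. \<forall>y<8 * 2 ^ n.
     \<bar>\<Sum>j<2 * 2 ^ n. Q n j x * (\<theta> n j * P (Suc n) j y)\<bar> \<le> 4 * (real n + 3) * sqrt (2 ^ n))" ..
  have \<theta>: "\<theta> n j \<in> {1, -1}" for n j using all by blast
  have nxt: "\<bar>\<Sum>j<2 * 2 ^ n. Q n j x * (\<theta> n j * P (Suc n) j y)\<bar> \<le> 4 * (real n + 3) * sqrt (2 ^ n)"
    if "x < 4 * 2 ^ n" "y < 8 * 2 ^ n" for n x y
    using all that by blast
  define \<sigma> where "\<sigma> n j = \<theta> (n - 1) j" for n j
  have \<sigma>2: "\<sigma> n j * \<sigma> n j = 1" for n j using \<theta>[of "n - 1" j] by (auto simp: \<sigma>_def)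
  define P' where "P' n j i = (if i \<in> block n then \<sigma> n j * P n j (i - 4 * 2 ^ n) else 0)" for n j i
  define Q' where "Q' n j i = (if i \<in> block n then Q n j (i - 4 * 2 ^ n) else 0)" for n j i
  have sq: "P n j g * P n j g = 1" "Q n j g * Q n j g = 1" for n j g
    using abs1[where n = n and j = j and g = g] abs_mult_self_eq[of "P n j g"] abs_mult_self_eq[of "Q n j g"] by simp_all
  have eq: "\<sigma> n j * x * (\<sigma> n j * y) = x * y" for n j x y
  proof -
    have "\<sigma> n j * x * (\<sigma> n j * y) = (\<sigma> n j * \<sigma> n j) * (x * y)" by (simp only: mult_ac)
    then show ?thesis by (simp add: \<sigma>2)
  qed
  have "flat_system P' Q'"
  proof
    show "P' n j i * P' n j i = 1" if "i \<in> block n" for n j i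
      using that by (simp add: P'_def eq sq)
    show "(\<Sum>i\<in>block n. P' n j i * P' n k i) = (if j = k then 4 * 2 ^ n else 0)"
      if "j < 2 ^ n" "k < 2 ^ n" for n j k
    proof -
      have "(\<Sum>i\<in>block n. P' n j i * P' n k i)
          = (\<Sum>i\<in>block n. \<sigma> n j * \<sigma> n k * (P n j (i - 4 * 2 ^ n) * P n k (i - 4 * 2 ^ n)))"
        by (intro sum.cong) (auto simp: P'_def)
      also have "\<dots> = \<sigma> n j * \<sigma> n k * (\<Sum>g<4 * 2 ^ n. P n j g * P n k g)"
        unfolding sum_block[of "\<lambda>g. \<sigma> n j * \<sigma> n k * (P n j g * P n k g)"] by (simp add: sum_distrib_left)
      also have "\<dots> = (if j = k then 4 * 2 ^ n else 0)" using that \<sigma>2[of n k] by (simp add: PP)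
      finally show ?thesis .
    qed
    show "(\<Sum>i\<in>block n. Q' n j i * Q' n k i) = (if j = k then 4 * 2 ^ n else 0)"
      if "j < 2 * 2 ^ n" "k < 2 * 2 ^ n" for n j k
    proof -
      have "(\<Sum>i\<in>block n. Q' n j i * Q' n k i)
          = (\<Sum>i\<in>block n. Q n j (i - 4 * 2 ^ n) * Q n k (i - 4 * 2 ^ n))"
        by (intro sum.cong) (auto simp: Q'_def)
      also have "\<dots> = (\<Sum>g<4 * 2 ^ n. Q n j g * Q n k g)"
        by (rule sum_block)
      finally show ?thesis using that by (simp add: QQ)
    qed
    show "(\<Sum>i\<in>block n. P' n j i * Q' n k i) = 0"
      if "j < 2 ^ n" "k < 2 * 2 ^ n" for n j k
    proof -
      have "(\<Sum>i\<in>block n. P' n j i * Q' n k i)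
          = (\<Sum>i\<in>block n. \<sigma> n j * (P n j (i - 4 * 2 ^ n) * Q n k (i - 4 * 2 ^ n)))"
        by (intro sum.cong) (auto simp: P'_def Q'_def)
      also have "\<dots> = \<sigma> n j * (\<Sum>g<4 * 2 ^ n. P n j g * Q n k g)"
        unfolding sum_block[of "\<lambda>g. \<sigma> n j * (P n j g * Q n k g)"] by (simp add: sum_distrib_left)
      finally show ?thesis using that by (simp add: PQ)
    qed
    show "\<bar>(\<Sum>j<2 * 2 ^ n. Q' n j i * Q' n j k) / 2 - (\<Sum>j<2 ^ n. P' n j i * P' n j k)\<bar>
        \<le> 4 * (real n + 3) * sqrt (2 ^ n)" if "i \<in> block n" "k \<in> block n" for n i k
    proof -
      have "i - 4 * 2 ^ n < 4 * 2 ^ n" "k - 4 * 2 ^ n < 4 * 2 ^ n" using that by (auto simp: block_def)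
      from same[OF this] show ?thesis using that by (simp add: P'_def Q'_def eq)
    qed
    show "\<bar>\<Sum>j<2 * 2 ^ n. Q' n j i * P' (Suc n) j k\<bar> \<le> 4 * (real n + 3) * sqrt (2 ^ n)"
      if "i \<in> block n" "k \<in> block (Suc n)" for n i k
    proof -
      have "i - 4 * 2 ^ n < 4 * 2 ^ n" "k - 4 * 2 ^ Suc n < 8 * 2 ^ n" using that by (auto simp: block_def)
      from nxt[OF this] show ?thesis using that by (simp add: P'_def Q'_def \<sigma>_def)
    qed
  qed (simp_all add: P'_def Q'_def sq)
  then show ?thesis by blast
qed

section \<open>A nilpotent matrix with trace one\<close>

lemma block_disjoint: "i \<in> block n \<Longrightarrow> i \<in> block m \<Longrightarrow> n = m"
proof (rule ccontr)
  assume i: "i \<in> block n" "i \<in> block m" and "n \<noteq> m"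
  have *: False if "k < l" "i \<in> block k" "i \<in> block l" for k l
  proof -
    have "(2::nat) ^ Suc k \<le> 2 ^ l" using that(1) by (intro power_increasing) auto
    then show False using that(2,3) by (auto simp: block_def)
  qed
  show False using *[of n m] *[of m n] i \<open>n \<noteq> m\<close> by linarith
qed

lemma block_exists: "4 \<le> i \<Longrightarrow> \<exists>n. i \<in> block n"
proof -
  assume "4 \<le> i"
  then have "1 \<le> i div 4" by simp
  then obtain n where "2 ^ n \<le> i div 4" "i div 4 < 2 ^ (n + 1)" using ex_power_ivl1[of 2 "i div 4"] by auto
  then have "i \<in> block n" by (simp add: block_def less_eq_div_iff_mult_less_eq div_less_iff_less_mult)
  then show ?thesis by blast
qed

lemma less_of_block: "i \<in> block n \<Longrightarrow> n + 2 < i"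
proof -
  assume "i \<in> block n"
  moreover have "n < 2 ^ n" by (rule less_exp)
  ultimately show ?thesis unfolding block_def atLeastLessThan_iff by linarith
qed

context flat_system
begin

text \<open>
  A vector \<open>E m j\<close> lives on the two blocks \<open>m - 1\<close> and \<open>m\<close>, and \<open>F m j\<close> is the difference of the two functionals
  that are biorthogonal to the vectors \<open>E\<close>, one seen on block \<open>m - 1\<close> and one on block \<open>m\<close>, averaged over the
  \<open>2\<^sup>m\<close> indices \<open>j\<close>. Consequently all the \<open>F\<close> annihilate all the \<open>E\<close>, and the matrix \<open>A = \<Sum> F \<otimes> E\<close> has square
  zero. Levels start with \<open>m = 1\<close>.
\<close>

definition E :: "nat \<Rightarrow> nat \<Rightarrow> nat \<Rightarrow> real" where
  "E m j i = Q (m - 1) j i + P m j i"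

definition F :: "nat \<Rightarrow> nat \<Rightarrow> nat \<Rightarrow> real" where
  "F m j i = Q (m - 1) j i / (2 * 4 ^ m) - P m j i / (4 * 4 ^ m)"

text \<open>
  Only finitely many levels meet a given row \<open>i\<close>, and all of them are at most \<open>i\<close>.
\<close>

definition A :: "nat \<Rightarrow> nat \<Rightarrow> real" where
  "A i k = (\<Sum>m\<in>{1..i}. \<Sum>j<2 ^ m. F m j i * E m j k)"

lemma P_other: "i \<in> block n \<Longrightarrow> m \<noteq> n \<Longrightarrow> P m j i = 0"
  and Q_other: "i \<in> block n \<Longrightarrow> m \<noteq> n \<Longrightarrow> Q m j i = 0"
  using block_disjoint[of i n m] P_support[of i m j] Q_support[of i m j] by auto

text \<open>
  In block \<open>n\<close> only the levels \<open>Suc n\<close> (through \<open>Q n\<close>) and \<open>n\<close> (through \<open>P n\<close>, absent if \<open>n = 0\<close>) contribute.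
\<close>

lemma A_block:
  assumes i: "i \<in> block n"
  shows "A i k = ((\<Sum>j<2 * 2 ^ n. Q n j i * E (Suc n) j k) / 2
             - (if n = 0 then 0 else \<Sum>j<2 ^ n. P n j i * E n j k)) / (4 * 4 ^ n)"
proof -
  define t where "t m = (\<Sum>j<2 ^ m. F m j i * E m j k)" for m
  have t0: "t m = 0" if "m \<in> {1..i} - (if n = 0 then {1} else {n, Suc n})" for m
  proof -
    have "m - 1 \<noteq> n" "m \<noteq> n" using that by (auto split: if_splits)
    then show ?thesis unfolding t_def F_def by (simp add: P_other[OF i] Q_other[OF i])
  qed
  have "A i k = sum t {1..i}" by (simp add: A_def t_def)
  also have "\<dots> = sum t (if n = 0 then {1} else {n, Suc n})"
    by (rule sum.mono_neutral_right) (use t0 less_of_block[OF i] in \<open>auto split: if_splits\<close>)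
  also have "\<dots> = t (Suc n) + (if n = 0 then 0 else t n)" by simp
  also have "t (Suc n) = (\<Sum>j<2 * 2 ^ n. Q n j i * E (Suc n) j k) / 2 / (4 * 4 ^ n)"
    unfolding t_def F_def by (simp add: P_other[OF i] sum_divide_distrib)
  also have "(if n = 0 then 0 else t n)
      = - (if n = 0 then 0 else \<Sum>j<2 ^ n. P n j i * E n j k) / (4 * 4 ^ n)"
    unfolding t_def F_def by (simp add: Q_other[OF i] sum_divide_distrib sum_negf)
  finally show ?thesis by (simp add: diff_divide_distrib)
qed

lemma A_outside: "i < 4 \<Longrightarrow> A i k = 0"
proof -
  assume i: "i < 4"
  have "i \<notin> block n" for n
    using i one_le_power[of "2::nat" n] unfolding block_def atLeastLessThan_iff by linarith
  then show ?thesis by (simp add: A_def F_def P_support Q_support)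
qed

lemma A_next:
  assumes "i \<in> block n" "k \<in> block (Suc n)"
  shows "A i k = (\<Sum>j<2 * 2 ^ n. Q n j i * P (Suc n) j k) / (8 * 4 ^ n)"
  unfolding A_block[OF assms(1)] E_def by (simp add: P_other[OF assms(2)] Q_other[OF assms(2)])

lemma A_same:
  assumes "i \<in> block n" "k \<in> block n"
  shows "A i k = ((\<Sum>j<2 * 2 ^ n. Q n j i * Q n j k) / 2
             - (if n = 0 then 0 else \<Sum>j<2 ^ n. P n j i * P n j k)) / (4 * 4 ^ n)"
  unfolding A_block[OF assms(1)] E_def by (cases n) (simp_all add: P_other[OF assms(2)] Q_other[OF assms(2)])

lemma A_previous:
  assumes "i \<in> block (Suc n)" "k \<in> block n"
  shows "A i k = - (\<Sum>j<2 * 2 ^ n. Q n j k * P (Suc n) j i) / (4 * 4 ^ Suc n)"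
  unfolding A_block[OF assms(1)] E_def
  by (simp add: P_other[OF assms(2)] Q_other[OF assms(2)] mult.commute)

lemma A_far:
  assumes "i \<in> block n" "k \<notin> block n" "k \<notin> block (Suc n)" "k \<notin> block (n - 1)"
  shows "A i k = 0"
  unfolding A_block[OF assms(1)] E_def by (simp add: P_support Q_support assms assms(4)[unfolded One_nat_def])

lemma A_banded:
  assumes "A i k \<noteq> 0"
  shows "i \<le> 4 * k" "k \<le> 4 * i"
proof -
  have "4 \<le> i" using assms A_outside[of i k] by force
  then obtain n where n: "i \<in> block n" using block_exists by blast
  consider "k \<in> block n" | "k \<in> block (Suc n)" | "k \<in> block (n - 1)" using A_far[OF n] assms by blast
  then have "i \<le> 4 * k \<and> k \<le> 4 * i"
  proof cases
    case 3
    then show ?thesis using n by (cases n) (auto simp: block_def)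
  qed (use n in \<open>auto simp: block_def\<close>)
  then show "i \<le> 4 * k" "k \<le> 4 * i" by auto
qed

text \<open>
  The three possible positions of \<open>k\<close> correspond to the two correlation estimates of the system, where
  the estimate between neighbouring blocks is used in both directions.
\<close>

lemma A_bound_block:
  assumes i: "i \<in> block n"
  shows "\<bar>A i k\<bar> \<le> (real n + 3) * sqrt (2 ^ n) / 4 ^ n"
proof -
  define \<delta> where "\<delta> = 4 * (real n + 3) * sqrt (2 ^ n)"
  have \<delta>: "0 \<le> \<delta>" by (simp add: \<delta>_def)
  have \<delta>4: "\<delta> / (4 * 4 ^ n) = (real n + 3) * sqrt (2 ^ n) / 4 ^ n" by (simp add: \<delta>_def field_simps)
  have le: "\<bar>x / (4 * 4 ^ n)\<bar> \<le> \<delta> / (4 * 4 ^ n)" if "\<bar>x\<bar> \<le> \<delta>" for x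
    using that by (simp add: divide_right_mono)
  consider "k \<in> block n" | "k \<in> block (Suc n)" | m where "n = Suc m" "k \<in> block m"
    | "A i k = 0"
    using A_far[OF i] by (cases n) auto
  then have "\<bar>A i k\<bar> \<le> \<delta> / (4 * 4 ^ n)"
  proof cases
    case 1
    show ?thesis
    proof (cases "n = 0")
      case False
      then show ?thesis unfolding A_same[OF i 1] using same_level[OF i 1] by (intro le) (simp add: \<delta>_def)
    next
      case True
      have "\<bar>\<Sum>j<2. Q 0 j i * Q 0 j k\<bar> \<le> (\<Sum>j<2::nat. 1)"
      proof (rule order_trans[OF sum_abs sum_mono])
        fix j
        have "\<bar>Q 0 j i\<bar> = 1" "\<bar>Q 0 j k\<bar> = 1"
          using Q_square[of i 0 j] Q_square[of k 0 j] i 1 True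
          by (auto simp flip: power2_eq_square simp: abs_square_eq_1)
        then show "\<bar>Q 0 j i * Q 0 j k\<bar> \<le> 1" by (simp add: abs_mult)
      qed
      then show ?thesis unfolding A_same[OF i 1] using True by (intro le) (simp add: \<delta>_def)
    qed
  next
    case 2
    have "\<bar>A i k\<bar> = \<bar>(\<Sum>j<2 * 2 ^ n. Q n j i * P (Suc n) j k) / 2 / (4 * 4 ^ n)\<bar>"
      unfolding A_next[OF i 2] by simp
    also have "\<dots> \<le> \<delta> / (4 * 4 ^ n)"
      using next_level[OF i 2] \<delta> by (intro le) (simp add: \<delta>_def)
    finally show ?thesis .
  next
    case 3
    have i': "i \<in> block (Suc m)" using i 3 by simp
    have "4 * (real m + 3) * sqrt (2 ^ m) \<le> \<delta>"
      unfolding \<delta>_def using 3(1) by (intro mult_mono) auto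
    then have "\<bar>- (\<Sum>j<2 * 2 ^ m. Q m j k * P (Suc m) j i)\<bar> \<le> \<delta>"
      using next_level[OF 3(2) i'] by simp
    from le[OF this] show ?thesis unfolding A_previous[OF i' 3(2)] using 3(1) by simp
  next
    case 4
    then show ?thesis using \<delta> by simp
  qed
  then show ?thesis unfolding \<delta>4 .
qed

text \<open>
  On the diagonal both kernels count their columns, \<open>2 \<cdot> 2\<^sup>n\<close> and \<open>2\<^sup>n\<close>, and cancel. The exception is the first block,
  where the level \<open>0\<close> is missing: each of its four positions contributes \<open>1/4\<close>. In this way a matrix
  of square zero gets a non-zero trace.
\<close>

lemma A_diagonal: "8 \<le> i \<Longrightarrow> A i i = 0" and A_trace: "(\<Sum>i<8. A i i) = 1"
proof -
  show "A i i = 0" if i: "8 \<le> i"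
  proof -
    obtain n where n: "i \<in> block n" using block_exists[of i] i by auto
    then have "n \<noteq> 0" using i by (auto simp: block_def intro!: gr0I)
    then show ?thesis unfolding A_same[OF n n] using P_square[OF n] Q_square[OF n] by simp
  qed
  have "A i i = 1 / 4" if "i \<in> {4..<8}" for i
  proof -
    have n: "i \<in> block 0" using that by (simp add: block_def)
    show ?thesis unfolding A_same[OF n n] using Q_square[OF n] by simp
  qed
  then have "(\<Sum>i\<in>{4..<8}. A i i) = (\<Sum>i\<in>{4..<8::nat}. 1 / 4)" by (intro sum.cong) auto
  then have "(\<Sum>i\<in>{4..<8}. A i i) = 1" by simp
  moreover have "(\<Sum>i<8. A i i) = (\<Sum>i\<in>{4..<8}. A i i)"
    by (rule sum.mono_neutral_right) (auto simp: A_outside)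
  ultimately show "(\<Sum>i<8. A i i) = 1" by simp
qed

lemma sum_eq_sum_block:
  fixes f :: "nat \<Rightarrow> real"
  assumes "8 * 2 ^ n \<le> L" "\<And>l. l \<notin> block n \<Longrightarrow> f l = 0"
  shows "(\<Sum>l<L. f l) = (\<Sum>l\<in>block n. f l)"
  by (rule sum.mono_neutral_right) (use assms in \<open>auto simp: block_def\<close>)

text \<open>
  If \<open>m' = m\<close>, the contributions \<open>4 \<cdot> 2\<^bsup>m - 1\<^esup> / (2 \<cdot> 4\<^sup>m)\<close> of \<open>Q\<close> and \<open>4 \<cdot> 2\<^sup>m / (4 \<cdot> 4\<^sup>m)\<close> of \<open>P\<close> cancel; all other
  pairs meet at most in one block, where \<open>P\<close> and \<open>Q\<close> are orthogonal.
\<close>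

lemma E_F_orthogonal:
  assumes m: "1 \<le> m" "1 \<le> m'" and j: "j < 2 ^ m" "j' < 2 ^ m'" and L: "8 * 2 ^ m' \<le> L"
  shows "(\<Sum>l<L. E m j l * F m' j' l) = 0"
proof -
  obtain n n' where n: "m = Suc n" "m' = Suc n'" using m by (metis Suc_le_D One_nat_def)
  have L': "8 * 2 ^ n' \<le> L" using L by (simp add: n)
  have jn: "j < 2 * 2 ^ n" "j' < 2 * 2 ^ n'" using j by (simp_all add: n)
  have QQ: "(\<Sum>l<L. Q n j l * Q n' j' l) = (if n = n' \<and> j = j' then 4 * 2 ^ n' else 0)"
  proof (cases "n = n'")
    case True
    then show ?thesis using sum_eq_sum_block[OF L', of "\<lambda>l. Q n j l * Q n' j' l"] Q_orth[of j n' j'] jn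
      by (simp add: Q_support)
  next
    case False
    have "Q n j l * Q n' j' l = 0" for l
      using Q_support[of l n' j'] Q_other[of l n' n j] False by (cases "l \<in> block n'") auto
    then show ?thesis using False by (simp del: mult_eq_0_iff add: sum.neutral)
  qed
  have PP: "(\<Sum>l<L. P m j l * P m' j' l) = (if m = m' \<and> j = j' then 4 * 2 ^ m' else 0)"
  proof (cases "m = m'")
    case True
    then show ?thesis using sum_eq_sum_block[OF L, of "\<lambda>l. P m j l * P m' j' l"] P_orth[of j m' j'] j
      by (simp add: P_support)
  next
    case False
    have "P m j l * P m' j' l = 0" for l
      using P_support[of l m' j'] P_other[of l m' m j] False by (cases "l \<in> block m'") auto
    then show ?thesis using False by (simp del: mult_eq_0_iff add: sum.neutral)
  qed
  have PQ: "(\<Sum>l<L. P m j l * Q n' j' l) = 0"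
  proof (cases "m = n'")
    case True
    then show ?thesis using sum_eq_sum_block[OF L', of "\<lambda>l. P m j l * Q n' j' l"] PQ_orth[of j n' j'] j jn
      by (simp add: P_support Q_support)
  next
    case False
    have "P m j l * Q n' j' l = 0" for l
      using Q_support[of l n' j'] P_other[of l n' m j] False by (cases "l \<in> block n'") auto
    then show ?thesis by (simp only: sum.neutral_const)
  qed
  have QP: "(\<Sum>l<L. Q n j l * P m' j' l) = 0"
  proof (cases "n = m'")
    case True
    then show ?thesis using sum_eq_sum_block[OF L, of "\<lambda>l. Q n j l * P m' j' l"] PQ_orth[of j' m' j] j jn
      by (simp add: P_support Q_support mult.commute)
  next
    case False
    have "Q n j l * P m' j' l = 0" for l
      using P_support[of l m' j'] Q_other[of l m' n j] False by (cases "l \<in> block m'") auto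
    then show ?thesis by (simp only: sum.neutral_const)
  qed
  have pt: "E m j l * F m' j' l = Q n j l * Q n' j' l / (2 * 4 ^ m') - Q n j l * P m' j' l / (4 * 4 ^ m')
        + P m j l * Q n' j' l / (2 * 4 ^ m') - P m j l * P m' j' l / (4 * 4 ^ m')" for l
    by (simp add: E_def F_def n distrib_right right_diff_distrib add_divide_distrib diff_divide_distrib)
  have "(\<Sum>l<L. E m j l * F m' j' l)
      = (\<Sum>l<L. Q n j l * Q n' j' l) / (2 * 4 ^ m') - (\<Sum>l<L. Q n j l * P m' j' l) / (4 * 4 ^ m')
        + (\<Sum>l<L. P m j l * Q n' j' l) / (2 * 4 ^ m') - (\<Sum>l<L. P m j l * P m' j' l) / (4 * 4 ^ m')"
    by (simp only: pt sum.distrib sum_subtractf sum_divide_distrib)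
  also have "\<dots> = 0" unfolding QQ QP PQ PP by (auto simp: n)
  finally show ?thesis .
qed

lemma A_square_zero: "(\<Sum>l\<le>4 * k. A i l * A l k) = 0"
proof -
  define I where "I n = (SIGMA m:{1..n}. {..<2 ^ m :: nat})" for n :: nat
  \<comment> \<open>This makes the range of levels independent of \<open>l\<close>, so that the sums can be interchanged.\<close>
  have F0: "F m j l = 0" if "l < m" for m j l
  proof -
    have "l \<notin> block m" "l \<notin> block (m - 1)" using less_of_block[of l m] less_of_block[of l "m - 1"] that by auto
    then show ?thesis by (simp add: F_def P_support Q_support)
  qed
  have A_I: "A l k = (\<Sum>p\<in>I n. F (fst p) (snd p) l * E (fst p) (snd p) k)" if "l \<le> n" for l k n
  proof -
    have "A l k = (\<Sum>m\<in>{1..n}. \<Sum>j<2 ^ m. F m j l * E m j k)"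
      unfolding A_def by (rule sum.mono_neutral_left) (use that F0 in auto)
    then show ?thesis by (simp add: I_def sum.Sigma case_prod_beta)
  qed
  have "(\<Sum>l\<le>4 * k. A i l * A l k)
      = (\<Sum>l\<le>4 * k. \<Sum>p\<in>I i. \<Sum>p'\<in>I (4 * k). F (fst p) (snd p) i * E (fst p') (snd p') k
           * (E (fst p) (snd p) l * F (fst p') (snd p') l))"
    by (intro sum.cong refl) (simp add: A_I[of i i] A_I[of _ "4 * k"] sum_product mult_ac)
  also have "\<dots> = (\<Sum>p\<in>I i. \<Sum>p'\<in>I (4 * k). F (fst p) (snd p) i * E (fst p') (snd p') k
           * (\<Sum>l<Suc (4 * k). E (fst p) (snd p) l * F (fst p') (snd p') l))"
    unfolding lessThan_Suc_atMost sum_distrib_left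
    by (subst sum.swap, rule sum.cong[OF refl], rule sum.swap)
  also have "\<dots> = 0"
  proof (intro sum.neutral ballI)
    fix p p' assume "p \<in> I i" "p' \<in> I (4 * k)"
    then obtain m j m' j' where p: "p = (m, j)" "p' = (m', j')"
      and *: "m \<in> {1..i}" "j < 2 ^ m" "m' \<in> {1..4 * k}" "j' < 2 ^ m'"
      by (auto simp: I_def)
    show "F (fst p) (snd p) i * E (fst p') (snd p') k
        * (\<Sum>l<Suc (4 * k). E (fst p) (snd p) l * F (fst p') (snd p') l) = 0"
    proof (cases "k \<in> block (m' - 1) \<or> k \<in> block m'")
      case True
      \<comment> \<open>The summation up to \<open>4 k\<close> covers the support of \<open>F m' j'\<close> whenever \<open>E m' j'\<close> does not vanish at \<open>k\<close>.\<close>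
      then have "8 * 2 ^ m' \<le> Suc (4 * k)" using * by (cases m') (auto simp: block_def)
      then have "(\<Sum>l<Suc (4 * k). E m j l * F m' j' l) = 0" using * by (intro E_F_orthogonal) auto
      then show ?thesis by (simp add: p)
    next
      case False
      then show ?thesis by (simp add: p E_def P_support Q_support)
    qed
  qed
  finally show ?thesis .
qed

text \<open>
  In block \<open>n\<close> the bound of \<open>A_bound_block\<close> is \<open>(n + 3) 2\<^bsup>-3n/2\<^esup>\<close>, and \<open>i\<close> is comparable to \<open>2\<^sup>n\<close>. The linear
  factor is absorbed by lowering the exponent below \<open>3/2\<close>.
\<close>

lemma A_bound:
  assumes s: "0 \<le> s" "s < 3 / 2"
  shows "\<exists>C. \<forall>i k. \<bar>A i k\<bar> \<le> C * (real i + 1) powr (- s)"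
proof -
  define \<epsilon> where "\<epsilon> = 3 / 2 - s"
  have \<epsilon>: "\<epsilon> > 0" using s by (simp add: \<epsilon>_def)
  define D where "D = 3 + 1 / (\<epsilon> * ln 2)"
  have D: "0 \<le> D" using \<epsilon> by (simp add: D_def)
  have poly: "real n + 3 \<le> D * 2 powr (\<epsilon> * n)" for n
  proof -
    have "real n + 3 \<le> D * (1 + \<epsilon> * n * ln 2)" using \<epsilon> by (simp add: D_def field_simps)
    also have "\<dots> \<le> D * exp (\<epsilon> * n * ln 2)" by (intro mult_left_mono D) simp
    finally show ?thesis by (simp add: powr_def)
  qed
  have "\<bar>A i k\<bar> \<le> D * 8 powr s * (real i + 1) powr (- s)" for i k
  proof (cases "i < 4")
    case True
    then show ?thesis using D by (simp add: A_outside)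
  next
    case False
    then obtain n where n: "i \<in> block n" using block_exists[of i] by auto
    have "\<bar>A i k\<bar> \<le> (real n + 3) * sqrt (2 ^ n) / 4 ^ n" by (rule A_bound_block[OF n])
    also have "\<dots> \<le> D * 2 powr (\<epsilon> * n) * sqrt (2 ^ n) / 4 ^ n"
      by (intro divide_right_mono mult_right_mono poly) auto
    also have "\<dots> = D * (2 powr (\<epsilon> * n) * 2 powr (n / 2) * 2 powr (- (2 * n)))"
    proof -
      have "sqrt (2 ^ n) = (2::real) powr (n / 2)" by (simp add: powr_half_sqrt[symmetric] powr_powr flip: powr_realpow)
      moreover have "2 powr (- (2 * real n)) = 1 / 4 ^ n"
      proof -
        have "2 powr (2 * real n) = 4 powr real n" by (simp add: powr_powr[symmetric])
        then show ?thesis by (simp add: powr_minus_divide powr_realpow)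
      qed
      ultimately show ?thesis by simp
    qed
    also have "\<dots> = D * 2 powr (- s * n)" by (simp add: \<epsilon>_def algebra_simps flip: powr_add)
    also have "2 powr (- s * n) = 8 powr s * (8 * 2 ^ n) powr (- s)"
    proof -
      have "(8 * 2 ^ n) powr (- s) = 8 powr (- s) * (2 ^ n) powr (- s)" by (simp add: powr_mult)
      also have "(2 ^ n) powr (- s) = (2 powr n) powr (- s)" by (simp add: powr_realpow)
      also have "\<dots> = 2 powr (- s * n)" by (simp add: powr_powr mult.commute)
      finally show ?thesis by (simp add: powr_minus)
    qed
    also have "D * (8 powr s * (8 * 2 ^ n) powr (- s)) \<le> D * (8 powr s * (real i + 1) powr (- s))"
    proof -
      have "i + 1 \<le> 8 * 2 ^ n" using n by (auto simp: block_def)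
      from of_nat_mono[OF this, where 'a = real] have "real i + 1 \<le> 8 * 2 ^ n" by simp
      then show ?thesis using s D by (intro mult_left_mono powr_mono2') auto
    qed
    finally show ?thesis by (simp add: mult.assoc)
  qed
  then show ?thesis by blast
qed

end

text \<open>
  The constant depends on \<open>s\<close>, the matrix does not. Bandedness gives a meaning to \<open>a\<^sup>2 = 0\<close> by finite
  sums; the trace is \<open>1\<close> when the diagonal is summed first.
\<close>

theorem nilpotent_matrix_with_trace_one:
  "\<exists>a :: nat \<Rightarrow> nat \<Rightarrow> real.
     (\<forall>s. 0 \<le> s \<and> s < 3 / 2 \<longrightarrow> (\<exists>C. \<forall>i k. \<bar>a i k\<bar> \<le> C * (real i + 1) powr (- s))) \<and>
     (\<forall>i k. a i k \<noteq> 0 \<longrightarrow> i \<le> 4 * k \<and> k \<le> 4 * i) \<and>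
     (\<forall>i k. (\<Sum>l\<le>4 * k. a i l * a l k) = 0) \<and>
     (\<forall>i\<ge>8. a i i = 0) \<and> (\<Sum>i<8. a i i) = 1"
proof -
  obtain P Q where "flat_system P Q" using flat_system_exists by blast
  then interpret flat_system P Q .
  show ?thesis
    by (intro exI[of _ A] conjI allI impI A_bound A_square_zero A_trace A_diagonal) (auto dest: A_banded)
qed

section \<open>Banach spaces and ranges of operators with the quotient norm\<close>

text \<open>
  The axioms of \<open>banach_space\<close> in the form of rules.
\<close>

locale Banach = vector_space "scl X"
  for X :: "('k::real_normed_field, 'a::ab_group_add) nspace" +
  assumes banach: "banach_space X"
begin

lemma subspace_vecs: "subspace (vecs X)"
  using banach by (simp add: banach_space_def)

lemmas vecs_0 = subspace_0[OF subspace_vecs]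
  and vecs_add = subspace_add[OF subspace_vecs]
  and vecs_diff = subspace_diff[OF subspace_vecs]
  and vecs_scale = subspace_scale[OF subspace_vecs]
  and vecs_sum = subspace_sum[OF subspace_vecs]

lemma nrm_nonneg: "x \<in> vecs X \<Longrightarrow> 0 \<le> nrm X x"
  and nrm_eq_0_iff: "x \<in> vecs X \<Longrightarrow> nrm X x = 0 \<longleftrightarrow> x = 0"
  and nrm_scale: "x \<in> vecs X \<Longrightarrow> nrm X (scl X c x) = norm c * nrm X x"
  and nrm_triangle: "x \<in> vecs X \<Longrightarrow> y \<in> vecs X \<Longrightarrow> nrm X (x + y) \<le> nrm X x + nrm X y"
  using banach by (simp_all add: banach_space_def)

lemma nrm_0: "nrm X 0 = 0"
  using nrm_eq_0_iff[OF vecs_0] by simp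

lemma nrm_minus_commute: "x \<in> vecs X \<Longrightarrow> y \<in> vecs X \<Longrightarrow> nrm X (x - y) = nrm X (y - x)"
  using nrm_scale[OF vecs_diff, of x y "-1"] by simp

lemma nrm_triangle_diff:
  "x \<in> vecs X \<Longrightarrow> y \<in> vecs X \<Longrightarrow> z \<in> vecs X \<Longrightarrow> nrm X (x - z) \<le> nrm X (x - y) + nrm X (y - z)"
  using nrm_triangle[OF vecs_diff vecs_diff, of x y y z] by simp

lemma nrm_sum_le: "(\<And>i. i \<in> I \<Longrightarrow> x i \<in> vecs X) \<Longrightarrow> nrm X (\<Sum>i\<in>I. x i) \<le> (\<Sum>i\<in>I. nrm X (x i))"
proof (induction I rule: infinite_finite_induct)
  case (insert i I)
  then show ?case using nrm_triangle[of "x i" "\<Sum>i\<in>I. x i"] vecs_sum[of I x] by force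
qed (simp_all add: nrm_0)

lemma complete:
  assumes "range f \<subseteq> vecs X" "\<And>e. 0 < e \<Longrightarrow> \<exists>M. \<forall>m\<ge>M. \<forall>n\<ge>M. nrm X (f m - f n) < e"
  shows "\<exists>x\<in>vecs X. (\<lambda>n. nrm X (f n - x)) \<longlonglongrightarrow> 0"
proof -
  have "\<forall>f::nat \<Rightarrow> 'a. range f \<subseteq> vecs X \<and>
        (\<forall>e>0. \<exists>M. \<forall>m\<ge>M. \<forall>n\<ge>M. nrm X (f m - f n) < e) \<longrightarrow>
        (\<exists>x\<in>vecs X. (\<lambda>n. nrm X (f n - x)) \<longlonglongrightarrow> 0)"
    using banach by (simp add: banach_space_def)
  then show ?thesis using assms by blast
qed

lemma nrm_limit_unique:
  assumes "range f \<subseteq> vecs X" "x \<in> vecs X" "y \<in> vecs X"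
    "(\<lambda>n. nrm X (f n - x)) \<longlonglongrightarrow> 0" "(\<lambda>n. nrm X (f n - y)) \<longlonglongrightarrow> 0"
  shows "x = y"
proof -
  have f: "f n \<in> vecs X" for n using assms(1) by auto
  have "nrm X (x - y) \<le> nrm X (f n - x) + nrm X (f n - y)" for n
    using nrm_triangle_diff[OF assms(2) f assms(3), of n] nrm_minus_commute[OF assms(2) f, of n] by simp
  moreover have "(\<lambda>n. nrm X (f n - x) + nrm X (f n - y)) \<longlonglongrightarrow> 0"
    using tendsto_add[OF assms(4,5)] by simp
  ultimately have "nrm X (x - y) \<le> 0" by (intro LIMSEQ_le_const) auto
  then have "nrm X (x - y) = 0" using nrm_nonneg[OF vecs_diff[OF assms(2,3)]] by simp
  then show ?thesis using nrm_eq_0_iff[OF vecs_diff[OF assms(2,3)]] by simp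
qed

lemma series_converges:
  assumes w: "\<And>k. w k \<in> vecs X" and s: "summable (\<lambda>k. nrm X (w k))"
  shows "\<exists>x\<in>vecs X. (\<lambda>n. nrm X ((\<Sum>k<n. w k) - x)) \<longlonglongrightarrow> 0"
proof (rule complete)
  show "range (\<lambda>n. \<Sum>k<n. w k) \<subseteq> vecs X" using vecs_sum[of _ w] w by auto
  fix e :: real assume "0 < e"
  then obtain M where M: "\<And>m n. m \<ge> M \<Longrightarrow> norm (sum (\<lambda>k. nrm X (w k)) {m..<n}) < e"
    using s unfolding summable_Cauchy by blast
  have le: "nrm X ((\<Sum>k<n. w k) - (\<Sum>k<m. w k)) < e" if "M \<le> m" "m \<le> n" for m n
  proof -
    have "(\<Sum>k<n. w k) - (\<Sum>k<m. w k) = (\<Sum>k\<in>{m..<n}. w k)"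
      using sum_diff_nat_ivl[of 0 m n w] that by (simp add: atLeast0LessThan)
    then have "nrm X ((\<Sum>k<n. w k) - (\<Sum>k<m. w k)) \<le> (\<Sum>k\<in>{m..<n}. nrm X (w k))"
      using nrm_sum_le[of "{m..<n}" w] w by simp
    also have "\<dots> < e" using M[OF that(1), of n] by simp
    finally show ?thesis .
  qed
  have "nrm X ((\<Sum>k<m. w k) - (\<Sum>k<n. w k)) < e" if "M \<le> m" "M \<le> n" for m n
  proof (cases "m \<le> n")
    case True
    have "nrm X ((\<Sum>k<m. w k) - (\<Sum>k<n. w k)) = nrm X ((\<Sum>k<n. w k) - (\<Sum>k<m. w k))"
      using w by (intro nrm_minus_commute vecs_sum) auto
    then show ?thesis using le[of m n] that True by simp
  next
    case False
    then show ?thesis using le[of n m] that by simp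
  qed
  then show "\<exists>M. \<forall>m\<ge>M. \<forall>n\<ge>M. nrm X ((\<Sum>k<m. w k) - (\<Sum>k<n. w k)) < e" by blast
qed

end

lemma Banach_iff: "Banach X \<longleftrightarrow> banach_space X"
  by (auto simp: Banach_def Banach_axioms_def banach_space_def)

lemma banach_closed_subspace:
  assumes "banach_space E" "closed_subspace E V"
  shows "banach_space (E\<lparr>vecs := V\<rparr>)"
proof -
  interpret Banach E using assms(1) by (simp add: Banach_iff)
  have V: "V \<subseteq> vecs E" "subspace V" using assms(2) by (auto simp: closed_subspace_def)
  have "\<exists>x\<in>V. (\<lambda>n. nrm E (f n - x)) \<longlonglongrightarrow> 0"
    if f: "range f \<subseteq> V" and c: "\<forall>e>0. \<exists>M. \<forall>m\<ge>M. \<forall>n\<ge>M. nrm E (f m - f n) < e" for f :: "nat \<Rightarrow> _"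
  proof -
    obtain x where "x \<in> vecs E" "(\<lambda>n. nrm E (f n - x)) \<longlonglongrightarrow> 0"
      using complete[of f] f c V(1) by blast
    then show ?thesis using assms(2) f unfolding closed_subspace_def by blast
  qed
  then show ?thesis using V nrm_nonneg nrm_eq_0_iff nrm_scale nrm_triangle vector_space_axioms
    by (auto simp: banach_space_def subset_iff)
qed

text \<open>
  The range of \<open>T\<close> with the norm of the quotient of \<open>W\<close> by the kernel of \<open>T\<close>.
\<close>

definition range_space :: "('k::real_normed_field, 'b::ab_group_add) nspace \<Rightarrow> ('k, 'a::ab_group_add) nspace
    \<Rightarrow> ('b \<Rightarrow> 'a) \<Rightarrow> ('k, 'a) nspace" where
  "range_space W X T = \<lparr>vecs = T ` vecs W, scl = scl X,
     nrm = (\<lambda>z. Inf {nrm W w | w. w \<in> vecs W \<and> T w = z})\<rparr>"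

locale operator_range = W: Banach W + X: Banach X
  for W :: "('k::real_normed_field, 'b::ab_group_add) nspace"
    and X :: "('k, 'a::ab_group_add) nspace" +
  fixes T :: "'b \<Rightarrow> 'a"
  assumes T: "T \<in> bounded_op W X"
begin

definition "Z = range_space W X T"

lemma Z_simps [simp]: "vecs Z = T ` vecs W" "scl Z = scl X"
  by (simp_all add: Z_def range_space_def)

lemma T_vecs: "w \<in> vecs W \<Longrightarrow> T w \<in> vecs X"
  and T_add: "w \<in> vecs W \<Longrightarrow> v \<in> vecs W \<Longrightarrow> T (w + v) = T w + T v"
  and T_scale: "w \<in> vecs W \<Longrightarrow> T (scl W c w) = scl X c (T w)"
  using T by (auto simp: bounded_op_def)

lemma T_0: "T 0 = 0"
  using T_add[OF W.vecs_0 W.vecs_0] by simp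

lemma T_diff: "w \<in> vecs W \<Longrightarrow> v \<in> vecs W \<Longrightarrow> T (w - v) = T w - T v"
  using T_add[OF W.vecs_diff, of w v v] by (simp add: algebra_simps)

lemma T_sum: "(\<And>i. i \<in> I \<Longrightarrow> w i \<in> vecs W) \<Longrightarrow> T (\<Sum>i\<in>I. w i) = (\<Sum>i\<in>I. T (w i))"
proof (induction I rule: infinite_finite_induct)
  case (insert i I)
  then show ?case using T_add[of "w i" "\<Sum>i\<in>I. w i"] W.vecs_sum[of I w] by force
qed (simp_all add: T_0)

lemma nrm_Z_le: "w \<in> vecs W \<Longrightarrow> nrm Z (T w) \<le> nrm W w"
  unfolding Z_def range_space_def
  by (auto intro!: cInf_lower bdd_belowI[of _ 0] simp: W.nrm_nonneg)

lemma nrm_Z_greatest: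
  assumes "z \<in> vecs Z" "\<And>w. w \<in> vecs W \<Longrightarrow> T w = z \<Longrightarrow> c \<le> nrm W w"
  shows "c \<le> nrm Z z"
  unfolding Z_def range_space_def nspace.select_convs by (rule cInf_greatest) (use assms in auto)

lemma lift:
  assumes "z \<in> vecs Z" "nrm Z z < b"
  obtains w where "w \<in> vecs W" "T w = z" "nrm W w < b"
  using nrm_Z_greatest[OF assms(1), of b] assms(2) by (meson not_le)

lemma Z_subspace: "X.subspace (T ` vecs W)"
proof (rule X.subspaceI)
  show "0 \<in> T ` vecs W" using T_0 W.vecs_0 by force
  show "x + y \<in> T ` vecs W" if "x \<in> T ` vecs W" "y \<in> T ` vecs W" for x y
    using that T_add W.vecs_add by (metis (no_types, lifting) image_iff)
  show "scl X c x \<in> T ` vecs W" if "x \<in> T ` vecs W" for c x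
    using that T_scale W.vecs_scale by (metis (no_types, lifting) image_iff)
qed

lemma inclusion_bounded: obtains C where "0 \<le> C" "\<And>z. z \<in> vecs Z \<Longrightarrow> nrm X z \<le> C * nrm Z z"
proof -
  have "\<exists>C. \<forall>w\<in>vecs W. nrm X (T w) \<le> C * nrm W w" using T by (simp add: bounded_op_def)
  then obtain C where C: "\<And>w. w \<in> vecs W \<Longrightarrow> nrm X (T w) \<le> C * nrm W w" by blast
  define D where "D = \<bar>C\<bar> + 1"
  have D: "0 < D" by (simp add: D_def)
  have "nrm X (T w) \<le> D * nrm W w" if "w \<in> vecs W" for w
  proof -
    have "C * nrm W w \<le> D * nrm W w" using W.nrm_nonneg[OF that] by (intro mult_right_mono) (auto simp: D_def)
    then show ?thesis using C[OF that] by simp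
  qed
  then have "nrm X z / D \<le> nrm Z z" if "z \<in> vecs Z" for z
    using that D by (intro nrm_Z_greatest) (auto simp: divide_le_eq mult.commute)
  then show thesis using that[of D] D by (simp add: divide_le_eq mult.commute)
qed

lemma nrm_Z_nonneg: "z \<in> vecs Z \<Longrightarrow> 0 \<le> nrm Z z"
  by (rule nrm_Z_greatest) (auto simp: W.nrm_nonneg)

lemma nrm_Z_eq_0: assumes "z \<in> vecs Z" shows "nrm Z z = 0 \<longleftrightarrow> z = 0"
proof
  obtain C where C: "0 \<le> C" "\<And>z. z \<in> vecs Z \<Longrightarrow> nrm X z \<le> C * nrm Z z" using inclusion_bounded by blast
  have z: "z \<in> vecs X" using assms T_vecs by auto
  show "z = 0" if "nrm Z z = 0" using C(2)[OF assms] that X.nrm_nonneg[OF z] X.nrm_eq_0_iff[OF z] by simp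
  have "nrm Z 0 \<le> 0" using nrm_Z_le[OF W.vecs_0] by (simp add: T_0 W.nrm_0)
  moreover assume "z = 0"
  ultimately show "nrm Z z = 0" using nrm_Z_nonneg[OF assms] by simp
qed

lemma nrm_Z_scale_le: assumes "z \<in> vecs Z" shows "nrm Z (scl X c z) \<le> norm c * nrm Z z"
proof (cases "c = 0")
  case True
  have "z \<in> vecs X" using assms T_vecs by auto
  then show ?thesis using True nrm_Z_eq_0[of 0] X.subspace_0[OF Z_subspace] by simp
next
  case False
  have "nrm Z (scl X c z) / norm c \<le> nrm Z z"
  proof (rule nrm_Z_greatest[OF assms])
    fix w assume w: "w \<in> vecs W" "T w = z"
    have "nrm Z (scl X c z) \<le> nrm W (scl W c w)"
      using nrm_Z_le[OF W.vecs_scale[OF w(1)]] T_scale[OF w(1)] w(2) by simp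
    then show "nrm Z (scl X c z) / norm c \<le> nrm W w"
      using False W.nrm_scale[OF w(1)] by (simp add: divide_le_eq mult.commute)
  qed
  then show ?thesis using False by (simp add: divide_le_eq mult.commute)
qed

lemma nrm_Z_scale: assumes "z \<in> vecs Z" shows "nrm Z (scl X c z) = norm c * nrm Z z"
proof (cases "c = 0")
  case False
  have "nrm Z z \<le> norm (inverse c) * nrm Z (scl X c z)"
    using nrm_Z_scale_le[of "scl X c z" "inverse c"] X.subspace_scale[OF Z_subspace] assms False by simp
  then show ?thesis using nrm_Z_scale_le[OF assms, of c] False by (simp add: norm_divide norm_inverse field_simps)
next
  case True
  then show ?thesis using nrm_Z_eq_0[of 0] X.subspace_0[OF Z_subspace] by simp
qed

lemma nrm_Z_triangle:
  assumes z: "z \<in> vecs Z" and z': "z' \<in> vecs Z"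
  shows "nrm Z (z + z') \<le> nrm Z z + nrm Z z'"
proof -
  have "nrm Z (z + z') - nrm W w \<le> nrm Z z'" if w: "w \<in> vecs W" "T w = z" for w
  proof (rule nrm_Z_greatest[OF z'])
    fix w' assume w': "w' \<in> vecs W" "T w' = z'"
    have "nrm Z (z + z') \<le> nrm W (w + w')"
      using nrm_Z_le[OF W.vecs_add[OF w(1) w'(1)]] T_add[OF w(1) w'(1)] w(2) w'(2) by simp
    then show "nrm Z (z + z') - nrm W w \<le> nrm W w'" using W.nrm_triangle[OF w(1) w'(1)] by simp
  qed
  then have "nrm Z (z + z') - nrm Z z' \<le> nrm Z z"
    by (intro nrm_Z_greatest[OF z]) (simp add: diff_le_eq add.commute)
  then show ?thesis by simp
qed

text \<open>
  As for every quotient of a Banach space: a rapidly convergent subsequence of a Cauchy sequence has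
  increments that lift to an absolutely convergent series in \<open>W\<close>.
\<close>

lemma banach_range_space: "banach_space Z"
proof -
  have complete: "\<exists>z\<in>vecs Z. (\<lambda>n. nrm Z (f n - z)) \<longlonglongrightarrow> 0"
    if fZ: "range f \<subseteq> vecs Z" and cauchy: "\<forall>e>0. \<exists>M. \<forall>m\<ge>M. \<forall>n\<ge>M. nrm Z (f m - f n) < e"
    for f :: "nat \<Rightarrow> 'a"
  proof -
    have f: "f n \<in> T ` vecs W" for n using fZ by auto
    have fd: "f m - f n \<in> vecs Z" for m n using X.subspace_diff[OF Z_subspace f f] by simp
    have "\<forall>k. \<exists>M. \<forall>m\<ge>M. \<forall>n\<ge>M. nrm Z (f m - f n) < (1/2)^k" using cauchy by simp
    then obtain M where M: "\<And>k m n. m \<ge> M k \<Longrightarrow> n \<ge> M k \<Longrightarrow> nrm Z (f m - f n) < (1/2)^k"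
      by metis
    define \<phi> where "\<phi> = rec_nat (M 0) (\<lambda>k m. max m (M (Suc k)))"
    have \<phi>: "M k \<le> \<phi> k" "\<phi> k \<le> \<phi> (Suc k)" for k by (cases k; simp add: \<phi>_def)+
    have "\<exists>w. w \<in> vecs W \<and> T w = f (\<phi> (Suc k)) - f (\<phi> k) \<and> nrm W w < (1/2)^k" for k
      using lift[OF fd M[of k "\<phi> (Suc k)" "\<phi> k"]] \<phi>(1)[of k] \<phi>(2)[of k] by (metis order_trans)
    then obtain w where w: "\<And>k. w k \<in> vecs W" "\<And>k. T (w k) = f (\<phi> (Suc k)) - f (\<phi> k)"
      "\<And>k. nrm W (w k) < (1/2)^k" by metis
    have "summable (\<lambda>k. nrm W (w k))"
      by (rule summable_comparison_test'[of "\<lambda>k. (1/2)^k" 0])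
        (use w(1,3) W.nrm_nonneg in \<open>auto simp: less_imp_le summable_geometric\<close>)
    then obtain v where v: "v \<in> vecs W" "(\<lambda>n. nrm W ((\<Sum>k<n. w k) - v)) \<longlonglongrightarrow> 0"
      using W.series_converges[of w] w(1) by blast
    obtain u where u: "u \<in> vecs W" "T u = f (\<phi> 0)" using f[of "\<phi> 0"] by (metis imageE)
    define z where "z = T (u + v)"
    have z: "z \<in> T ` vecs W" unfolding z_def using W.vecs_add[OF u(1) v(1)] by simp
    have fz: "f n - z \<in> vecs Z" for n using X.subspace_diff[OF Z_subspace f z] by simp
    have sum_w: "(\<Sum>k<n. w k) \<in> vecs W" for n by (rule W.vecs_sum) (rule w)
    have "f (\<phi> n) - z = T ((\<Sum>k<n. w k) - v)" for n
    proof -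
      have "T (\<Sum>k<n. w k) = f (\<phi> n) - f (\<phi> 0)"
        using T_sum[of "{..<n}" w] w(1,2) sum_lessThan_telescope[of "\<lambda>k. f (\<phi> k)" n] by simp
      then show ?thesis
        using T_diff[OF sum_w v(1), of n] T_add[OF u(1) v(1)] u(2) by (simp add: z_def)
    qed
    then have sub: "nrm Z (f (\<phi> n) - z) \<le> nrm W ((\<Sum>k<n. w k) - v)" for n
      using nrm_Z_le[OF W.vecs_diff[OF sum_w v(1)]] by simp
    have "(\<lambda>n. nrm Z (f n - z)) \<longlonglongrightarrow> 0"
    proof (rule LIMSEQ_I)
      fix e :: real assume e: "0 < e"
      obtain n0 where n0: "\<And>n. n \<ge> n0 \<Longrightarrow> norm (nrm W ((\<Sum>k<n. w k) - v) - 0) < e / 2"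
        using LIMSEQ_D[OF v(2), of "e/2"] e by auto
      obtain K where K: "(1/2)^K < e / 2" using real_arch_pow_inv[of "e/2" "1/2"] e by auto
      define n where "n = max n0 K"
      have "(1/2::real)^n \<le> (1/2)^K" by (rule power_decreasing) (auto simp: n_def)
      moreover have "nrm W ((\<Sum>k<n. w k) - v) < e / 2" using n0[of n] by (simp add: n_def)
      moreover have "nrm Z (f m - z) \<le> nrm Z (f m - f (\<phi> n)) + nrm Z (f (\<phi> n) - z)" for m
        using nrm_Z_triangle[OF fd fz, of m "\<phi> n" "\<phi> n"] by simp
      ultimately have "nrm Z (f m - z) < e" if "M n \<le> m" for m
        using M[OF that \<phi>(1)] K sub[of n] by (smt (verit) field_sum_of_halves)
      then show "\<exists>no. \<forall>n\<ge>no. norm (nrm Z (f n - z) - 0) < e"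
        using nrm_Z_nonneg[OF fz] by auto
    qed
    then show ?thesis using z by auto
  qed
  show ?thesis unfolding banach_space_def
  proof (intro conjI ballI allI impI)
    show "vector_space (scl Z)" using X.vector_space_axioms by simp
    show "module.subspace (scl Z) (vecs Z)" using Z_subspace by simp
    show "nrm Z (scl Z c z) = norm c * nrm Z z" if "z \<in> vecs Z" for c z
      using nrm_Z_scale[OF that] by simp
    show "0 \<le> nrm Z z" if "z \<in> vecs Z" for z using that by (rule nrm_Z_nonneg)
    show "nrm Z z = 0 \<longleftrightarrow> z = 0" if "z \<in> vecs Z" for z using that by (rule nrm_Z_eq_0)
    show "nrm Z (z + z') \<le> nrm Z z + nrm Z z'" if "z \<in> vecs Z" "z' \<in> vecs Z" for z z'
      using that by (rule nrm_Z_triangle)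
    show "\<exists>z\<in>vecs Z. (\<lambda>n. nrm Z (f n - z)) \<longlonglongrightarrow> 0"
      if "range f \<subseteq> vecs Z \<and> (\<forall>e>0. \<exists>M. \<forall>m\<ge>M. \<forall>n\<ge>M. nrm Z (f m - f n) < e)"
      for f :: "nat \<Rightarrow> 'a"
      using that by (intro complete) auto
  qed
qed

end

section \<open>The Banach spaces of summable sequences\<close>

lemma sum_fun_apply: "(\<Sum>k\<in>I. f k) i = (\<Sum>k\<in>I. f k i)"
  by (induction I rule: infinite_finite_induct) auto

lemma ell_simps [simp]:
  "scl (ell q) = (\<lambda>c x n. c * x n)"
  "x \<in> vecs (ell q) \<longleftrightarrow> summable (\<lambda>n. norm (x n) powr q)"
  by (simp_all add: ell_def)

lemma nrm_ell: "nrm (ell q) x = (\<Sum>n. norm (x n) powr q) powr (1 / q)"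
  by (simp add: ell_def)

lemma nrm_ell_nonneg: "0 \<le> nrm (ell q) x"
  by (simp add: nrm_ell)

lemma nrm_ell_powr:
  assumes "0 < q" "x \<in> vecs (ell q)"
  shows "nrm (ell q) x powr q = (\<Sum>n. norm (x n) powr q)"
  using assms by (simp add: nrm_ell powr_powr suminf_nonneg)

text \<open>
  Membership and norm bounds in \<open>\<ell>\<^sup>q\<close> are read off from the finite partial sums, which are the quantities
  that survive coordinatewise limits.
\<close>

lemma nrm_ell_le:
  assumes "0 < q" "0 \<le> M" "\<And>n. (\<Sum>i<n. norm (x i) powr q) \<le> M powr q"
  shows "x \<in> vecs (ell q)" "nrm (ell q) x \<le> M"
proof -
  show x: "x \<in> vecs (ell q)"
    using summableI_nonneg_bounded[of "\<lambda>i. norm (x i) powr q" "M powr q"] assms(3) by simp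
  have "(\<Sum>n. norm (x n) powr q) \<le> M powr q"
    using x assms(3) by (intro suminf_le_const) auto
  then have "(\<Sum>n. norm (x n) powr q) powr (1 / q) \<le> (M powr q) powr (1 / q)"
    using assms(1) x by (intro powr_mono2) (auto intro: suminf_nonneg)
  then show "nrm (ell q) x \<le> M" using assms(1,2) by (simp add: nrm_ell powr_powr)
qed

lemma sum_le_nrm_ell:
  assumes "0 < q" "x \<in> vecs (ell q)" "finite I"
  shows "(\<Sum>i\<in>I. norm (x i) powr q) \<le> nrm (ell q) x powr q"
  unfolding nrm_ell_powr[OF assms(1,2)] using assms by (intro sum_le_suminf) auto

lemma norm_le_nrm_ell:
  assumes "0 < q" "x \<in> vecs (ell q)"
  shows "norm (x i) \<le> nrm (ell q) x"
proof (rule ccontr)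
  assume "\<not> ?thesis"
  then have "nrm (ell q) x powr q < norm (x i) powr q"
    using assms(1) by (intro powr_less_mono2) (auto simp: nrm_ell_nonneg)
  then show False using sum_le_nrm_ell[OF assms, of "{i}"] by simp
qed

lemma powr_convex_combination:
  fixes u v t q :: real
  assumes q: "1 \<le> q" and t: "0 \<le> t" "t \<le> 1" and uv: "0 \<le> u" "0 \<le> v"
  shows "((1 - t) * u + t * v) powr q \<le> (1 - t) * u powr q + t * v powr q"
proof -
  have scaled: "(c * w) powr q \<le> c * w powr q" if "0 \<le> c" "c \<le> 1" "0 \<le> w" for c w :: real
  proof -
    have "c powr q \<le> c"
    proof (cases "c = 0")
      case False
      then show ?thesis using powr_mono'[of 1 q c] that q by simp
    qed simp
    then show ?thesis using that by (simp add: powr_mult mult_right_mono)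
  qed
  consider "u = 0" | "v = 0" | "0 < u" "0 < v" using uv by linarith
  then show ?thesis
  proof cases
    case 3
    then show ?thesis
      using convex_onD[OF powr_convex[OF q], of t u v] t by simp
  qed (use scaled[of t v] scaled[of "1 - t" u] t uv in auto)
qed

text \<open>
  Minkowski's inequality: by convexity of \<open>u \<mapsto> u\<^sup>q\<close> the unit ball is convex, and a homogeneous
  functional with a convex unit ball is subadditive.
\<close>

lemma ell_add:
  fixes x y :: "nat \<Rightarrow> 'k::real_normed_field"
  assumes q: "1 \<le> q" and x: "x \<in> vecs (ell q)" and y: "y \<in> vecs (ell q)"
  shows "x + y \<in> vecs (ell q)" "nrm (ell q) (x + y) \<le> nrm (ell q) x + nrm (ell q) y"
proof -
  have main: "x + y \<in> vecs (ell q) \<and> nrm (ell q) (x + y) \<le> a + b"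
    if a: "nrm (ell q) x \<le> a" "0 < a" and b: "nrm (ell q) y \<le> b" "0 < b" for a b
  proof -
    define t where "t = b / (a + b)"
    have t: "0 \<le> t" "t \<le> 1" and t': "1 - t = a / (a + b)" using a b by (auto simp: t_def field_simps)
    have pt: "(norm (x i + y i) / (a + b)) powr q
        \<le> (1 - t) * (norm (x i) / a) powr q + t * (norm (y i) / b) powr q" for i
    proof -
      have "norm (x i + y i) / (a + b) \<le> (1 - t) * (norm (x i) / a) + t * (norm (y i) / b)"
      proof -
        have "(1 - t) * (norm (x i) / a) = norm (x i) / (a + b)" "t * (norm (y i) / b) = norm (y i) / (a + b)"
          unfolding t' unfolding t_def using a b by simp_all
        then show ?thesis using norm_triangle_ineq[of "x i" "y i"] a b
          by (simp add: divide_right_mono flip: add_divide_distrib)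
      qed
      then have "(norm (x i + y i) / (a + b)) powr q
          \<le> ((1 - t) * (norm (x i) / a) + t * (norm (y i) / b)) powr q"
        using q a b by (intro powr_mono2) auto
      also have "\<dots> \<le> (1 - t) * (norm (x i) / a) powr q + t * (norm (y i) / b) powr q"
        using a b by (intro powr_convex_combination q t) auto
      finally show ?thesis .
    qed
    have part: "(\<Sum>i<n. (norm (w i) / c) powr q) \<le> 1"
      if "w \<in> vecs (ell q)" "nrm (ell q) w \<le> c" "0 < c" for w :: "nat \<Rightarrow> 'k" and c n
    proof -
      have "(\<Sum>i<n. norm (w i) powr q) \<le> nrm (ell q) w powr q"
        using sum_le_nrm_ell[of q w "{..<n}"] q that by simp
      also have "\<dots> \<le> c powr q" using that q by (intro powr_mono2) (auto simp: nrm_ell_nonneg)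
      finally show ?thesis using that by (simp add: powr_divide flip: sum_divide_distrib)
    qed
    have "(\<Sum>i<n. norm ((x + y) i) powr q) \<le> (a + b) powr q" for n
    proof -
      have "(\<Sum>i<n. norm ((x + y) i) powr q) / (a + b) powr q = (\<Sum>i<n. (norm (x i + y i) / (a + b)) powr q)"
        using a b by (simp add: powr_divide sum_divide_distrib)
      also have "\<dots> \<le> (\<Sum>i<n. (1 - t) * (norm (x i) / a) powr q + t * (norm (y i) / b) powr q)"
        by (rule sum_mono) (rule pt)
      also have "\<dots> = (1 - t) * (\<Sum>i<n. (norm (x i) / a) powr q) + t * (\<Sum>i<n. (norm (y i) / b) powr q)"
        by (simp add: sum.distrib sum_distrib_left)
      also have "\<dots> \<le> (1 - t) * 1 + t * 1"
        using t part[OF x a] part[OF y b] by (intro add_mono mult_left_mono) auto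
      finally show ?thesis using a b by (simp add: divide_le_eq)
    qed
    then show ?thesis using nrm_ell_le[of q "a + b" "x + y"] q a b by auto
  qed
  show "x + y \<in> vecs (ell q)"
    using main[of "nrm (ell q) x + 1" "nrm (ell q) y + 1"] nrm_ell_nonneg[of q x] nrm_ell_nonneg[of q y] by simp
  show "nrm (ell q) (x + y) \<le> nrm (ell q) x + nrm (ell q) y"
  proof (rule field_le_epsilon)
    fix e :: real assume "0 < e"
    then show "nrm (ell q) (x + y) \<le> nrm (ell q) x + nrm (ell q) y + e"
      using main[of "nrm (ell q) x + e / 2" "nrm (ell q) y + e / 2"]
        nrm_ell_nonneg[of q x] nrm_ell_nonneg[of q y] by (simp add: add_nonneg_pos)
  qed
qed

lemma ell_scale:
  fixes x :: "nat \<Rightarrow> 'k::real_normed_field"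
  assumes "0 < q" "x \<in> vecs (ell q)"
  shows "(\<lambda>n. c * x n) \<in> vecs (ell q)" "nrm (ell q) (\<lambda>n. c * x n) = norm c * nrm (ell q) x"
proof -
  show "(\<lambda>n. c * x n) \<in> vecs (ell q)" using assms by (simp add: norm_mult powr_mult summable_mult)
  have "(\<Sum>n. norm (c * x n) powr q) = norm c powr q * (\<Sum>n. norm (x n) powr q)"
    using assms by (simp add: norm_mult powr_mult suminf_mult)
  then show "nrm (ell q) (\<lambda>n. c * x n) = norm c * nrm (ell q) x"
    using assms by (simp add: nrm_ell powr_mult powr_powr suminf_nonneg)
qed

lemma vector_space_ell: "vector_space (scl (ell q))"
  by unfold_locales (simp_all add: fun_eq_iff distrib_left distrib_right mult.assoc)

text \<open>
  The limit of a Cauchy sequence is found coordinatewise, and finite partial sums carry the Cauchy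
  estimate over to it.
\<close>

lemma banach_ell:
  assumes q: "1 \<le> q"
  shows "banach_space (ell q :: ('k::{real_normed_field,banach}, nat \<Rightarrow> 'k) nspace)"
proof -
  let ?E = "ell q :: ('k, nat \<Rightarrow> 'k) nspace"
  interpret vector_space "scl ?E" by (rule vector_space_ell)
  have q0: "0 < q" using q by simp
  have zero: "(0 :: nat \<Rightarrow> 'k) \<in> vecs ?E" using q0 by simp
  have sub: "subspace (vecs ?E)"
    using zero ell_add(1)[OF q] ell_scale(1)[OF q0] by (intro subspaceI) auto
  have diff: "x - y \<in> vecs ?E" if "x \<in> vecs ?E" "y \<in> vecs ?E" for x y
    using subspace_diff[OF sub that] .
  have complete: "\<exists>x\<in>vecs ?E. (\<lambda>n. nrm ?E (f n - x)) \<longlonglongrightarrow> 0"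
    if f: "range f \<subseteq> vecs ?E" and c: "\<forall>e>0. \<exists>M. \<forall>m\<ge>M. \<forall>n\<ge>M. nrm ?E (f m - f n) < e"
    for f :: "nat \<Rightarrow> nat \<Rightarrow> 'k"
  proof -
    have fE: "f n \<in> vecs ?E" for n using f by blast
    have "Cauchy (\<lambda>n. f n i)" for i
    proof (rule CauchyI)
      fix e :: real assume "0 < e"
      then obtain M where M: "\<And>m n. M \<le> m \<Longrightarrow> M \<le> n \<Longrightarrow> nrm ?E (f m - f n) < e" using c by blast
      have "norm (f m i - f n i) < e" if "M \<le> m" "M \<le> n" for m n
        using norm_le_nrm_ell[OF q0 diff[OF fE fE], of m n i] M[OF that] by simp
      then show "\<exists>M. \<forall>m\<ge>M. \<forall>n\<ge>M. norm (f m i - f n i) < e" by blast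
    qed
    then obtain x where x: "\<And>i. (\<lambda>n. f n i) \<longlonglongrightarrow> x i"
      unfolding Cauchy_convergent_iff convergent_def by metis
    have close: "f m - x \<in> vecs ?E \<and> nrm ?E (f m - x) \<le> e"
      if e: "0 < e" and M: "\<And>m n. M \<le> m \<Longrightarrow> M \<le> n \<Longrightarrow> nrm ?E (f m - f n) < e" and m: "M \<le> m" for e M m
    proof -
      have "(\<Sum>i<N. norm ((f m - x) i) powr q) \<le> e powr q" for N
      proof (rule LIMSEQ_le_const2)
        show "(\<lambda>n. \<Sum>i<N. norm (f m i - f n i) powr q) \<longlonglongrightarrow> (\<Sum>i<N. norm ((f m - x) i) powr q)"
          using q0 by (auto intro!: tendsto_intros x)
        have "(\<Sum>i<N. norm (f m i - f n i) powr q) \<le> e powr q" if "M \<le> n" for n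
        proof -
          have "(\<Sum>i<N. norm ((f m - f n) i) powr q) \<le> nrm ?E (f m - f n) powr q"
            by (rule sum_le_nrm_ell[OF q0 diff[OF fE fE]]) simp
          also have "\<dots> \<le> e powr q"
            using M[OF m that] q0 by (intro powr_mono2) (auto simp: nrm_ell_nonneg)
          finally show ?thesis by simp
        qed
        then show "\<exists>N'. \<forall>n\<ge>N'. (\<Sum>i<N. norm (f m i - f n i) powr q) \<le> e powr q" by blast
      qed
      then show ?thesis using nrm_ell_le[OF q0, of e "f m - x"] e by auto
    qed
    obtain M where "\<And>m n. M \<le> m \<Longrightarrow> M \<le> n \<Longrightarrow> nrm ?E (f m - f n) < 1" using c zero_less_one by blast
    then have "f M - x \<in> vecs ?E" using close[of 1 M M] by auto
    from diff[OF fE[of M] this] have x_vecs: "x \<in> vecs ?E" by (simp only: diff_diff_eq2 add_diff_cancel_left')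
    have "(\<lambda>n. nrm ?E (f n - x)) \<longlonglongrightarrow> 0"
    proof (rule LIMSEQ_I)
      fix e :: real assume e: "0 < e"
      then obtain M where M: "\<And>m n. M \<le> m \<Longrightarrow> M \<le> n \<Longrightarrow> nrm ?E (f m - f n) < e / 2"
        using c[rule_format, of "e / 2"] by auto
      have "norm (nrm ?E (f n - x) - 0) < e" if "M \<le> n" for n
        using close[of "e/2" M n, OF _ M that] e nrm_ell_nonneg[of q "f n - x"] by simp
      then show "\<exists>M. \<forall>n\<ge>M. norm (nrm ?E (f n - x) - 0) < e" by blast
    qed
    then show ?thesis using x_vecs by blast
  qed
  show ?thesis unfolding banach_space_def
  proof (intro conjI ballI allI impI)
    show "nrm ?E x = 0 \<longleftrightarrow> x = 0" if x: "x \<in> vecs ?E" for x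
    proof
      assume "nrm ?E x = 0"
      then show "x = 0" using norm_le_nrm_ell[OF q0 x] by (auto simp: fun_eq_iff)
    qed (use q0 in \<open>simp add: nrm_ell\<close>)
    show "nrm ?E (scl ?E c x) = norm c * nrm ?E x" if "x \<in> vecs ?E" for c x
      using ell_scale(2)[OF q0 that] by simp
    show "\<exists>x\<in>vecs ?E. (\<lambda>n. nrm ?E (f n - x)) \<longlonglongrightarrow> 0"
      if "range f \<subseteq> vecs ?E \<and> (\<forall>e>0. \<exists>M. \<forall>m\<ge>M. \<forall>n\<ge>M. nrm ?E (f m - f n) < e)"
      for f :: "nat \<Rightarrow> nat \<Rightarrow> 'k"
      using that by (intro complete) auto
    show "vector_space (scl ?E)" by (rule vector_space_axioms)
    show "subspace (vecs ?E)" by (rule sub)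
    show "0 \<le> nrm ?E x" for x by (rule nrm_ell_nonneg)
    show "nrm ?E (x + y) \<le> nrm ?E x + nrm ?E y" if "x \<in> vecs ?E" "y \<in> vecs ?E" for x y
      using that by (rule ell_add(2)[OF q])
  qed
qed

section \<open>Auxiliary tools for the trace functional\<close>

lemma powr_Young:
  fixes a b r :: real
  assumes "1 < r" "0 \<le> a" "0 \<le> b"
  shows "a * b \<le> a powr (r / (r - 1)) + b powr r"
proof (cases "b \<le> a powr (1 / (r - 1))")
  case True
  have "a * b \<le> a * a powr (1 / (r - 1))" using True assms by (intro mult_left_mono) auto
  also have "\<dots> = a powr (r / (r - 1))"
  proof (cases "a = 0")
    case False
    have "r / (r - 1) = 1 + 1 / (r - 1)" using assms by (simp add: field_simps)
    then show ?thesis using False assms by (simp add: powr_add)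
  qed simp
  finally show ?thesis by (simp add: add_increasing2)
next
  case False
  then have b: "0 < b" using assms(3) powr_ge_zero[of a "1 / (r - 1)"] by linarith
  have "(a powr (1 / (r - 1))) powr (r - 1) \<le> b powr (r - 1)"
    using False assms by (intro powr_mono2) auto
  then have "a \<le> b powr (r - 1)" using assms by (simp add: powr_powr)
  then have "a * b \<le> b powr (r - 1) * b" using assms by (intro mult_right_mono) auto
  also have "\<dots> = b powr r" using b powr_add[of b "r - 1" 1] by simp
  finally show ?thesis by (simp add: add_increasing)
qed

text \<open>
  A strongly \<open>r\<close>-summable sequence \<open>y\<close> defines the operator \<open>l \<mapsto> \<Sum> l\<^sub>k y\<^sub>k\<close> on \<open>\<ell>\<^bsup>r'\<^esup>\<close>. Its range with the quotient norm
  is the canonical domain of an \<open>r\<close>-compact inclusion: its open unit ball lies in \<open>r-co{y\<^sub>k}\<close>.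
\<close>

locale synthesis = Banach X
  for X :: "('k::{real_normed_field,banach}, 'a::ab_group_add) nspace" +
  fixes r :: real and y :: "nat \<Rightarrow> 'a"
  assumes r: "1 < r" and y: "y \<in> strongly_summable r X"
begin

definition "r' = r / (r - 1)"

abbreviation "L \<equiv> (ell r' :: ('k, nat \<Rightarrow> 'k) nspace)"

definition T :: "(nat \<Rightarrow> 'k) \<Rightarrow> 'a" where
  "T l = (SOME x. x \<in> vecs X \<and> (\<lambda>n. nrm X ((\<Sum>k<n. scl X (l k) (y k)) - x)) \<longlonglongrightarrow> 0)"

lemma r': "1 \<le> r'" and r'_pos: "0 < r'"
  using r by (simp_all add: r'_def)

lemma y_vecs: "y k \<in> vecs X"
  using y by (auto simp: strongly_summable_def)

lemma y_summable: "summable (\<lambda>k. nrm X (y k) powr r)"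
  using y by (auto simp: strongly_summable_def)

lemma partial_vecs: "(\<Sum>k<n. scl X (l k) (y k)) \<in> vecs X"
  by (intro vecs_sum vecs_scale y_vecs)

lemma nrm_term_le: "nrm X (scl X (l k) (y k)) \<le> norm (l k) powr r' + nrm X (y k) powr r"
  using powr_Young[OF r, of "norm (l k)" "nrm X (y k)"]
  by (simp add: nrm_scale[OF y_vecs] nrm_nonneg[OF y_vecs] r'_def)

lemma T_spec:
  assumes "l \<in> vecs L"
  shows "T l \<in> vecs X" "(\<lambda>n. nrm X ((\<Sum>k<n. scl X (l k) (y k)) - T l)) \<longlonglongrightarrow> 0"
proof -
  have "summable (\<lambda>k. norm (l k) powr r' + nrm X (y k) powr r)"
    using assms y_summable by (intro summable_add) auto
  then have "summable (\<lambda>k. nrm X (scl X (l k) (y k)))"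
    by (rule summable_comparison_test'[where N = 0])
      (use nrm_term_le nrm_nonneg[OF vecs_scale[OF y_vecs]] in auto)
  then have "\<exists>x. x \<in> vecs X \<and> (\<lambda>n. nrm X ((\<Sum>k<n. scl X (l k) (y k)) - x)) \<longlonglongrightarrow> 0"
    using series_converges[of "\<lambda>k. scl X (l k) (y k)"] vecs_scale[OF y_vecs] by blast
  from someI_ex[OF this]
  show "T l \<in> vecs X" "(\<lambda>n. nrm X ((\<Sum>k<n. scl X (l k) (y k)) - T l)) \<longlonglongrightarrow> 0"
    unfolding T_def by blast+
qed

lemma T_eqI:
  assumes "l \<in> vecs L" "x \<in> vecs X" "(\<lambda>n. nrm X ((\<Sum>k<n. scl X (l k) (y k)) - x)) \<longlonglongrightarrow> 0"
  shows "T l = x"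
  using nrm_limit_unique[OF _ T_spec(1)[OF assms(1)] assms(2) T_spec(2)[OF assms(1)] assms(3)] partial_vecs
  by auto

lemma T_bounded: "T \<in> bounded_op L X"
proof -
  interpret L: Banach L using banach_ell[OF r'] by (simp add: Banach_iff)
  have add: "T (l + m) = T l + T m" if l: "l \<in> vecs L" and m: "m \<in> vecs L" for l m
  proof (rule T_eqI)
    show "l + m \<in> vecs L" by (rule L.vecs_add[OF l m])
    show "T l + T m \<in> vecs X" using T_spec(1) l m by (intro vecs_add)
    define u where "u n = (\<Sum>k<n. scl X (l k) (y k)) - T l" for n
    define v where "v n = (\<Sum>k<n. scl X (m k) (y k)) - T m" for n
    have uv: "u n \<in> vecs X" "v n \<in> vecs X" for n
      unfolding u_def v_def using T_spec(1) l m by (auto intro!: vecs_diff partial_vecs)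
    have eq: "(\<Sum>k<n. scl X ((l + m) k) (y k)) - (T l + T m) = u n + v n" for n
      by (simp add: u_def v_def scale_left_distrib sum.distrib)
    have "(\<lambda>n. nrm X (u n) + nrm X (v n)) \<longlonglongrightarrow> 0"
      using tendsto_add[OF T_spec(2)[OF l] T_spec(2)[OF m]] by (simp add: u_def v_def)
    then show "(\<lambda>n. nrm X ((\<Sum>k<n. scl X ((l + m) k) (y k)) - (T l + T m))) \<longlonglongrightarrow> 0"
      unfolding eq
      by (rule tendsto_sandwich[OF _ _ tendsto_const, rotated 2])
        (auto intro!: always_eventually nrm_nonneg nrm_triangle vecs_add uv)
  qed
  have scale: "T (scl L c l) = scl X c (T l)" if l: "l \<in> vecs L" for l c
  proof (rule T_eqI)
    show "scl L c l \<in> vecs L" by (rule L.vecs_scale[OF l])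
    show "scl X c (T l) \<in> vecs X" using T_spec(1)[OF l] by (rule vecs_scale)
    have "(\<Sum>k<n. scl X (scl L c l k) (y k)) - scl X c (T l) = scl X c ((\<Sum>k<n. scl X (l k) (y k)) - T l)" for n
      by (simp add: scale_right_diff_distrib scale_sum_right)
    then have eq: "nrm X ((\<Sum>k<n. scl X (scl L c l k) (y k)) - scl X c (T l))
        = norm c * nrm X ((\<Sum>k<n. scl X (l k) (y k)) - T l)" for n
      using nrm_scale[OF vecs_diff[OF partial_vecs T_spec(1)[OF l]]] by metis
    show "(\<lambda>n. nrm X ((\<Sum>k<n. scl X (scl L c l k) (y k)) - scl X c (T l))) \<longlonglongrightarrow> 0"
      unfolding eq using tendsto_mult_left[OF T_spec(2)[OF l], of "norm c"] by simp
  qed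
  define C where "C = 1 + (\<Sum>k. nrm X (y k) powr r)"
  have ball: "nrm X (T l) \<le> C" if l: "l \<in> vecs L" "nrm L l \<le> 1" for l
  proof -
    have part: "nrm X (\<Sum>k<n. scl X (l k) (y k)) \<le> C" for n
    proof -
      have "nrm X (\<Sum>k<n. scl X (l k) (y k)) \<le> (\<Sum>k<n. norm (l k) powr r' + nrm X (y k) powr r)"
        by (rule order_trans[OF nrm_sum_le sum_mono[OF nrm_term_le]]) (rule vecs_scale[OF y_vecs])
      also have "\<dots> = (\<Sum>k<n. norm (l k) powr r') + (\<Sum>k<n. nrm X (y k) powr r)"
        by (rule sum.distrib)
      also have "\<dots> \<le> 1 + (\<Sum>k. nrm X (y k) powr r)"
      proof (rule add_mono)
        have "(\<Sum>k<n. norm (l k) powr r') \<le> nrm L l powr r'"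
          by (rule sum_le_nrm_ell[OF r'_pos l(1)]) simp
        also have "\<dots> \<le> 1 powr r'" using l(2) r'_pos by (intro powr_mono2) (auto simp: nrm_ell_nonneg)
        finally show "(\<Sum>k<n. norm (l k) powr r') \<le> 1" by simp
        show "(\<Sum>k<n. nrm X (y k) powr r) \<le> (\<Sum>k. nrm X (y k) powr r)"
          by (rule sum_le_suminf[OF y_summable]) auto
      qed
      finally show ?thesis by (simp add: C_def)
    qed
    have "nrm X (T l) \<le> nrm X ((\<Sum>k<n. scl X (l k) (y k)) - T l) + C" for n
    proof -
      have "nrm X (T l - 0) \<le> nrm X (T l - (\<Sum>k<n. scl X (l k) (y k))) + nrm X ((\<Sum>k<n. scl X (l k) (y k)) - 0)"
        by (intro nrm_triangle_diff partial_vecs vecs_0 T_spec(1) l)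
      then show ?thesis
        using part[of n] nrm_minus_commute[OF T_spec(1)[OF l(1)] partial_vecs[of l n]] by simp
    qed
    moreover have "(\<lambda>n. nrm X ((\<Sum>k<n. scl X (l k) (y k)) - T l) + C) \<longlonglongrightarrow> 0 + C"
      by (intro tendsto_add T_spec(2) l tendsto_const)
    ultimately show ?thesis by (intro LIMSEQ_le_const[of _ C]) auto
  qed
  have "nrm X (T l) \<le> C * nrm L l" if l: "l \<in> vecs L" for l
  proof (cases "nrm L l = 0")
    case True
    then have "l = scl L 0 l" using L.nrm_eq_0_iff[OF l] by (simp add: fun_eq_iff)
    then have "T l = 0" using scale[OF l, of 0] by simp
    then show ?thesis using True nrm_0 by simp
  next
    case False
    then have pos: "0 < nrm L l" using nrm_ell_nonneg[of r' l] by simp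
    define c where "c = (of_real (1 / nrm L l) :: 'k)"
    have c: "norm c = 1 / nrm L l" using pos by (simp add: c_def norm_divide)
    have "nrm L (scl L c l) = 1" using L.nrm_scale[OF l, of c] c pos by simp
    then have "nrm X (T (scl L c l)) \<le> C" using L.vecs_scale[OF l] by (intro ball) auto
    then have "nrm X (T l) / nrm L l \<le> C"
      using scale[OF l] nrm_scale[OF T_spec(1)[OF l], of c] c by simp
    then show ?thesis using pos by (simp add: divide_le_eq)
  qed
  then show ?thesis unfolding bounded_op_def using T_spec(1) add scale by blast
qed

sublocale operator_range L X T
proof
  show "banach_space L" by (rule banach_ell[OF r'])
  show "T \<in> bounded_op L X" by (rule T_bounded)
qed (simp_all add: algebra_simps fun_eq_iff)

lemma T_unit: "T (\<lambda>i. if i = k then 1 else 0) = y k" (is "T ?d = _")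
  and unit_vecs: "(\<lambda>i. if i = k then 1 else 0) \<in> vecs L"
  and nrm_unit: "nrm L (\<lambda>i. if i = k then 1 else 0) = 1"
proof -
  have eq: "norm (?d i) powr r' = (if i = k then 1 else 0)" for i by simp
  have s: "(\<lambda>i. norm (?d i) powr r') sums 1" unfolding eq by (rule sums_single)
  then show d: "?d \<in> vecs L" by (simp only: ell_simps sums_summable)
  show "nrm L ?d = 1" unfolding nrm_ell using sums_unique[OF s] by simp
  show "T ?d = y k"
  proof (rule T_eqI[OF d y_vecs])
    have "nrm X ((\<Sum>i<n. scl X (?d i) (y i)) - y k) = 0" if "k < n" for n
    proof -
      have "(\<Sum>i<n. scl X (?d i) (y i)) = (\<Sum>i<n. if i = k then y i else 0)" by (intro sum.cong) auto
      also have "\<dots> = y k" using that by simp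
      finally show ?thesis using nrm_0 by simp
    qed
    then show "(\<lambda>n. nrm X ((\<Sum>i<n. scl X (?d i) (y i)) - y k)) \<longlonglongrightarrow> 0"
      by (intro tendsto_eventually eventually_sequentiallyI[of "Suc k"]) auto
  qed
qed

lemma y_Z: "y k \<in> vecs Z" and nrm_y_Z: "nrm Z (y k) \<le> 1"
  using nrm_Z_le[OF unit_vecs, of k] unit_vecs[of k] T_unit[of k] nrm_unit[of k] by (auto intro: rev_image_eqI)

text \<open>
  An element of the closed unit ball need not be the image of a vector of norm \<open>1\<close>, but it is the image
  of one of norm less than \<open>2\<close>; doubling the sequence \<open>y\<close> makes up for this.
\<close>

lemma inclusion_SK: "(\<lambda>z. z) \<in> SK r Z X"
proof -
  obtain C where "\<And>z. z \<in> vecs Z \<Longrightarrow> nrm X z \<le> C * nrm Z z" using inclusion_bounded by blast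
  then have bdd: "(\<lambda>z. z) \<in> bounded_op Z X"
    unfolding bounded_op_def using T_vecs by auto
  define y2 where "y2 k = scl X 2 (y k)" for k
  have "nrm X (y2 k) powr r = 2 powr r * nrm X (y k) powr r" for k
    using nrm_scale[OF y_vecs, of 2 k] nrm_nonneg[OF y_vecs, of k] by (simp add: y2_def powr_mult)
  then have y2: "y2 \<in> strongly_summable r X"
    using y_summable y_vecs vecs_scale by (auto simp: strongly_summable_def y2_def intro!: summable_mult)
  have "z \<in> r_co r X y2" if z: "z \<in> unit_ball Z" for z
  proof -
    have "z \<in> vecs Z" "nrm Z z < 2" using z by (auto simp: unit_ball_def)
    then obtain l where l: "l \<in> vecs L" "T l = z" "nrm L l < 2" using lift by blast
    define m where "m = scl L (1 / 2) l"
    have m: "m \<in> vecs L" "nrm L m \<le> 1"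
      using ell_scale[OF r'_pos l(1), of "1 / 2"] l(3) by (auto simp: m_def norm_divide)
    have "(\<Sum>k<n. scl X (m k) (y2 k)) = (\<Sum>k<n. scl X (l k) (y k))" for n
      by (intro sum.cong) (auto simp: m_def y2_def)
    then have "(\<lambda>n. nrm X ((\<Sum>k<n. scl X (m k) (y2 k)) - z)) \<longlonglongrightarrow> 0"
      using T_spec(2)[OF l(1)] l(2) by simp
    moreover have "m \<in> coeff_ball r" using m r by (simp add: coeff_ball_def unit_ball_def r'_def)
    moreover have "z \<in> vecs X" using T_spec(1)[OF l(1)] l(2) by simp
    ultimately show ?thesis by (auto simp: r_co_def)
  qed
  then show ?thesis using bdd y2 by (auto simp: SK_def)
qed

end

text \<open>
  A finite-dimensional space of sequences is determined by finitely many coordinates \<open>K\<close>: Gaussian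
  elimination yields a basis \<open>x k\<close> dual to the evaluations at \<open>k \<in> K\<close>. For an operator of finite rank this
  writes the coefficient functionals as evaluations, which are visibly continuous.
\<close>

lemma finite_span_coordinates:
  fixes B :: "(nat \<Rightarrow> 'k::field) set"
  assumes "finite B"
  defines "sc \<equiv> \<lambda>(c::'k) x n. c * x n"
  shows "\<exists>K x. finite K \<and> (\<forall>k\<in>K. x k \<in> module.span sc B) \<and>
     (\<forall>v\<in>module.span sc B. v = (\<Sum>k\<in>K. sc (v k) (x k)))"
proof -
  interpret vector_space sc
    unfolding sc_def by unfold_locales (simp_all add: fun_eq_iff distrib_left distrib_right mult.assoc)
  have ap: "sc c x n = c * x n" for c x n by (simp add: sc_def)
  have "\<exists>K x. finite K \<and> (\<forall>k\<in>K. x k \<in> span B) \<and> (\<forall>k\<in>K. \<forall>l\<in>K. x k l = (if k = l then 1 else 0)) \<and>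
     (\<forall>v\<in>span B. v = (\<Sum>k\<in>K. sc (v k) (x k)))"
    using assms(1)
  proof (induction B)
    case empty
    show ?case by (intro exI[of _ "{}"] exI[of _ "\<lambda>_. 0"]) simp
  next
    case (insert b B)
    from insert.IH obtain K x where *: "finite K \<and> (\<forall>k\<in>K. x k \<in> span B) \<and>
        (\<forall>k\<in>K. \<forall>l\<in>K. x k l = (if k = l then 1 else 0)) \<and> (\<forall>v\<in>span B. v = (\<Sum>k\<in>K. sc (v k) (x k)))"
      by (elim exE)
    then have K: "finite K" and x: "\<And>k. k \<in> K \<Longrightarrow> x k \<in> span B"
      and \<delta>: "\<And>k l. k \<in> K \<Longrightarrow> l \<in> K \<Longrightarrow> x k l = (if k = l then 1 else 0)"
      by simp_all
    have rep: "v = (\<Sum>k\<in>K. sc (v k) (x k))" if "v \<in> span B" for v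
      by (rule bspec[OF conjunct2[OF conjunct2[OF conjunct2[OF *]]] that])
    have mono: "span B \<subseteq> span (insert b B)" by (rule span_mono) auto
    define b' where "b' = b - (\<Sum>k\<in>K. sc (b k) (x k))"
    have sum_span: "(\<Sum>k\<in>K. sc (b k) (x k)) \<in> span B" by (intro span_sum span_scale x)
    have b'0: "b' l = 0" if "l \<in> K" for l
    proof -
      have "(\<Sum>k\<in>K. b k * x k l) = (\<Sum>k\<in>K. if k = l then b k else 0)" by (intro sum.cong) (auto simp: \<delta> that)
      then show ?thesis using that K by (simp add: b'_def sum_fun_apply ap)
    qed
    show ?case
    proof (cases "b' = 0")
      case True
      then have "b \<in> span B" using sum_span by (simp add: b'_def)
      then have "span (insert b B) = span B" by (rule span_redundant)
      then show ?thesis using insert.IH by simp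
    next
      case False
      then obtain p where p: "b' p \<noteq> 0" by (auto simp: fun_eq_iff)
      then have pK: "p \<notin> K" using b'0 by auto
      \<comment> \<open>The new vector is reduced modulo the old basis and normalised at a pivot \<open>p\<close>; then the pivot column
          of the old basis is cleared.\<close>
      define x' where "x' = sc (inverse (b' p)) b'"
      define u where "u k = (if k = p then x' else x k - sc (x k p) x')" for k
      have b'_span: "b' \<in> span (insert b B)"
        unfolding b'_def by (rule span_diff[OF span_base[OF insertI1] subsetD[OF mono sum_span]])
      have x'_span: "x' \<in> span (insert b B)" unfolding x'_def by (rule span_scale[OF b'_span])
      have u_span: "u k \<in> span (insert b B)" if "k \<in> insert p K" for k
        using that x mono x'_span by (auto simp: u_def intro!: span_diff span_scale)
      have x'l: "x' l = (if l = p then 1 else 0)" if "l \<in> insert p K" for l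
        using that p b'0 by (auto simp: x'_def ap)
      have \<delta>': "u k l = (if k = l then 1 else 0)" if "k \<in> insert p K" "l \<in> insert p K" for k l
        using that pK by (auto simp: u_def x'l ap \<delta>)
      define R where "R v = (\<Sum>k\<in>insert p K. sc (v k) (u k))" for v
      define Fix where "Fix = {v. v = R v}"
      have Fix_sub: "subspace Fix"
      proof (rule subspaceI)
        show "0 \<in> Fix" by (simp add: Fix_def R_def)
        have "R (v + w) = R v + R w" for v w by (simp add: R_def scale_left_distrib sum.distrib)
        then show "v + w \<in> Fix" if "v \<in> Fix" "w \<in> Fix" for v w using that by (simp add: Fix_def)
        have "R (sc c v) = sc c (R v)" for c v by (simp add: R_def scale_sum_right ap)
        then show "sc c v \<in> Fix" if "v \<in> Fix" for c v using that by (simp add: Fix_def)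
      qed
      have u_Fix: "u l \<in> Fix" if "l \<in> insert p K" for l
      proof -
        have "R (u l) = (\<Sum>k\<in>insert p K. if k = l then u k else 0)"
          unfolding R_def using that \<delta>' by (intro sum.cong) auto
        also have "\<dots> = u l" using that K by simp
        finally show ?thesis by (simp add: Fix_def)
      qed
      have x'_Fix: "x' \<in> Fix" using u_Fix[of p] by (simp add: u_def)
      have x_Fix: "x k \<in> Fix" if "k \<in> K" for k
      proof -
        have "x k = u k + sc (x k p) x'" using that pK by (auto simp: u_def)
        then show ?thesis
          using subspace_add[OF Fix_sub u_Fix[of k] subspace_scale[OF Fix_sub x'_Fix, of "x k p"]] that by simp
      qed
      have sum_Fix: "(\<Sum>k\<in>K. sc (f k) (x k)) \<in> Fix" for f
        by (intro subspace_sum[OF Fix_sub] subspace_scale[OF Fix_sub] x_Fix)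
      have "b' = sc (b' p) x'" using p by (simp add: x'_def)
      then have "b' \<in> Fix" using subspace_scale[OF Fix_sub x'_Fix, of "b' p"] by simp
      then have "b' + (\<Sum>k\<in>K. sc (b k) (x k)) \<in> Fix" by (rule subspace_add[OF Fix_sub _ sum_Fix])
      then have "b \<in> Fix" by (simp add: b'_def)
      moreover have "v \<in> Fix" if "v \<in> B" for v
        using rep[OF span_base[OF that]] sum_Fix[of v] by simp
      ultimately have "span (insert b B) \<subseteq> Fix" by (intro span_minimal Fix_sub) auto
      then have coords: "\<forall>v\<in>span (insert b B). v = (\<Sum>k\<in>insert p K. sc (v k) (u k))"
        unfolding Fix_def R_def by blast
      show ?thesis
        by (intro exI[of _ "insert p K"] exI[of _ u] conjI ballI) (use K u_span \<delta>' coords in blast)+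
    qed
  qed
  then show ?thesis by (elim exE conjE) (intro exI conjI)
qed

lemma summable_shifted_powr: "e < -1 \<Longrightarrow> summable (\<lambda>i. (real i + 1) powr e)"
  using summable_real_powr_iff[of e] summable_Suc_iff[of "\<lambda>n. real n powr e"] by (simp add: add.commute)

text \<open>
  For \<open>r \<ge> q\<close> this is the inclusion of \<open>\<ell>\<^sup>q\<close> into \<open>\<ell>\<^sup>r\<close>. For \<open>r < q\<close> it is Hoelder's inequality, here in the form
  of Young's inequality for a normalised vector; \<open>1 - r / q < \<eta>\<close> makes the dual power of the weight summable.
\<close>

lemma weighted_ell_embedding:
  fixes q r \<eta> :: real
  assumes q: "0 < q" and r: "0 < r" and \<eta>: "0 < \<eta>" "1 - r / q < \<eta>"
  shows "\<exists>K\<ge>0. \<forall>x \<in> vecs (ell q :: ('k::real_normed_field, nat \<Rightarrow> 'k) nspace). \<forall>n.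
     (\<Sum>i<n. (real i + 1) powr (- \<eta>) * norm (x i) powr r) \<le> K * nrm (ell q) x powr r"
proof -
  let ?E = "ell q :: ('k, nat \<Rightarrow> 'k) nspace"
  define w where "w i = (real i + 1) powr (- \<eta>)" for i :: nat
  have w: "0 \<le> w i" "w i \<le> 1" for i
    using \<eta> powr_mono[of "- \<eta>" 0 "real i + 1"] by (simp_all add: w_def)
  define V where "V i = (if r < q then (real i + 1) powr (- \<eta> * (q / (q - r))) else 0)" for i :: nat
  have pt: "w i * u powr r \<le> u powr q + V i" if u: "0 \<le> u" "u \<le> 1" for u i
  proof (cases "r < q")
    case True
    have "w i * u powr r \<le> w i powr ((q / r) / (q / r - 1)) + (u powr r) powr (q / r)"
      using True r w u by (intro powr_Young) auto
    also have "(q / r) / (q / r - 1) = q / (q - r)" using True r by (simp add: field_simps)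
    finally show ?thesis using True r by (simp add: V_def w_def powr_powr)
  next
    case False
    then have "u powr r \<le> u powr q" using u powr_mono'[of q r u] by simp
    moreover have "w i * u powr r \<le> 1 * u powr r" using w by (intro mult_right_mono) auto
    ultimately show ?thesis using False by (simp add: V_def)
  qed
  have V: "summable V" "\<And>i. 0 \<le> V i"
  proof -
    show "0 \<le> V i" for i by (simp add: V_def)
    show "summable V"
    proof (cases "r < q")
      case True
      have "(q - r) / q < \<eta>" using \<eta>(2) q by (simp add: diff_divide_distrib)
      then have "- \<eta> * (q / (q - r)) < - 1" using True q by (simp add: field_simps)
      then show ?thesis using True unfolding V_def by (simp add: summable_shifted_powr)
    qed (simp add: V_def[abs_def])
  qed
  define K where "K = 1 + (\<Sum>i. V i)"
  have K: "0 \<le> K" using V by (simp add: K_def suminf_nonneg)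
  have "(\<Sum>i<n. w i * norm (x i) powr r) \<le> K * nrm ?E x powr r" if x: "x \<in> vecs ?E" for x n
  proof (cases "nrm ?E x = 0")
    case True
    then have "x i = 0" for i using norm_le_nrm_ell[OF q x, of i] by simp
    then show ?thesis using K r by simp
  next
    case False
    define N where "N = nrm ?E x"
    have N: "0 < N" using False nrm_ell_nonneg[of q x] by (simp add: N_def)
    have le: "norm (x i) / N \<le> 1" for i using norm_le_nrm_ell[OF q x, of i] N by (simp add: N_def)
    have "(\<Sum>i<n. w i * norm (x i) powr r) / N powr r = (\<Sum>i<n. w i * (norm (x i) / N) powr r)"
      using N by (simp add: powr_divide sum_divide_distrib)
    also have "\<dots> \<le> (\<Sum>i<n. (norm (x i) / N) powr q + V i)"
      using N le by (intro sum_mono pt) auto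
    also have "\<dots> = (\<Sum>i<n. norm (x i) powr q) / N powr q + (\<Sum>i<n. V i)"
      using N by (simp add: sum.distrib powr_divide sum_divide_distrib)
    also have "\<dots> \<le> 1 + (\<Sum>i. V i)"
      using sum_le_nrm_ell[OF q x, of "{..<n}"] N V
      by (intro add_mono sum_le_suminf) (auto simp: N_def divide_le_eq)
    finally show ?thesis using N by (simp add: K_def N_def divide_le_eq)
  qed
  then show ?thesis using K unfolding w_def by blast
qed

section \<open>The trace functional on Sinha-Karn operators\<close>

text \<open>
  A coordinate of \<open>\<Sum>\<^sub>k l\<^sub>k z\<^sub>k\<close> is estimated by Young's inequality applied to \<open>w\<^bsup>1/r'\<^esup> \<bar>l\<^sub>k\<bar>\<close> and
  \<open>w\<^bsup>-1/r'\<^esup> b \<bar>z\<^sub>k(i)\<bar>\<close>. The free parameter \<open>w\<close> will depend on \<open>i\<close>: the first term is then summable over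
  \<open>i\<close>, although nothing relates the coefficients \<open>l\<close> belonging to different \<open>i\<close>.
\<close>

lemma r_co_coordinate_bound:
  fixes X :: "('k::real_normed_field, nat \<Rightarrow> 'k) nspace"
  assumes X: "vecs X \<subseteq> vecs (ell q)" "scl X = scl (ell q)" "nrm X = nrm (ell q)" and q: "1 \<le> q"
    and r: "1 < r" and z: "z \<in> strongly_summable r X" and x: "x \<in> r_co r X z"
    and w: "0 < w" and b: "0 \<le> b"
  shows "b * norm (x i) \<le> w + w powr (1 - r) * b powr r * (\<Sum>k. norm (z k i) powr r)"
    and "summable (\<lambda>k. norm (z k i) powr r)"
proof -
  have q0: "0 < q" using q by simp
  have zE: "z k \<in> vecs (ell q)" for k using z X(1) unfolding strongly_summable_def by blast
  have zs: "summable (\<lambda>k. nrm (ell q) (z k) powr r)" using z by (simp add: strongly_summable_def X)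
  have "norm (z k i) powr r \<le> nrm (ell q) (z k) powr r" for k
    using norm_le_nrm_ell[OF q0 zE] r by (intro powr_mono2) auto
  then show si: "summable (\<lambda>k. norm (z k i) powr r)"
    by (intro summable_comparison_test'[OF zs, where N = 0]) auto
  obtain l where l: "l \<in> coeff_ball r" and
    lim: "(\<lambda>n. nrm (ell q) ((\<Sum>k<n. scl (ell q) (l k) (z k)) - x)) \<longlonglongrightarrow> 0" and xX: "x \<in> vecs X"
    using x by (auto simp: r_co_def X)
  define r' where "r' = r / (r - 1)"
  have r': "0 < r'" using r by (simp add: r'_def)
  have lE: "l \<in> vecs (ell r')" "nrm (ell r') l \<le> 1"
    using l r by (simp_all add: coeff_ball_def unit_ball_def r'_def)
  interpret E: vector_space "scl (ell q) :: 'k \<Rightarrow> _" by (rule vector_space_ell)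
  have add: "u + v \<in> vecs (ell q)" if "u \<in> vecs (ell q)" "v \<in> vecs (ell q)" for u v :: "nat \<Rightarrow> 'k"
    using that by (rule ell_add(1)[OF q])
  have scale: "scl (ell q) c u \<in> vecs (ell q)" if "u \<in> vecs (ell q)" for c and u :: "nat \<Rightarrow> 'k"
    using ell_scale(1)[OF q0 that, of c] by simp
  have sub: "E.subspace (vecs (ell q))"
    using add scale q0 by (intro E.subspaceI) auto
  have diff: "(\<Sum>k<n. scl (ell q) (l k) (z k)) - x \<in> vecs (ell q)" for n
    using X(1) xX zE by (intro E.subspace_diff[OF sub] E.subspace_sum[OF sub] scale) auto
  have coord: "(\<lambda>n. \<Sum>k<n. l k * z k i) \<longlonglongrightarrow> x i"
  proof (rule LIM_zero_cancel, rule tendsto_0_le[OF lim, of _ 1], rule always_eventually, rule allI)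
    fix n
    have "norm (((\<Sum>k<n. scl (ell q) (l k) (z k)) - x) i) \<le> nrm (ell q) ((\<Sum>k<n. scl (ell q) (l k) (z k)) - x)"
      by (rule norm_le_nrm_ell[OF q0 diff])
    then show "norm ((\<Sum>k<n. l k * z k i) - x i) \<le> norm (nrm (ell q) ((\<Sum>k<n. scl (ell q) (l k) (z k)) - x)) * 1"
      by (simp add: sum_fun_apply nrm_ell_nonneg)
  qed
  define v where "v = w powr (1 - r) * b powr r"
  have v: "0 \<le> v" by (simp add: v_def)
  have term_le: "b * norm (l k * z k i) \<le> w * norm (l k) powr r' + v * norm (z k i) powr r" for k
  proof -
    define A where "A = w powr (1 / r') * norm (l k)"
    define B where "B = w powr (- (1 / r')) * (b * norm (z k i))"
    have "b * norm (l k * z k i) = A * B"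
      using w by (simp add: A_def B_def norm_mult powr_minus)
    also have "\<dots> \<le> A powr (r / (r - 1)) + B powr r"
      using b by (intro powr_Young r) (auto simp: A_def B_def)
    also have "A powr (r / (r - 1)) = w * norm (l k) powr r'"
      using w r' unfolding r'_def[symmetric] by (simp add: A_def powr_mult powr_powr)
    also have "B powr r = v * norm (z k i) powr r"
    proof -
      have "- (1 / r') * r = 1 - r" using r by (simp add: r'_def field_simps)
      then show ?thesis using b by (simp add: B_def v_def powr_mult powr_powr)
    qed
    finally show ?thesis .
  qed
  have "b * norm (\<Sum>k<n. l k * z k i) \<le> w + v * (\<Sum>k. norm (z k i) powr r)" for n
  proof -
    have "b * norm (\<Sum>k<n. l k * z k i) \<le> b * (\<Sum>k<n. norm (l k * z k i))"
      using b by (intro mult_left_mono norm_sum) auto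
    also have "\<dots> \<le> (\<Sum>k<n. w * norm (l k) powr r' + v * norm (z k i) powr r)"
      unfolding sum_distrib_left by (rule sum_mono) (rule term_le)
    also have "\<dots> = w * (\<Sum>k<n. norm (l k) powr r') + v * (\<Sum>k<n. norm (z k i) powr r)"
      by (simp add: sum.distrib sum_distrib_left)
    also have "\<dots> \<le> w * 1 + v * (\<Sum>k. norm (z k i) powr r)"
    proof (intro add_mono mult_left_mono)
      have "(\<Sum>k<n. norm (l k) powr r') \<le> nrm (ell r') l powr r'"
        by (rule sum_le_nrm_ell[OF r' lE(1)]) simp
      also have "\<dots> \<le> 1 powr r'" using lE(2) r' by (intro powr_mono2) (auto simp: nrm_ell_nonneg)
      finally show "(\<Sum>k<n. norm (l k) powr r') \<le> 1" by simp
      show "(\<Sum>k<n. norm (z k i) powr r) \<le> (\<Sum>k. norm (z k i) powr r)"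
        by (rule sum_le_suminf[OF si]) auto
    qed (use w v in auto)
    finally show ?thesis by simp
  qed
  moreover have "(\<lambda>n. b * norm (\<Sum>k<n. l k * z k i)) \<longlonglongrightarrow> b * norm (x i)"
    by (intro tendsto_mult tendsto_const tendsto_norm coord)
  ultimately show "b * norm (x i) \<le> w + w powr (1 - r) * b powr r * (\<Sum>k. norm (z k i) powr r)"
    unfolding v_def[symmetric] by (intro LIMSEQ_le_const2) auto
qed

text \<open>
  The matrix of \<open>nilpotent_matrix_with_trace_one\<close>, with one exponent \<open>s\<close> fixed for its decay.
\<close>

locale nilpotent_matrix =
  fixes a :: "nat \<Rightarrow> nat \<Rightarrow> real" and s C q :: real
  assumes bound: "\<bar>a i k\<bar> \<le> C * (real i + 1) powr (- s)"
    and banded: "a i k \<noteq> 0 \<Longrightarrow> i \<le> 4 * k \<and> k \<le> 4 * i"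
    and square_zero: "(\<Sum>l\<le>4 * k. a i l * a l k) = 0"
    and diagonal: "8 \<le> i \<Longrightarrow> a i i = 0"
    and trace: "(\<Sum>i<8. a i i) = 1"
    and q: "1 < q"
begin

definition matrix_row :: "nat \<Rightarrow> nat \<Rightarrow> 'k::{real_normed_field,banach}" where
  "matrix_row i = (\<lambda>k. of_real (a i k))"

text \<open>
  Column \<open>k\<close> of the matrix ends before position \<open>4 k + 1\<close>, so that the relations are finite sums and define
  a closed subspace.
\<close>

definition left_kernel :: "(nat \<Rightarrow> 'k::{real_normed_field,banach}) set" where
  "left_kernel = {x \<in> vecs (ell q). \<forall>k. (\<Sum>i\<le>4 * k. x i * matrix_row i k) = 0}"

lemma q0: "0 < q" using q by simp

lemma C_nonneg: "0 \<le> C"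
  using bound[of 0 0] by simp

lemma kernel_closed: "closed_subspace (ell q) (left_kernel :: (nat \<Rightarrow> 'k::{real_normed_field,banach}) set)"
proof -
  let ?E = "ell q :: ('k, nat \<Rightarrow> 'k) nspace"
  interpret E: Banach ?E using banach_ell[of q] q by (simp add: Banach_iff)
  have "E.subspace (left_kernel :: (nat \<Rightarrow> 'k) set)"
  proof (rule E.subspaceI)
    show "0 \<in> (left_kernel :: (nat \<Rightarrow> 'k) set)" using E.vecs_0 unfolding left_kernel_def by simp
    show "x + y \<in> left_kernel" if "x \<in> left_kernel" "y \<in> left_kernel" for x y :: "nat \<Rightarrow> 'k"
      using that E.vecs_add[of x y] unfolding left_kernel_def mem_Collect_eq
      by (simp only: plus_fun_apply distrib_right sum.distrib) simp
    show "scl ?E c x \<in> left_kernel" if "x \<in> left_kernel" for c x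
    proof -
      have "(\<Sum>i\<le>4 * k. scl ?E c x i * matrix_row i k) = c * (\<Sum>i\<le>4 * k. x i * matrix_row i k)" for k
        by (simp add: sum_distrib_left mult.assoc)
      then show ?thesis using that E.vecs_scale[of x c] unfolding left_kernel_def mem_Collect_eq by simp
    qed
  qed
  moreover have "x \<in> left_kernel"
    if f: "range f \<subseteq> left_kernel" and x: "x \<in> vecs ?E" and lim: "(\<lambda>n. nrm ?E (f n - x)) \<longlonglongrightarrow> 0"
    for f and x :: "nat \<Rightarrow> 'k"
  proof -
    have fk: "f n \<in> left_kernel" for n using f by auto
    have coord: "(\<lambda>n. f n i) \<longlonglongrightarrow> x i" for i
    proof (rule LIM_zero_cancel, rule tendsto_0_le[OF lim, of _ 1], rule always_eventually, rule allI)
      fix n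
      have "f n - x \<in> vecs ?E" using fk x by (intro E.vecs_diff) (auto simp: left_kernel_def)
      then show "norm (f n i - x i) \<le> norm (nrm ?E (f n - x)) * 1"
        using norm_le_nrm_ell[OF q0, of "f n - x" i] by (simp add: nrm_ell_nonneg)
    qed
    have "(\<Sum>i\<le>4 * k. x i * matrix_row i k) = 0" for k
    proof (rule LIMSEQ_unique)
      show "(\<lambda>n. \<Sum>i\<le>4 * k. f n i * matrix_row i k) \<longlonglongrightarrow> (\<Sum>i\<le>4 * k. x i * matrix_row i k)"
        by (intro tendsto_sum tendsto_mult coord tendsto_const)
      have "(\<Sum>i\<le>4 * k. f n i * matrix_row i k) = 0" for n using fk[of n] by (simp add: left_kernel_def)
      then show "(\<lambda>n. \<Sum>i\<le>4 * k. f n i * matrix_row i k) \<longlonglongrightarrow> 0" by simp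
    qed
    then show ?thesis using x by (simp add: left_kernel_def)
  qed
  ultimately show ?thesis unfolding closed_subspace_def by (auto simp: left_kernel_def)
qed

lemma row_ell: "(matrix_row i :: nat \<Rightarrow> 'k::{real_normed_field,banach}) \<in> vecs (ell q)"
  and nrm_row: "nrm (ell q) (matrix_row i :: nat \<Rightarrow> 'k) \<le> 4 powr (1 / q) * C * (real i + 1) powr (1 / q - s)"
proof -
  define M where "M = 4 powr (1 / q) * C * (real i + 1) powr (1 / q - s)"
  have M: "0 \<le> M" using C_nonneg by (simp add: M_def)
  have "(\<Sum>k<n. norm (matrix_row i k :: 'k) powr q) \<le> M powr q" for n
  proof -
    have "(\<Sum>k<n. norm (matrix_row i k :: 'k) powr q) \<le> (\<Sum>k<max n (4 * i + 1). \<bar>a i k\<bar> powr q)"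
      by (simp add: matrix_row_def sum_mono2)
    also have "\<dots> = (\<Sum>k<4 * i + 1. \<bar>a i k\<bar> powr q)"
    proof (rule sum.mono_neutral_right)
      show "\<forall>k\<in>{..<max n (4 * i + 1)} - {..<4 * i + 1}. \<bar>a i k\<bar> powr q = 0"
        using banded[of i] by force
    qed auto
    also have "\<dots> \<le> (\<Sum>k<4 * i + 1. (C * (real i + 1) powr (- s)) powr q)"
      using bound q by (intro sum_mono powr_mono2) auto
    also have "\<dots> \<le> (4 * (real i + 1)) * (C * (real i + 1) powr (- s)) powr q"
      by (simp add: mult_right_mono)
    also have "\<dots> = M powr q"
    proof -
      have e: "(1 / q - s) * q = 1 - s * q" using q by (simp add: field_simps)
      have "(real i + 1) powr (1 - s * q) = (real i + 1) * (real i + 1) powr (- s * q)"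
        using powr_add[of "real i + 1" 1 "- s * q"] by simp
      moreover have "M powr q = 4 * C powr q * (real i + 1) powr (1 - s * q)"
        unfolding e[symmetric] using q C_nonneg by (simp add: M_def powr_mult powr_powr)
      moreover have "(C * (real i + 1) powr (- s)) powr q = C powr q * (real i + 1) powr (- s * q)"
        using C_nonneg by (simp add: powr_mult powr_powr)
      ultimately show ?thesis by (simp only: mult_ac)
    qed
    finally show ?thesis .
  qed
  from nrm_ell_le[OF q0 M this]
  show "(matrix_row i :: nat \<Rightarrow> 'k) \<in> vecs (ell q)" "nrm (ell q) (matrix_row i :: nat \<Rightarrow> 'k) \<le> 4 powr (1 / q) * C * (real i + 1) powr (1 / q - s)"
    by (auto simp: M_def)
qed

lemma row_kernel: "matrix_row i \<in> (left_kernel :: (nat \<Rightarrow> 'k::{real_normed_field,banach}) set)"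
proof -
  have "(\<Sum>l\<le>4 * k. matrix_row i l * matrix_row l k) = (of_real (\<Sum>l\<le>4 * k. a i l * a l k) :: 'k)" for k
    by (simp add: matrix_row_def)
  then show ?thesis using row_ell by (simp add: left_kernel_def square_zero)
qed

text \<open>
  The columns of a banded matrix are finite, so that the relations defining the left kernel already
  hold for long partial sums.
\<close>

lemma kernel_partial_sum:
  fixes x :: "nat \<Rightarrow> 'k::{real_normed_field,banach}"
  assumes "x \<in> left_kernel" "4 * k < n"
  shows "(\<Sum>i<n. x i * matrix_row i k) = 0"
proof -
  have "(\<Sum>i<n. x i * matrix_row i k) = (\<Sum>i\<le>4 * k. x i * matrix_row i k)"
  proof (rule sum.mono_neutral_right)
    show "\<forall>i\<in>{..<n} - {..4 * k}. x i * matrix_row i k = 0" using banded[of _ k] by (force simp: matrix_row_def)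
  qed (use assms(2) in auto)
  then show ?thesis using assms(1) by (simp add: left_kernel_def)
qed

lemma trace_row: "8 \<le> n \<Longrightarrow> (\<Sum>i<n. matrix_row i i) = (1 :: 'k::{real_normed_field,banach})"
proof -
  assume "8 \<le> n"
  then have "(\<Sum>i<n. a i i) = (\<Sum>i<8. a i i)" using diagonal by (intro sum.mono_neutral_right) auto
  then have "of_real (\<Sum>i<n. a i i) = (1 :: 'k)" by (simp add: trace)
  then show ?thesis by (simp add: matrix_row_def)
qed

text \<open>
  The inclusion of the space \<open>Z\<close> generated by the normalised rows cannot be approximated: the functional
  \<open>D \<mapsto> \<Sum>\<^sub>i (D a\<^sub>i)(i)\<close> is \<open>1\<close> on it, vanishes on operators of finite rank (\<open>finite_rank_trace\<close>) and is
  small on \<open>SK\<close> operators of small norm (\<open>trace_bound\<close>).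
\<close>

theorem kernel_fails_SK_AP:
  fixes r :: real
  assumes r: "1 < r" and sq: "1 + 1 / q < s" and sr: "1 + 1 / r < s"
  shows "\<not> SK_AP r ((ell q)\<lparr>vecs := left_kernel :: (nat \<Rightarrow> 'k::{real_normed_field,banach}) set\<rparr>)"
proof
  define X where "X = (ell q)\<lparr>vecs := left_kernel :: (nat \<Rightarrow> 'k) set\<rparr>"
  assume "SK_AP r ((ell q)\<lparr>vecs := left_kernel :: (nat \<Rightarrow> 'k) set\<rparr>)"
  then have AP: "SK_AP r X" by (simp add: X_def)
  have X_simps [simp]: "vecs X = left_kernel" "scl X = scl (ell q)" "nrm X = nrm (ell q)" by (simp_all add: X_def)
  have "banach_space X"
    unfolding X_def using banach_closed_subspace[OF banach_ell kernel_closed] q by simp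
  then interpret X: Banach X by (simp add: Banach_iff)
  have kernel_ell: "left_kernel \<subseteq> vecs (ell q :: ('k, nat \<Rightarrow> 'k) nspace)" by (auto simp: left_kernel_def)

  have X_ell: "vecs X \<subseteq> vecs (ell q)" unfolding X_simps by (rule kernel_ell)
  have coord_le: "norm (v k) \<le> nrm X v" if "v \<in> vecs X" for v k
    unfolding X_simps by (rule norm_le_nrm_ell[OF q0 subsetD[OF X_ell that]])

  \<comment> \<open>Below \<open>u\<close> the normalised rows are strongly \<open>r\<close>-summable; above \<open>m\<close> the functional converges. The
      hypotheses on \<open>s\<close> say precisely that \<open>m < u\<close>.\<close>
  define m where "m = max (1 - 1 / q) (1 - 1 / r)"
  define u where "u = s - 1 / q - 1 / r"
  have mu: "m < u" using sq sr by (simp add: m_def u_def)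
  define t where "t = (m + u) / 2"
  have t: "m < t" "t < u" using mu by (simp_all add: t_def)
  have tq: "1 - 1 / q < t" and tr: "1 - 1 / r < t" using t(1) by (simp_all add: m_def)
  have t0: "0 < t" using tq q by (smt (verit) divide_less_eq_1_pos)
  define b where "b i = (real i + 1) powr (- t)" for i :: nat
  have b: "0 < b i" for i by (simp add: b_def)
  define y where "y i = scl X (of_real (1 / b i)) (matrix_row i)" for i
  have row_y: "matrix_row i = scl X (of_real (b i)) (y i)" for i
    using b[of i] by (simp add: y_def fun_eq_iff flip: of_real_mult mult.assoc)
  have y_vecs: "y i \<in> vecs X" for i
    unfolding y_def by (rule X.vecs_scale) (simp add: row_kernel)
  have row_X: "matrix_row i \<in> vecs X" for i by (simp add: row_kernel)
  have nrm_y: "nrm X (y i) \<le> 4 powr (1 / q) * C * (real i + 1) powr (t + 1 / q - s)" for i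
  proof -
    have "nrm X (y i) = (real i + 1) powr t * nrm (ell q) (matrix_row i :: nat \<Rightarrow> 'k)"
      unfolding y_def X.nrm_scale[OF row_X] by (simp add: norm_divide b_def powr_minus divide_inverse)
    also have "\<dots> \<le> (real i + 1) powr t * (4 powr (1 / q) * C * (real i + 1) powr (1 / q - s))"
      by (intro mult_left_mono nrm_row) simp
    also have "\<dots> = 4 powr (1 / q) * C * (real i + 1) powr (t + 1 / q - s)"
      using powr_add[of "real i + 1" t "1 / q - s"] by (simp add: add_diff_eq)
    finally show ?thesis .
  qed
  have "y \<in> strongly_summable r X"
  proof -
    have sum: "summable (\<lambda>i. (4 powr (1 / q) * C) powr r * (real i + 1) powr ((t + 1 / q - s) * r))"
    proof (intro summable_mult summable_shifted_powr)
      have "t + 1 / q - s < - 1 / r" using t(2) by (simp add: u_def)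
      then have "(t + 1 / q - s) * r < (- 1 / r) * r" using r by (intro mult_strict_right_mono) auto
      then show "(t + 1 / q - s) * r < - 1" using r by simp
    qed
    have le: "nrm X (y i) powr r \<le> (4 powr (1 / q) * C) powr r * (real i + 1) powr ((t + 1 / q - s) * r)" for i
    proof -
      have "nrm X (y i) powr r \<le> (4 powr (1 / q) * C * (real i + 1) powr (t + 1 / q - s)) powr r"
        using nrm_y[of i] r by (intro powr_mono2) (auto simp: nrm_ell_nonneg)
      then show ?thesis using C_nonneg by (simp add: powr_mult powr_powr)
    qed
    have "summable (\<lambda>i. nrm X (y i) powr r)"
      by (rule summable_comparison_test'[OF sum, where N = 0])
        (simp only: real_norm_def abs_of_nonneg[OF powr_ge_zero] le)
    then show ?thesis using y_vecs unfolding strongly_summable_def by blast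
  qed
  then interpret synthesis X r y by (intro synthesis.intro synthesis_axioms.intro X.Banach_axioms r)

  have row_Z: "matrix_row i \<in> vecs Z" for i
    using row_y[of i] X.subspace_scale[OF Z_subspace, of "y i" "of_real (b i)"] y_Z[of i] by simp
  interpret Z: Banach Z using banach_range_space by (simp add: Banach_iff)
  have nrm_row_Z: "nrm Z (matrix_row i) \<le> b i" for i
    using Z.nrm_scale[OF y_Z, of "of_real (b i)" i] nrm_y_Z[of i] b[of i] row_y[of i]
    by (simp add: mult_left_le)

  \<comment> \<open>The series converges absolutely in \<open>Z\<close>, and its limit has vanishing coordinates because \<open>x\<close> is in the
      left kernel.\<close>
  have row_series: "(\<lambda>n. nrm Z (\<Sum>i<n. scl X (x i) (matrix_row i))) \<longlonglongrightarrow> 0" if x: "x \<in> left_kernel" for x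
  proof -
    have xE: "x \<in> vecs (ell q)" using x kernel_ell by blast
    obtain K where K: "\<And>n. (\<Sum>i<n. (real i + 1) powr (- t) * norm (x i) powr 1) \<le> K * nrm (ell q) x powr 1"
      using weighted_ell_embedding[where 'k = 'k, OF q0 zero_less_one t0 tq] xE by blast
    have sum: "summable (\<lambda>i. (real i + 1) powr (- t) * norm (x i) powr 1)"
      by (rule summableI_nonneg_bounded[OF _ K]) simp
    have wZ: "scl X (x i) (matrix_row i) \<in> vecs Z" for i
      using X.subspace_scale[OF Z_subspace] row_Z by simp
    have le: "nrm Z (scl X (x i) (matrix_row i)) \<le> (real i + 1) powr (- t) * norm (x i) powr 1" for i
      using Z.nrm_scale[OF row_Z, of "x i" i] mult_left_mono[OF nrm_row_Z[of i], of "norm (x i)"]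
      by (simp add: b_def mult.commute)
    have "summable (\<lambda>i. nrm Z (scl X (x i) (matrix_row i)))"
      by (rule summable_comparison_test'[OF sum, where N = 0])
        (simp only: real_norm_def abs_of_nonneg[OF Z.nrm_nonneg[OF wZ]] le)
    from Z.series_converges[of "\<lambda>i. scl X (x i) (matrix_row i)", OF wZ this]
    obtain \<xi> where \<xi>: "\<xi> \<in> vecs Z" "(\<lambda>n. nrm Z ((\<Sum>i<n. scl X (x i) (matrix_row i)) - \<xi>)) \<longlonglongrightarrow> 0"
      by (elim bexE) (rule that)
    have sumZ: "(\<Sum>i<n. scl X (x i) (matrix_row i)) \<in> vecs Z" for n by (rule Z.vecs_sum) (rule wZ)
    obtain D where D: "\<And>z. z \<in> vecs Z \<Longrightarrow> nrm X z \<le> D * nrm Z z" using inclusion_bounded by blast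
    have Z_X: "vecs Z \<subseteq> vecs X" using T_vecs unfolding Z_simps by blast
    have "\<xi> k = 0" for k
    proof -
      have "norm (\<xi> k) \<le> D * nrm Z ((\<Sum>i<n. scl X (x i) (matrix_row i)) - \<xi>)" if "4 * k < n" for n
      proof -
        have v: "(\<Sum>i<n. scl X (x i) (matrix_row i)) - \<xi> \<in> vecs Z" by (rule Z.vecs_diff[OF sumZ \<xi>(1)])
        have "((\<Sum>i<n. scl X (x i) (matrix_row i)) - \<xi>) k = - \<xi> k"
          using kernel_partial_sum[OF x that] by (simp add: sum_fun_apply)
        then have "norm (\<xi> k) = norm (((\<Sum>i<n. scl X (x i) (matrix_row i)) - \<xi>) k)" by (metis norm_minus_cancel)
        also have "\<dots> \<le> nrm X ((\<Sum>i<n. scl X (x i) (matrix_row i)) - \<xi>)"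
          by (rule coord_le[OF subsetD[OF Z_X v]])
        also have "\<dots> \<le> D * nrm Z ((\<Sum>i<n. scl X (x i) (matrix_row i)) - \<xi>)" by (rule D[OF v])
        finally show ?thesis .
      qed
      moreover have "(\<lambda>n. D * nrm Z ((\<Sum>i<n. scl X (x i) (matrix_row i)) - \<xi>)) \<longlonglongrightarrow> D * 0"
        by (intro tendsto_mult tendsto_const \<xi>(2))
      ultimately have "norm (\<xi> k) \<le> D * 0" by (intro LIMSEQ_le_const) (auto intro!: exI[of _ "Suc (4 * k)"])
      then show ?thesis by simp
    qed
    then have "\<xi> = 0" by (simp add: fun_eq_iff)
    then show ?thesis using \<xi>(2) by simp
  qed

  have finite_rank_trace: "(\<lambda>n. \<Sum>i<n. S (matrix_row i) i) \<longlonglongrightarrow> 0" if S: "S \<in> finite_rank_op Z X" for S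
  proof -
    have S_bdd: "S \<in> bounded_op Z X" using S by (simp add: finite_rank_op_def)
    interpret S: operator_range Z X S by unfold_locales (rule S_bdd)
    obtain D where D: "\<And>z. z \<in> vecs Z \<Longrightarrow> nrm X (S z) \<le> D * nrm Z z"
    proof -
      have "\<exists>D. \<forall>z\<in>vecs Z. nrm X (S z) \<le> D * nrm Z z" using S_bdd by (simp add: bounded_op_def)
      then show ?thesis using that by blast
    qed
    obtain B where B: "finite B" "B \<subseteq> vecs X" "S ` vecs Z \<subseteq> X.span B"
      using S by (auto simp: finite_rank_op_def)
    obtain K x where K: "finite K" "\<And>k. k \<in> K \<Longrightarrow> x k \<in> X.span B"
      "\<And>v. v \<in> X.span B \<Longrightarrow> v = (\<Sum>k\<in>K. scl X (v k) (x k))"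
      using finite_span_coordinates[OF B(1)] by auto
    have x: "x k \<in> left_kernel" if "k \<in> K" for k
      using K(2)[OF that] X.span_minimal[OF B(2) X.subspace_vecs] by auto
    \<comment> \<open>The functional becomes a finite sum over \<open>k\<close> of the coordinate \<open>k\<close> of \<open>S (\<Sum>\<^sub>i x k i a\<^sub>i)\<close>.\<close>
    have S_row: "S (matrix_row i) i = (\<Sum>k\<in>K. S (matrix_row i) k * x k i)" for i
    proof -
      have "S (matrix_row i) \<in> X.span B" using B(3) row_Z by blast
      from arg_cong[OF K(3)[OF this], of "\<lambda>v. v i"] show ?thesis by (simp add: sum_fun_apply)
    qed
    have "(\<Sum>i<n. S (matrix_row i) i) = (\<Sum>k\<in>K. S (\<Sum>i<n. scl X (x k i) (matrix_row i)) k)" for n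
    proof -
      have "S (\<Sum>i<n. scl X (x k i) (matrix_row i)) k = (\<Sum>i<n. S (matrix_row i) k * x k i)" for k
      proof -
        have "S (\<Sum>i<n. scl X (x k i) (matrix_row i)) = (\<Sum>i<n. S (scl Z (x k i) (matrix_row i)))"
          using S.T_sum[of "{..<n}" "\<lambda>i. scl Z (x k i) (matrix_row i)"] Z.vecs_scale[OF row_Z] by simp
        also have "\<dots> = (\<Sum>i<n. scl X (x k i) (S (matrix_row i)))"
          using S.T_scale[OF row_Z] by simp
        finally show ?thesis by (simp add: sum_fun_apply mult.commute)
      qed
      then show ?thesis unfolding S_row by (simp add: sum.swap[of _ K])
    qed
    moreover have "(\<lambda>n. \<Sum>k\<in>K. S (\<Sum>i<n. scl X (x k i) (matrix_row i)) k) \<longlonglongrightarrow> (\<Sum>k\<in>K. 0)"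
    proof (rule tendsto_sum)
      fix k assume k: "k \<in> K"
      have "(\<lambda>n. D * nrm Z (\<Sum>i<n. scl X (x k i) (matrix_row i))) \<longlonglongrightarrow> D * 0"
        by (intro tendsto_mult tendsto_const row_series x k)
      then have lim: "(\<lambda>n. D * nrm Z (\<Sum>i<n. scl X (x k i) (matrix_row i))) \<longlonglongrightarrow> 0" by simp
      show "(\<lambda>n. S (\<Sum>i<n. scl X (x k i) (matrix_row i)) k) \<longlonglongrightarrow> 0"
      proof (rule Lim_null_comparison[OF always_eventually lim], rule allI)
        fix n
        have v: "(\<Sum>i<n. scl X (x k i) (matrix_row i)) \<in> vecs Z"
          using Z.vecs_sum[of "{..<n}" "\<lambda>i. scl Z (x k i) (matrix_row i)"] Z.vecs_scale[OF row_Z] by simp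
        have "norm (S (\<Sum>i<n. scl X (x k i) (matrix_row i)) k) \<le> nrm X (S (\<Sum>i<n. scl X (x k i) (matrix_row i)))"
          by (rule coord_le[OF S.T_vecs[OF v]])
        also have "\<dots> \<le> D * nrm Z (\<Sum>i<n. scl X (x k i) (matrix_row i))" by (rule D[OF v])
        finally show "norm (S (\<Sum>i<n. scl X (x k i) (matrix_row i)) k) \<le> D * nrm Z (\<Sum>i<n. scl X (x k i) (matrix_row i))" .
      qed
    qed
    ultimately show ?thesis by simp
  qed

  \<comment> \<open>Weights \<open>w\<^sub>i \<sim> i\<^bsup>-\<rho>\<^esup>\<close> with \<open>\<rho>\<close> just above \<open>1\<close> are summable; half of the margin \<open>t - m\<close> is spent on \<open>\<rho>\<close>, and the
      other half keeps the exponent \<open>\<eta>\<close> of the remaining weight within the range of the embedding.\<close>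
  define \<rho> where "\<rho> = 1 + (t - m) * r / (2 * (r - 1))"
  have \<rho>: "1 < \<rho>" using t(1) r by (simp add: \<rho>_def)
  define \<eta> where "\<eta> = t * r - \<rho> * (r - 1)"
  have \<eta>_eq: "\<eta> = m * r - (r - 1) + (t - m) * r / 2"
    using r by (simp add: \<eta>_def \<rho>_def field_simps)
  have \<eta>: "0 < \<eta>" "1 - r / q < \<eta>"
  proof -
    have g: "0 < (t - m) * r / 2" using t(1) r by simp
    have "(1 - 1 / r) * r \<le> m * r" "(1 - 1 / q) * r \<le> m * r"
      using r by (auto simp: m_def intro!: mult_right_mono)
    then have "r - 1 \<le> m * r" "r - r / q \<le> m * r" using r by (simp_all add: left_diff_distrib)
    then show "0 < \<eta>" "1 - r / q < \<eta>" unfolding \<eta>_eq using g by linarith+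
  qed
  obtain K where K: "0 \<le> K" "\<And>x n. x \<in> vecs (ell q :: ('k, nat \<Rightarrow> 'k) nspace) \<Longrightarrow>
      (\<Sum>i<n. (real i + 1) powr (- \<eta>) * norm (x i) powr r) \<le> K * nrm (ell q) x powr r"
    using weighted_ell_embedding[of q r \<eta>, where 'k = 'k] q0 r \<eta> by auto
  have W: "summable (\<lambda>i. (real i + 1) powr (- \<rho>))" using \<rho> by (intro summable_shifted_powr) simp
  define W0 where "W0 = (\<Sum>i. (real i + 1) powr (- \<rho>))"
  have "0 < W0" unfolding W0_def by (rule suminf_pos[OF W]) simp
  \<comment> \<open>The total weight \<open>1/2\<close> leaves room below the value \<open>1\<close> of the functional on the inclusion.\<close>
  define c where "c = 1 / (2 * W0)"
  have c: "0 < c" using \<open>0 < W0\<close> by (simp add: c_def)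
  define w where "w i = c * (real i + 1) powr (- \<rho>)" for i :: nat
  have w: "0 < w i" for i using c by (simp add: w_def)
  have sum_w: "(\<Sum>i<n. w i) \<le> 1 / 2" for n
  proof -
    have "(\<Sum>i<n. w i) \<le> c * W0"
      unfolding w_def sum_distrib_left[symmetric] W0_def using c W by (intro mult_left_mono sum_le_suminf) auto
    then show ?thesis using \<open>0 < W0\<close> by (simp add: c_def)
  qed
  have wb: "w i powr (1 - r) * b i powr r = c powr (1 - r) * (real i + 1) powr (- \<eta>)" for i
  proof -
    have "- \<rho> * (1 - r) + (- t) * r = - \<eta>" by (simp add: \<eta>_def algebra_simps)
    then show ?thesis using c by (simp add: w_def b_def powr_mult powr_powr mult.assoc flip: powr_add)
  qed
  define K' where "K' = c powr (1 - r) * K"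
  have K': "0 \<le> K'" using K(1) by (simp add: K'_def)
  have trace_bound: "norm (\<Sum>i<n. D (matrix_row i) i) \<le> 1 / 2 + K' * (\<Sum>k. nrm X (z k) powr r)"
    if D: "D \<in> bounded_op Z X" and z: "z \<in> strongly_summable r X" and DZ: "D ` unit_ball Z \<subseteq> r_co r X z"
    for D z n
  proof -
    have zE: "z k \<in> vecs (ell q)" for k using z kernel_ell unfolding strongly_summable_def X_simps by blast
    have zs: "summable (\<lambda>k. nrm X (z k) powr r)" using z by (simp add: strongly_summable_def)
    have co: "D (y i) \<in> r_co r X z" for i using DZ y_Z[of i] nrm_y_Z[of i] by (auto simp: unit_ball_def)
    have b1: "norm (D (matrix_row i) i) \<le> w i + c powr (1 - r) * ((real i + 1) powr (- \<eta>) * (\<Sum>k. norm (z k i) powr r))"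
      and s1: "summable (\<lambda>k. norm (z k i) powr r)" for i
    proof -
      have "D (matrix_row i) = scl X (of_real (b i)) (D (y i))"
        using D y_Z[of i] row_y[of i] unfolding bounded_op_def by (auto simp del: Z_simps(1))
      then have "norm (D (matrix_row i) i) = b i * norm (D (y i) i)" using b[of i] by (simp add: norm_mult)
      also have "\<dots> \<le> w i + w i powr (1 - r) * b i powr r * (\<Sum>k. norm (z k i) powr r)"
        by (rule r_co_coordinate_bound(1)[OF X_ell X_simps(2,3) less_imp_le[OF q] r z co w less_imp_le[OF b]])
      finally show "norm (D (matrix_row i) i) \<le> w i + c powr (1 - r) * ((real i + 1) powr (- \<eta>) * (\<Sum>k. norm (z k i) powr r))"
        by (simp add: wb mult.assoc)
      show "summable (\<lambda>k. norm (z k i) powr r)"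
        by (rule r_co_coordinate_bound(2)[OF X_ell X_simps(2,3) less_imp_le[OF q] r z co w less_imp_le[OF b]])
    qed
    have "norm (\<Sum>i<n. D (matrix_row i) i)
        \<le> (\<Sum>i<n. w i + c powr (1 - r) * ((real i + 1) powr (- \<eta>) * (\<Sum>k. norm (z k i) powr r)))"
      by (rule order_trans[OF norm_sum sum_mono[OF b1]])
    also have "\<dots> = (\<Sum>i<n. w i)
        + c powr (1 - r) * (\<Sum>i<n. (real i + 1) powr (- \<eta>) * (\<Sum>k. norm (z k i) powr r))"
      by (simp add: sum.distrib sum_distrib_left)
    also have "(\<Sum>i<n. (real i + 1) powr (- \<eta>) * (\<Sum>k. norm (z k i) powr r))
        = (\<Sum>k. \<Sum>i<n. (real i + 1) powr (- \<eta>) * norm (z k i) powr r)"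
      using s1 by (subst suminf_sum) (auto simp: suminf_mult intro!: summable_mult)
    also have "(\<Sum>k. \<Sum>i<n. (real i + 1) powr (- \<eta>) * norm (z k i) powr r) \<le> (\<Sum>k. K * nrm X (z k) powr r)"
      using K(2)[OF zE] zs s1 by (intro suminf_le summable_sum summable_mult) auto
    also have "\<dots> = K * (\<Sum>k. nrm X (z k) powr r)" by (rule suminf_mult[OF zs])
    finally have "norm (\<Sum>i<n. D (matrix_row i) i) \<le> (\<Sum>i<n. w i) + c powr (1 - r) * (K * (\<Sum>k. nrm X (z k) powr r))"
      by (simp add: mult_left_mono)
    then show ?thesis using sum_w[of n] by (simp add: K'_def mult.assoc)
  qed

  define e where "e = (1 / (4 * (K' + 1))) powr (1 / r)"
  have e: "0 < e" using K' by (simp add: e_def)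
  obtain S where S: "S \<in> finite_rank_op Z X" "(\<lambda>v. v - S v) \<in> SK r Z X" "SK_norm r Z X (\<lambda>v. v - S v) < e"
    using AP[unfolded SK_AP_def, rule_format, OF banach_range_space inclusion_SK e] by blast
  define D where "D v = v - S v" for v
  have D: "D \<in> bounded_op Z X" using S(2) by (simp add: D_def[abs_def] SK_def)
  obtain z where z: "z \<in> strongly_summable r X" "D ` unit_ball Z \<subseteq> r_co r X z" "strong_norm r X z < e"
  proof -
    let ?A = "{strong_norm r X z | z. z \<in> strongly_summable r X \<and> D ` unit_ball Z \<subseteq> r_co r X z}"
    have "?A \<noteq> {}" using S(2) by (auto simp: SK_def D_def[abs_def])
    moreover have "Inf ?A < e" using S(3) by (simp add: SK_norm_def D_def[abs_def])
    ultimately have "\<exists>a\<in>?A. a < e" by (rule cInf_lessD)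
    then show ?thesis using that by blast
  qed
  have "(\<Sum>k. nrm X (z k) powr r) = strong_norm r X z powr r"
    using z(1) r by (simp add: strong_norm_def powr_powr strongly_summable_def suminf_nonneg)
  also have "\<dots> \<le> e powr r" using z(3) r by (intro powr_mono2) (auto simp: strong_norm_def)
  also have "\<dots> = 1 / (4 * (K' + 1))" using r K' by (simp add: e_def powr_powr)
  finally have "K' * (\<Sum>k. nrm X (z k) powr r) \<le> K' * (1 / (4 * (K' + 1)))" using K' by (intro mult_left_mono)
  also have "\<dots> \<le> 1 / 4" using K' by (simp add: field_simps)
  finally have small: "norm (\<Sum>i<n. D (matrix_row i) i) \<le> 3 / 4" for n
    using trace_bound[OF D z(1,2), of n] by simp
  have "(\<Sum>i<n. D (matrix_row i) i) = 1 - (\<Sum>i<n. S (matrix_row i) i)" if "8 \<le> n" for n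
    using trace_row[OF that, where 'k = 'k] by (simp add: D_def sum_subtractf)
  then have "norm (1 - (\<Sum>i<n. S (matrix_row i) i)) \<le> 3 / 4" if "8 \<le> n" for n
    using small[of n] that by simp
  moreover have "(\<lambda>n. norm (1 - (\<Sum>i<n. S (matrix_row i) i))) \<longlonglongrightarrow> norm (1 - 0 :: 'k)"
    by (intro tendsto_intros finite_rank_trace S)
  ultimately have "norm (1 - 0 :: 'k) \<le> 3 / 4" by (intro LIMSEQ_le_const2) auto
  then show False by simp
qed

end

text \<open>
  One exponent \<open>s\<close> between \<open>1 + 1/min(p, q)\<close> and \<open>3/2\<close> works for all \<open>r \<ge> p\<close>, so a single subspace does.
\<close>

theorem subspace_of_ell_failing_SK_AP:
  fixes p q :: real
  assumes "2 < p" "2 < q"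
  shows "\<exists>X :: (nat \<Rightarrow> 'k::{real_normed_field,banach}) set. closed_subspace (ell q) X \<and>
            (\<forall>r\<ge>p. \<not> SK_AP r ((ell q)\<lparr>vecs := X\<rparr>))"
proof -
  have "1 / q < 1 / 2" "1 / p < 1 / 2" using assms by (simp_all add: field_simps)
  then have "1 + max (1 / q) (1 / p) < 3 / 2" by linarith
  then obtain s where s: "1 + 1 / q < s" "1 + 1 / p < s" "s < 3 / 2"
    using dense[of "1 + max (1 / q) (1 / p)" "3 / 2"] by (metis add_less_cancel_left max.cobounded1 max.cobounded2 add_left_mono order.strict_trans1)
  have "0 < s" using s(1) assms by (smt (verit) divide_pos_pos)
  obtain a :: "nat \<Rightarrow> nat \<Rightarrow> real" where
    decay: "\<forall>s. 0 \<le> s \<and> s < 3 / 2 \<longrightarrow> (\<exists>C. \<forall>i k. \<bar>a i k\<bar> \<le> C * (real i + 1) powr (- s))"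
    and a: "\<forall>i k. a i k \<noteq> 0 \<longrightarrow> i \<le> 4 * k \<and> k \<le> 4 * i" "\<forall>i k. (\<Sum>l\<le>4 * k. a i l * a l k) = 0"
      "\<forall>i\<ge>8. a i i = 0" "(\<Sum>i<8. a i i) = 1"
    using nilpotent_matrix_with_trace_one by blast
  obtain C where C: "\<forall>i k. \<bar>a i k\<bar> \<le> C * (real i + 1) powr (- s)"
    using decay s(3) \<open>0 < s\<close> by (meson less_imp_le)
  interpret nilpotent_matrix a s C q
    using a C assms by unfold_locales auto
  have "\<not> SK_AP r ((ell q)\<lparr>vecs := left_kernel :: (nat \<Rightarrow> 'k) set\<rparr>)" if "p \<le> r" for r
  proof (rule kernel_fails_SK_AP)
    show "1 < r" using that assms by simp
    have "1 / r \<le> 1 / p" using that assms by (simp add: frac_le)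
    then show "1 + 1 / r < s" using s(2) by simp
  qed (rule s(1))
  then show ?thesis using kernel_closed by blast
qed

theorem proposition4p1:
  fixes p q :: real
  assumes "2 < p" and "2 < q"
  shows "(\<exists>X :: (nat \<Rightarrow> real) set. closed_subspace (ell q) X \<and>
            (\<forall>r\<ge>p. \<not> SK_AP r ((ell q)\<lparr>vecs := X\<rparr>)))
       \<and> (\<exists>X :: (nat \<Rightarrow> complex) set. closed_subspace (ell q) X \<and>
            (\<forall>r\<ge>p. \<not> SK_AP r ((ell q)\<lparr>vecs := X\<rparr>)))"
  using subspace_of_ell_failing_SK_AP[OF assms, where 'k = real]
    subspace_of_ell_failing_SK_AP[OF assms, where 'k = complex] by (rule conjI)

end
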